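(* Let $\Lambda=A\mathbb{Z}^d$ ($A\in\mathbb{R}^{d\times d}$ regular) be a $d$-dimensional lattice, let $\bm\alpha\in\mathbb{N}^d$, let $\bm x,\bm y\in\mathbb{R}^d$ and let $\nu\in\mathbb{C}$ be such that $\nu\neq d+|\bm\alpha|$ if both $\bm y\in\Lambda^*$ and $\chi(\bm\alpha)=1$. Then, for any $\lambda>0$, it holds that $$ Z_{\Lambda,\nu,\bm\alpha}(\bm x,\bm y) = \frac{(\pi/\lambda^2)^{\nu/2}}{\Gamma(\nu/2)} \Bigg[ \sum_{\bm z\in \Lambda-\bm x} \bm z^{\bm\alpha} G_{\nu}(\bm{z}/\lambda)e^{-2\pi i\bm y\cdot (\bm z+\bm x)} + (-2\pi i)^{-|\bm\alpha|} \frac{\lambda^{d+|\bm\alpha|}}{V_{\Lambda}}\sum_{\bm p\in\Lambda^{*}+\bm y} G^{(\bm\alpha)}_{d-\nu} (\lambda \bm p)e^{-2\pi i\bm x\cdot\bm p} \Bigg]. $$ The derivatives $G_\nu^{(\bm\alpha)}=\nabla^{\bm\alpha}G_\nu$ of the upper Crandall function are given, for all $\nu\in\mathbb{C}$, by $$ G_\nu^{(\bm\alpha)}(\bm u) = \sum_{\bm\beta\in\mathbb{N}^d,\ 2\bm\beta\le \bm\alpha}p_{\bm\alpha,\bm \beta}(\bm u)\, G_{\nu+2|\bm\alpha|-2|\bm\beta|}( \bm u), \qquad \bm u\in D . $$ Furthermore, for $\mathrm{Re}(\nu)+|\bm\alpha|<0$ and $\bm u\in\mathbb{R}^d\setminus\{\bm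 0\}$, $G_\nu^{(\bm\alpha)}(\bm u)$ extends continuously to $\bm u=\bm 0$ with $$ G_{\nu}^{(\bm\alpha)}(\bm 0)= -2\chi(\bm\alpha)\frac{p_{\bm\alpha,\bm\alpha/2}(\bm 0)}{\nu+|\bm\alpha|}, $$ where the right-hand side (which is $0$ if $\chi(\bm\alpha)=0$) forms the meromorphic continuation to $\nu\in\mathbb{C}$, with a simple pole at $\nu=-|\bm\alpha|$ if and only if $\chi(\bm\alpha)=1$. In the first formula, the value $G^{(\bm\alpha)}_{d-\nu}(\bm 0)$ (occurring when $\bm y\in\Lambda^*$) is the value of this continuation.
   Context: $\mathbb{N}=\{0,1,2,\dots\}$, $d\ge 1$ is an integer, $0^0=1$. For a multi-index $\bm\alpha\in\mathbb{N}^d$, $|\bm\alpha|=\sum_j\alpha^{(j)}$, $\bm z^{\bm\alpha}=\prod_j (z^{(j)})^{\alpha^{(j)}}$, $\nabla^{\bm\alpha}$ is the corresponding iterated partial derivative, inequalities between multi-indices are componentwise, $\binom{\bm\alpha}{\bm\beta}=\prod_j\binom{\alpha^{(j)}}{\beta^{(j)}}$; for vectors $|\cdot|$ is the Euclidean norm. $\chi(\bm\alpha)=1$ if all components of $\bm\alpha$ are even and $\chi(\bm\alpha)=0$ otherwise. For $\Lambda=A\mathbb{Z}^d$: $V_\Lambda=|\det A|$, $\Lambda^*=A^{-T}\mathbb{Z}^d$. Falling Pochhammer symbol: $(\nu)_k=\nu(\nu-1)\cdots(\nu-k+1)$, $(\nu)_0=1$, and $(\bm\alpha)_{\bm\beta}=\prod_j(\alpha^{(j)})_{\beta^{(j)}}$.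 For $2\bm\beta\le\bm\alpha$ set $$p_{\bm\alpha,\bm \beta}(\bm y)=(-\pi)^{|\bm\alpha|-|\bm \beta|}(\bm\alpha-\bm\beta)_{\bm\beta}\binom{\bm\alpha}{\bm \beta}(2\bm y)^{\bm\alpha-2 \bm \beta}.$$ Anisotropic Epstein zeta function: for $\bm x,\bm y\in\mathbb{R}^d$, $Z_{\Lambda,\nu,\bm\alpha}(\bm x,\bm y)$ is the meromorphic continuation in $\nu$ to $\mathbb{C}$ of $$\sum_{\bm z\in\Lambda,\ \bm z\ne\bm x} e^{-2\pi i\bm y\cdot\bm z}\,\frac{(\bm z-\bm x)^{\bm\alpha}}{|\bm z-\bm x|^{\nu}},\qquad \mathrm{Re}(\nu)>d+|\bm\alpha|.$$ Upper Crandall function: let $D=\{\bm u\in\mathbb{C}^d:|\mathrm{Re}(\bm u)|>|\mathrm{Im}(\bm u)|\}$ (real and imaginary parts componentwise) and $\bm z^2=\sum_j(z^{(j)})^2$, so $\mathrm{Re}(\bm z^2)>0$ on $D$. For $\nu\in\mathbb{C}$, $\bm z\in D$, $G_\nu(\bm z)=\Gamma(\nu/2,\pi\bm z^2)/(\pi\bm z^2)^{\nu/2}$ (principal branch), with $\Gamma(s,x)$, $\mathrm{Re}(x)>0$, the upper incomplete Gamma function ($\int_x^\infty t^{s-1}e^{-t}\,dt$, continued holomorphically in $s$ to $\mathbb{C}$); and $G_\nu(\bm 0)=-2/\nu$. $1/\Gamma$ is the entire reciprocal Gamma function (zero at non-positive integers); if $\nu=0$ and $\bm x\in\Lambda$,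 the term $\frac{(\pi/\lambda^2)^{\nu/2}}{\Gamma(\nu/2)}\bm 0^{\bm\alpha}G_\nu(\bm 0)$ is understood as its limit $\nu\to0$, i.e. $-1$ for $\bm\alpha=\bm 0$ and $0$ for $\bm\alpha\ne\bm 0$. *)

theory Defs
  imports "HOL-Analysis.Analysis" "HOL-Complex_Analysis.Complex_Analysis"
begin

definition mi_abs :: "nat ^ 'n \<Rightarrow> nat" where
  "mi_abs \<alpha> = (\<Sum>j\<in>UNIV. \<alpha> $ j)"

definition mi_pow :: "'a::comm_monoid_mult ^ 'n \<Rightarrow> nat ^ 'n \<Rightarrow> 'a" where
  "mi_pow z \<alpha> = (\<Prod>j\<in>UNIV. (z $ j) ^ (\<alpha> $ j))"

definition mi_binom :: "nat ^ 'n \<Rightarrow> nat ^ 'n \<Rightarrow> nat" where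
  "mi_binom \<alpha> \<beta> = (\<Prod>j\<in>UNIV. (\<alpha> $ j) choose (\<beta> $ j))"

definition falling :: "'a::comm_ring_1 \<Rightarrow> nat \<Rightarrow> 'a" where
  "falling a k = (\<Prod>i<k. a - of_nat i)"

definition mi_falling :: "nat ^ 'n \<Rightarrow> nat ^ 'n \<Rightarrow> complex" where
  "mi_falling \<alpha> \<beta> = (\<Prod>j\<in>UNIV. falling (of_nat (\<alpha> $ j)) (\<beta> $ j))"

definition chi :: "nat ^ 'n \<Rightarrow> nat" where
  "chi \<alpha> = (if \<forall>j. even (\<alpha> $ j) then 1 else 0)"

definition mi_half :: "nat ^ 'n \<Rightarrow> nat ^ 'n" where
  "mi_half \<alpha> = (\<chi> j. \<alpha> $ j div 2)"

text \<open>Only used for \<open>2\<beta> \<le> \<alpha>\<close>, so that no subtraction of natural numbers truncates.\<close>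

definition p_poly :: "nat ^ 'n \<Rightarrow> nat ^ 'n \<Rightarrow> complex ^ 'n \<Rightarrow> complex" where
  "p_poly \<alpha> \<beta> y =
     (- of_real pi) ^ (mi_abs \<alpha> - mi_abs \<beta>) * mi_falling (\<alpha> - \<beta>) \<beta>
       * of_nat (mi_binom \<alpha> \<beta>) * mi_pow (2 *s y) (\<chi> j. \<alpha> $ j - 2 * \<beta> $ j)"

definition lat :: "real ^ 'n ^ 'n \<Rightarrow> (real ^ 'n) set" where
  "lat A = range (\<lambda>k :: int ^ 'n. A *v (\<chi> j. of_int (k $ j)))"

definition dual_lat :: "real ^ 'n ^ 'n \<Rightarrow> (real ^ 'n) set" where
  "dual_lat A = lat (transpose (matrix_inv A))"

definition covol :: "real ^ 'n ^ 'n \<Rightarrow> real" where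
  "covol A = \<bar>det A\<bar>"

definition phase :: "real ^ 'n \<Rightarrow> real ^ 'n \<Rightarrow> complex" where
  "phase y z = exp (- 2 * of_real pi * \<i> * of_real (y \<bullet> z))"

definition cvec :: "real ^ 'n \<Rightarrow> complex ^ 'n" where
  "cvec x = (\<chi> j. of_real (x $ j))"

text \<open>
  Requiring \<^term>\<open>F nicely_meromorphic_on UNIV\<close> makes a continuation from a nonempty open set
  unique as a function: removable singularities are removed, and the value at a pole is 0.
\<close>

definition is_merom_cont ::
    "(complex \<Rightarrow> complex) \<Rightarrow> complex set \<Rightarrow> (complex \<Rightarrow> complex) \<Rightarrow> bool" where
  "is_merom_cont f S F \<longleftrightarrow> F nicely_meromorphic_on UNIV \<and> (\<forall>s\<in>S. F s = f s)"

definition merom_cont :: "(complex \<Rightarrow> complex) \<Rightarrow> complex set \<Rightarrow> complex \<Rightarrow> complex" where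
  "merom_cont f S = (THE F. is_merom_cont f S F)"

definition epstein_term ::
    "nat ^ 'n \<Rightarrow> real ^ 'n \<Rightarrow> real ^ 'n \<Rightarrow> complex \<Rightarrow> real ^ 'n \<Rightarrow> complex" where
  "epstein_term \<alpha> x y \<nu> z =
     phase y z * of_real (mi_pow (z - x) \<alpha>) / of_real (norm (z - x)) powr \<nu>"

definition epstein_series ::
    "real ^ 'n ^ 'n \<Rightarrow> nat ^ 'n \<Rightarrow> real ^ 'n \<Rightarrow> real ^ 'n \<Rightarrow> complex \<Rightarrow> complex" where
  "epstein_series A \<alpha> x y \<nu> = infsum (epstein_term \<alpha> x y \<nu>) (lat A - {x})"

definition epstein_halfplane :: "nat ^ 'n \<Rightarrow> complex set" where
  "epstein_halfplane \<alpha> = {\<nu>. Re \<nu> > real (CARD('n) + mi_abs \<alpha>)}"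

definition epstein_zeta ::
    "real ^ 'n ^ 'n \<Rightarrow> complex \<Rightarrow> nat ^ 'n \<Rightarrow> real ^ 'n \<Rightarrow> real ^ 'n \<Rightarrow> complex" where
  "epstein_zeta A \<nu> \<alpha> x y = merom_cont (epstein_series A \<alpha> x y) (epstein_halfplane \<alpha>) \<nu>"

text \<open>
  The integral is taken along the horizontal ray from \<open>x\<close> to infinity. For \<open>Re x > 0\<close> the
  ray avoids the branch cut and the integral converges for every complex \<open>s\<close>, so that it
  already is the holomorphic continuation in \<open>s\<close>.
\<close>

definition upper_Gamma :: "complex \<Rightarrow> complex \<Rightarrow> complex" where
  "upper_Gamma s x =
     integral {0..} (\<lambda>r :: real. (x + of_real r) powr (s - 1) * exp (- (x + of_real r)))"

definition sq_sum :: "complex ^ 'n \<Rightarrow> complex" where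
  "sq_sum z = (\<Sum>j\<in>UNIV. (z $ j)\<^sup>2)"

definition crandall_dom :: "(complex ^ 'n) set" where
  "crandall_dom = {u. norm (\<chi> j. Re (u $ j)) > norm (\<chi> j. Im (u $ j))}"

text \<open>
  Meaningful on \<^const>\<open>crandall_dom\<close> and at 0. For \<open>\<nu> = 0\<close> the value at 0 is
  the meaningless \<open>-2 / 0 = 0\<close>.
\<close>

definition crandall :: "complex \<Rightarrow> complex ^ 'n \<Rightarrow> complex" where
  "crandall \<nu> z =
     (if z = 0 then - 2 / \<nu>
      else upper_Gamma (\<nu> / 2) (of_real pi * sq_sum z) / (of_real pi * sq_sum z) powr (\<nu> / 2))"

definition pd_line :: "'n \<Rightarrow> (complex ^ 'n \<Rightarrow> complex) \<Rightarrow> complex ^ 'n \<Rightarrow> complex \<Rightarrow> complex" where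
  "pd_line j f z w = f (\<chi> i. if i = j then w else z $ i)"

definition pd :: "'n \<Rightarrow> (complex ^ 'n \<Rightarrow> complex) \<Rightarrow> complex ^ 'n \<Rightarrow> complex" where
  "pd j f z = deriv (pd_line j f z) (z $ j)"

text \<open>
  The index type carries no order, so the sequence in which the partial derivatives are
  taken is an arbitrary one; it does not matter where \<open>f\<close> is holomorphic.
\<close>

definition nabla :: "nat ^ 'n \<Rightarrow> (complex ^ 'n \<Rightarrow> complex) \<Rightarrow> complex ^ 'n \<Rightarrow> complex" where
  "nabla \<alpha> f = foldr pd (SOME js. \<forall>j. count_list js j = \<alpha> $ j) f"

text \<open>
  The limit at the origin of the derivative of the Crandall function along real arguments
  (meaningful for \<open>Re \<nu> + \<bar>\<alpha>\<bar> < 0\<close>), and the extension of the derivative to the origin by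
  meromorphic continuation of this limit in \<open>\<nu>\<close>.
\<close>

definition crandall_lim0 :: "nat ^ 'n \<Rightarrow> complex \<Rightarrow> complex" where
  "crandall_lim0 \<alpha> \<nu> = Lim (at 0) (\<lambda>u :: real ^ 'n. nabla \<alpha> (crandall \<nu>) (cvec u))"

definition crandall_deriv :: "nat ^ 'n \<Rightarrow> complex \<Rightarrow> complex ^ 'n \<Rightarrow> complex" where
  "crandall_deriv \<alpha> \<nu> u =
     (if u = 0 then merom_cont (crandall_lim0 \<alpha>) {\<mu>. Re \<mu> + real (mi_abs \<alpha>) < 0} \<nu>
      else nabla \<alpha> (crandall \<nu>) u)"

definition crandall_prefactor :: "real \<Rightarrow> complex \<Rightarrow> complex" where
  "crandall_prefactor lam \<nu> = of_real (pi / lam\<^sup>2) powr (\<nu> / 2) * rGamma (\<nu> / 2)"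

definition direct_term ::
    "nat ^ 'n \<Rightarrow> real ^ 'n \<Rightarrow> real ^ 'n \<Rightarrow> complex \<Rightarrow> real \<Rightarrow> real ^ 'n \<Rightarrow> complex" where
  "direct_term \<alpha> x y \<nu> lam z =
     of_real (mi_pow z \<alpha>) * crandall \<nu> (cvec ((1 / lam) *\<^sub>R z)) * phase y (z + x)"

definition dual_term ::
    "nat ^ 'n \<Rightarrow> real ^ 'n \<Rightarrow> complex \<Rightarrow> real \<Rightarrow> real ^ 'n \<Rightarrow> complex" where
  "dual_term \<alpha> x \<nu> lam p =
     crandall_deriv \<alpha> (of_nat CARD('n) - \<nu>) (cvec (lam *\<^sub>R p)) * phase x p"

text \<open>
  For \<open>\<nu> = 0\<close> and \<open>x\<close> in the lattice, the term of the direct sum at \<open>z = 0\<close>, multiplied by the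
  prefactor, is understood as its limit for \<open>\<nu> \<rightarrow> 0\<close>. In that case \<^const>\<open>crandall_prefactor\<close> and
  \<^term>\<open>crandall 0 0\<close> are both 0, so the following limit is simply to be added.
\<close>

definition origin_limit ::
    "real ^ 'n ^ 'n \<Rightarrow> nat ^ 'n \<Rightarrow> real ^ 'n \<Rightarrow> real ^ 'n \<Rightarrow> complex \<Rightarrow> complex" where
  "origin_limit A \<alpha> x y \<nu> =
     (if \<nu> = 0 \<and> x \<in> lat A then (if \<alpha> = 0 then - 1 else 0) * phase y x else 0)"

end

theory Submission
  imports Defs "HOL-Probability.Characteristic_Functions" "HOL-Real_Asymp.Real_Asymp"
begin

text \<open>
  Up to the factor \<open>(\<pi> / \<lambda>\<^sup>2) powr (\<nu> / 2) / \<Gamma>(\<nu> / 2)\<close>, every term of the zeta series is the Mellin integral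
  over \<open>t > 0\<close> of a Gaussian times a monomial. The part over \<open>t \<ge> 1\<close> is the Crandall function
  of the direct sum. For the part over \<open>t < 1\<close> one sums over the lattice first and
  applies Poisson summation: the Fourier transform of \<open>z\<^sup>\<alpha> exp (- \<pi> t \<bar>z\<bar>\<^sup>2)\<close> is a Hermite polynomial times
  a Gaussian, and \<open>t \<mapsto> 1 / t\<close> turns the result into the integrals over \<open>t \<ge> 1\<close> that represent the
  derivatives of the dual Crandall functions; a lattice point at the origin contributes
  \<open>- 2 / \<nu>\<close>. This gives the formula in the half-plane of convergence. Both
  sums on the right-hand side converge locally uniformly in \<open>\<nu>\<close>, so that it holds everywhere by
  uniqueness of the continuation; the poles of the two terms at the origin are either cancelled by
  \<open>1 / \<Gamma>(\<nu> / 2)\<close> or are the excluded point \<open>\<nu> = d + \<bar>\<alpha>\<bar>\<close>.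
\<close>

text \<open>The Hermite polynomials on the Fourier side and the polynomials \<open>p_poly\<close> in
  the derivatives of the Crandall function are built from the same coefficients
  \<open>p_coeff\<close>; this is what allows the transformed integrals to be read as derivatives of
  Crandall functions. In the half-plane Re \<nu> > d + |\<alpha>| the dual order satisfies Re (d -
  \<nu>) + |\<alpha>| < 0, exactly the range in which the integral of \<open>crandall_kernel\<close>
  converges at the origin, so the dual point 0 needs no regularisation there and its integral
  already is the value to be continued. The theta series runs over the whole lattice while the zeta
  series omits z = x: the omitted term is subtracted before integrating, and its integral over t < 1
  becomes the origin term of the direct sum. Poisson summation is obtained by comparing the Fourier
  coefficients of two continuous functions, the periodisation and the dual series, and is only
  needed at the single point 0. The cut at t = 1 is arbitrary; \<open>lam\<close> enters by
  rescaling t, which is why the value of the formula does not depend on it.\<close>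

no_notation Formal_Power_Series.fps_nth (infixl "$" 75)

section \<open>Exchanging sums and integrals, and integrals of products\<close>

text \<open>Enumerating the countable index set turns the unordered sum into a series, to which the
  exchange theorem for absolutely convergent series applies. Over the complex numbers unordered
  summability is absolute summability, so \<open>pt\<close> also supplies the pointwise convergence
  of the norms.\<close>

lemma infsum_lebesgue_integral:
  fixes f :: "'i \<Rightarrow> 'a \<Rightarrow> complex"
  assumes S: "countable S" and int: "\<And>i. i \<in> S \<Longrightarrow> integrable M (f i)"
    and sum: "(\<lambda>i. \<integral>x. norm (f i x) \<partial>M) summable_on S"
    and pt: "\<And>x. x \<in> space M \<Longrightarrow> (\<lambda>i. f i x) summable_on S"
  shows "integrable M (\<lambda>x. \<Sum>\<^sub>\<infinity>i\<in>S. f i x)"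
    and "((\<lambda>i. \<integral>x. f i x \<partial>M) has_sum (\<integral>x. (\<Sum>\<^sub>\<infinity>i\<in>S. f i x) \<partial>M)) S"
proof -
  have "integrable M (\<lambda>x. \<Sum>\<^sub>\<infinity>i\<in>S. f i x) \<and>
     ((\<lambda>i. \<integral>x. f i x \<partial>M) has_sum (\<integral>x. (\<Sum>\<^sub>\<infinity>i\<in>S. f i x) \<partial>M)) S"
  proof (cases "finite S")
    case True
    then show ?thesis using int by (simp add: has_sum_finite_iff)
  next
    case False
    let ?e = "from_nat_into S"
    have bij: "bij_betw ?e UNIV S"
      using S False by (rule bij_betw_from_nat_into)
    have eS: "?e n \<in> S" for n
      using bij by (auto simp: bij_betw_def)
    have s1: "summable (\<lambda>n. \<integral>x. norm (f (?e n) x) \<partial>M)"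
      using sum summable_on_reindex_bij_betw[OF bij, of "\<lambda>i. \<integral>x. norm (f i x) \<partial>M"]
      by (simp add: summable_on_imp_summable)
    have ns: "summable (\<lambda>n. norm (f (?e n) x))" if "x \<in> space M" for x
    proof -
      have "(\<lambda>n. f (?e n) x) summable_on UNIV"
        using pt[OF that] summable_on_reindex_bij_betw[OF bij, of "\<lambda>i. f i x"] by simp
      then show ?thesis
        by (metis abs_summable_summable summable_on_imp_summable summable_on_iff_abs_summable_on_complex)
    qed
    have eq: "(\<Sum>\<^sub>\<infinity>i\<in>S. f i x) = (\<Sum>n. f (?e n) x)" if "x \<in> space M" for x
    proof -
      have "(\<lambda>n. f (?e n) x) sums (\<Sum>\<^sub>\<infinity>n. f (?e n) x)"
        using pt[OF that] summable_on_reindex_bij_betw[OF bij, of "\<lambda>i. f i x"]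
        by (intro has_sum_imp_sums) simp
      then show ?thesis
        using infsum_reindex_bij_betw[OF bij, of "\<lambda>i. f i x"] by (simp add: sums_iff)
    qed
    have i1: "integrable M (\<lambda>x. \<Sum>n. f (?e n) x)"
      by (rule integrable_suminf) (use int eS ns s1 in auto)
    have i2: "(\<lambda>n. \<integral>x. f (?e n) x \<partial>M) sums (\<integral>x. (\<Sum>n. f (?e n) x) \<partial>M)"
      by (rule sums_integral) (use int eS ns s1 in auto)
    have "summable (\<lambda>n. norm (\<integral>x. f (?e n) x \<partial>M))"
      by (rule summable_comparison_test'[OF s1, of 0]) simp
    from this i2 have "((\<lambda>n. \<integral>x. f (?e n) x \<partial>M) has_sum (\<integral>x. (\<Sum>n. f (?e n) x) \<partial>M)) UNIV"
      by (rule norm_summable_imp_has_sum)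
    then have h: "((\<lambda>i. \<integral>x. f i x \<partial>M) has_sum (\<integral>x. (\<Sum>n. f (?e n) x) \<partial>M)) S"
      using has_sum_reindex_bij_betw[OF bij, of "\<lambda>i. \<integral>x. f i x \<partial>M"] by simp
    have "integrable M (\<lambda>x. \<Sum>\<^sub>\<infinity>i\<in>S. f i x)"
      using i1 by (subst Bochner_Integration.integrable_cong[OF refl eq])
    moreover have "(\<integral>x. (\<Sum>\<^sub>\<infinity>i\<in>S. f i x) \<partial>M) = (\<integral>x. (\<Sum>n. f (?e n) x) \<partial>M)"
      by (rule Bochner_Integration.integral_cong[OF refl eq])
    ultimately show ?thesis using h by simp
  qed
  then show "integrable M (\<lambda>x. \<Sum>\<^sub>\<infinity>i\<in>S. f i x)"
    "((\<lambda>i. \<integral>x. f i x \<partial>M) has_sum (\<integral>x. (\<Sum>\<^sub>\<infinity>i\<in>S. f i x) \<partial>M)) S" by blast+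
qed

lemma prod_Basis_vec:
  "(\<Prod>b\<in>(Basis :: (real ^ 'n) set). g b) = (\<Prod>j\<in>UNIV. g (axis j 1))"
proof -
  have i: "inj_on (\<lambda>j::'n. axis j (1::real)) UNIV"
    by (auto simp: inj_on_def axis_eq_axis)
  have B: "(Basis :: (real ^ 'n) set) = (\<lambda>j. axis j 1) ` UNIV"
    by (auto simp: Basis_vec_def)
  show ?thesis
    unfolding B by (subst prod.reindex[OF i]) (simp add: o_def)
qed

text \<open>\<open>lborel\<close> on vectors is the image of the product measure over the basis, so
  this is Fubini for products of functions of separate coordinates, re-indexed from coordinates to
  basis vectors.\<close>

lemma
  fixes g :: "'n::finite \<Rightarrow> real \<Rightarrow> complex"
  assumes g: "\<And>j. integrable lborel (g j)"
  shows integrable_prod_vec: "integrable lborel (\<lambda>v :: real ^ 'n. \<Prod>j\<in>UNIV. g j (v $ j))"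
    and integral_prod_vec:
      "(\<integral>v. (\<Prod>j\<in>UNIV. g j (v $ j)) \<partial>(lborel :: (real ^ 'n) measure)) = (\<Prod>j\<in>UNIV. \<integral>x. g j x \<partial>lborel)"
proof -
  \<comment> \<open>The product measure is indexed by basis vectors; as \<open>axis j 1\<close>
    determines \<open>j\<close>, each factor can be recovered from its basis vector.\<close>
  define h where "h b = g (THE j. b = axis j (1::real))" for b :: "real ^ 'n"
  have h: "h (axis j 1) = g j" for j
    by (simp add: h_def axis_eq_axis)
  have gm[measurable]: "g j \<in> borel_measurable borel" for j
    using g[of j] by (simp add: borel_measurable_integrable)
  interpret product_sigma_finite "\<lambda>_::real ^ 'n. lborel :: real measure"
    by standard
  have hint: "integrable lborel (h b)" if "b \<in> Basis" for b
    using that g by (auto simp: Basis_vec_def h)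
  have m: "(\<lambda>f. \<Sum>b\<in>Basis. f b *\<^sub>R b) \<in> measurable (Pi\<^sub>M Basis (\<lambda>b::real^'n. lborel :: real measure)) borel"
    by measurable
  have p: "(\<Prod>j\<in>UNIV. g j ((\<Sum>b\<in>Basis. f b *\<^sub>R b) $ j)) = (\<Prod>b\<in>Basis. h b (f b))"
    for f :: "real ^ 'n \<Rightarrow> real"
  proof -
    have "(\<Sum>b\<in>Basis. f b *\<^sub>R b) $ j = f (axis j 1)" for j
    proof -
      have "(\<Sum>b\<in>Basis. f b *\<^sub>R b) $ j = (\<Sum>b\<in>Basis. f b *\<^sub>R b) \<bullet> axis j 1"
        by (simp add: inner_axis)
      also have "\<dots> = f (axis j 1)"
        by (simp add: inner_sum_left_Basis)
      finally show ?thesis .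
    qed
    then show ?thesis by (simp add: prod_Basis_vec h)
  qed
  have L: "(lborel :: (real ^ 'n) measure) =
      distr (Pi\<^sub>M Basis (\<lambda>_. lborel)) borel (\<lambda>f. \<Sum>b\<in>Basis. f b *\<^sub>R b)"
    by (rule lborel_eq)
  have meas: "(\<lambda>v :: real ^ 'n. \<Prod>j\<in>UNIV. g j (v $ j)) \<in> borel_measurable borel"
    by measurable
  show "integrable lborel (\<lambda>v :: real ^ 'n. \<Prod>j\<in>UNIV. g j (v $ j))"
    unfolding L
    by (subst integrable_distr_eq[OF m meas], subst p)
      (rule product_integrable_prod[OF finite_Basis hint])
  show "(\<integral>v. (\<Prod>j\<in>UNIV. g j (v $ j)) \<partial>(lborel :: (real ^ 'n) measure)) = (\<Prod>j\<in>UNIV. \<integral>x. g j x \<partial>lborel)"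
    unfolding L
    by (subst integral_distr[OF m meas], subst p, subst product_integral_prod[OF finite_Basis hint])
       (simp_all add: prod_Basis_vec h)
qed

section \<open>Poisson summation\<close>

definition ivec :: "int ^ 'n \<Rightarrow> real ^ 'n" where
  "ivec k = (\<chi> j. of_int (k $ j))"

lemma ivec_nth [simp]: "ivec k $ j = of_int (k $ j)"
  by (simp add: ivec_def)

lemma ivec_0 [simp]: "ivec 0 = 0"
  by (simp add: vec_eq_iff)

lemma ivec_add: "ivec (k + l) = ivec k + ivec l"
  and ivec_diff: "ivec (k - l) = ivec k - ivec l"
  and ivec_minus: "ivec (- k) = - ivec k"
  by (simp_all add: vec_eq_iff)

lemma inj_ivec: "inj ivec"
  by (auto simp: inj_on_def vec_eq_iff)

lemma summable_on_int_powr: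
  assumes "s > 1"
  shows "(\<lambda>m::int. (1 + \<bar>of_int m :: real\<bar>) powr (- s)) summable_on UNIV"
proof -
  have 1: "(\<lambda>n::nat. (1 + real n) powr (- s)) summable_on UNIV"
  proof (rule norm_summable_imp_summable_on)
    have "summable (\<lambda>n. real (Suc n) powr (- s))"
      using assms by (subst summable_Suc_iff) (simp add: summable_real_powr_iff)
    then show "summable (\<lambda>n. norm ((1 + real n) powr (- s)))"
      by (simp add: add.commute)
  qed
  have 2: "(\<lambda>m::int. (1 + \<bar>of_int m :: real\<bar>) powr (- s)) summable_on range int"
    using 1 by (subst summable_on_reindex) (auto simp: o_def)
  have 3: "(\<lambda>m::int. (1 + \<bar>of_int m :: real\<bar>) powr (- s)) summable_on range (\<lambda>n. - int n)"
    using 1 by (subst summable_on_reindex) (auto simp: o_def inj_on_def)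
  have "(UNIV :: int set) = range int \<union> range (\<lambda>n. - int n)"
    by (auto intro: int_cases2)
  then show ?thesis
    using summable_on_union[OF 2 3] by simp
qed

text \<open>The power is a product of d equal factors of exponent s / d > 1. Replacing the norm by
  one coordinate in each factor bounds the series by a product of d convergent one-dimensional
  series.\<close>

lemma summable_on_ivec:
  assumes "s > real CARD('n)"
  shows "(\<lambda>k :: int ^ 'n. (1 + norm (ivec k)) powr (- s)) summable_on UNIV"
proof -
  define n where "n = real CARD('n)"
  have n: "n > 0" by (simp add: n_def)
  define g where "g m = (1 + \<bar>of_int m :: real\<bar>) powr (- (s / n))" for m :: int
  have g0: "g m \<ge> 0" for m by (simp add: g_def)
  have "s / n > 1" using assms n by (simp add: n_def field_simps)
  then have "g summable_on UNIV"
    unfolding g_def by (rule summable_on_int_powr)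
  \<comment> \<open>The theorem on products of families speaks of this notion of absolute
    summability.\<close>
  then have gas: "Infinite_Set_Sum.abs_summable_on g UNIV"
    using g0 by (subst abs_summable_equivalent[symmetric]) simp
  have "Infinite_Set_Sum.abs_summable_on (\<lambda>f. \<Prod>j\<in>(UNIV :: 'n set). g (f j)) (PiE UNIV (\<lambda>_. UNIV))"
    by (rule abs_summable_on_prod_PiE) (use gas in auto)
  moreover have "(PiE UNIV (\<lambda>_. UNIV) :: ('n \<Rightarrow> int) set) = UNIV"
    by (simp add: PiE_UNIV_domain)
  ultimately have "Infinite_Set_Sum.abs_summable_on (\<lambda>f. \<Prod>j\<in>(UNIV :: 'n set). g (f j)) UNIV"
    by (simp only:)
  then have "(\<lambda>f. \<Prod>j\<in>(UNIV :: 'n set). g (f j)) summable_on UNIV"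
    by (rule abs_summable_summable[OF abs_summable_equivalent[THEN iffD2]])
  moreover have "bij_betw (\<lambda>k :: int ^ 'n. ($) k) UNIV UNIV"
    by (rule bij_betwI[where g = "\<lambda>f. \<chi> j. f j"]) auto
  ultimately have P: "(\<lambda>k :: int ^ 'n. \<Prod>j\<in>UNIV. g (k $ j)) summable_on UNIV"
    using summable_on_reindex_bij_betw[of "\<lambda>k :: int ^ 'n. ($) k" UNIV UNIV
        "\<lambda>f. \<Prod>j\<in>(UNIV :: 'n set). g (f j)"] by simp
  show ?thesis
  proof (rule summable_on_comparison_test[OF P])
    fix k :: "int ^ 'n"
    have "(1 + norm (ivec k)) powr (- s) = (\<Prod>j\<in>(UNIV :: 'n set). (1 + norm (ivec k)) powr (- (s / n)))"
    proof -
      have "(\<Prod>j\<in>(UNIV :: 'n set). (1 + norm (ivec k)) powr (- (s / n)))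
          = ((1 + norm (ivec k)) powr (- (s / n))) ^ CARD('n)"
        by (rule prod_constant)
      also have "\<dots> = (1 + norm (ivec k)) powr (- (s / n) * n)"
      proof -
        have "1 + norm (ivec k) \<noteq> 0"
          by (smt (verit) norm_ge_zero)
        then show ?thesis
          unfolding n_def by (simp add: powr_power)
      qed
      also have "- (s / n) * n = - s" using n by simp
      finally show ?thesis by simp
    qed
    also have "\<dots> \<le> (\<Prod>j\<in>UNIV. g (k $ j))"
    proof (rule prod_mono, intro conjI)
      fix j :: 'n
      have "\<bar>of_int (k $ j)\<bar> \<le> norm (ivec k)"
        using component_le_norm_cart[of "ivec k" j] by simp
      then show "(1 + norm (ivec k)) powr (- (s / n)) \<le> g (k $ j)"
        unfolding g_def using assms n by (intro powr_mono2') (auto simp: n_def)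
    qed auto
    finally show "(1 + norm (ivec k)) powr (- s) \<le> (\<Prod>j\<in>UNIV. g (k $ j))" .
  qed auto
qed

section \<open>Characters and the unit cube\<close>

lemma phase_add_right: "phase y (v + w) = phase y v * phase y w"
  by (simp add: phase_def inner_add_right algebra_simps flip: exp_add)

lemma phase_add_left: "phase (y + z) v = phase y v * phase z v"
  by (simp add: phase_def inner_add_left algebra_simps flip: exp_add)

lemma phase_commute: "phase y z = phase z y"
  by (simp add: phase_def inner_commute)

lemma phase_0 [simp]: "phase 0 v = 1" "phase y 0 = 1"
  by (simp_all add: phase_def)

lemma norm_phase [simp]: "norm (phase y v) = 1"
  by (simp add: phase_def)

lemma phase_ivec_ivec [simp]: "phase (ivec m) (ivec k) = 1"
proof -
  have "ivec m \<bullet> ivec k = of_int (\<Sum>j\<in>UNIV. m $ j * k $ j)"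
    by (simp add: inner_vec_def)
  then have "phase (ivec m) (ivec k) = exp (2 * of_int (- (\<Sum>j\<in>UNIV. m $ j * k $ j)) * pi * \<i>)"
    unfolding phase_def by (simp add: mult_ac)
  also have "\<dots> = 1"
    by (rule exp_integer_2pi) auto
  finally show ?thesis .
qed

lemma continuous_on_phase [continuous_intros]:
  "continuous_on S f \<Longrightarrow> continuous_on S g \<Longrightarrow> continuous_on S (\<lambda>v. phase (f v) (g v))"
  unfolding phase_def by (intro continuous_intros)

lemma phase_eq_prod:
  "phase y v = (\<Prod>j\<in>UNIV. exp (- 2 * of_real pi * \<i> * of_real (y $ j * v $ j)))"
  by (simp add: phase_def inner_vec_def exp_sum sum_distrib_left flip: sum_negf)

text \<open>Half-open, so that the integer translates tile the space without overlap; centred at 0,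
  so that the origin is an interior point at which a kernel can concentrate.\<close>

definition ubox :: "(real ^ 'n) set" where
  "ubox = {v. \<forall>j. - 1 / 2 \<le> v $ j \<and> v $ j < 1 / 2}"

lemma ubox_subset_cbox: "ubox \<subseteq> cbox (\<chi> j. - 1 / 2) (\<chi> j. 1 / 2)"
proof
  fix v :: "real ^ 'a" assume "v \<in> ubox"
  then have "- 1 / 2 \<le> v $ j \<and> v $ j < 1 / 2" for j
    by (simp add: ubox_def)
  then show "v \<in> cbox (\<chi> j. - 1 / 2) (\<chi> j. 1 / 2)"
    by (simp only: mem_box_cart vec_lambda_beta) (meson less_imp_le)
qed

lemma ubox_borel [measurable]: "ubox \<in> sets borel"
proof -
  have "ubox = {v \<in> space borel. \<forall>j. - 1 / 2 \<le> v $ j \<and> v $ j < 1 / 2}"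
    by (auto simp: ubox_def)
  also have "\<dots> \<in> sets borel"
    by measurable
  finally show ?thesis .
qed

lemma zero_mem_ubox: "ball 0 (1/2) \<subseteq> ubox"
proof
  fix v :: "real ^ 'a" assume "v \<in> ball 0 (1/2)"
  then have "\<bar>v $ j\<bar> < 1/2" for j
    using component_le_norm_cart[of v j] by simp
  then show "v \<in> ubox"
    unfolding ubox_def by (smt (verit) divide_minus_left mem_Collect_eq)
qed

lemma set_integrable_ubox:
  fixes g :: "real ^ 'n \<Rightarrow> 'b :: {banach, second_countable_topology}"
  assumes "continuous_on UNIV g"
  shows "set_integrable lborel ubox g"
proof (rule set_integrable_subset)
  show "set_integrable lborel (cbox (\<chi> j. - 1 / 2) (\<chi> j. 1 / 2)) g"
    unfolding set_integrable_def
    by (rule borel_integrable_compact[OF compact_cbox continuous_on_subset[OF assms]]) auto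
qed (use ubox_subset_cbox in auto)

lemma norm_le_ubox:
  obtains R where "R > 0" "\<And>v. v \<in> ubox \<Longrightarrow> norm v \<le> R"
proof -
  have "bounded (ubox :: (real ^ 'n) set)"
    by (rule bounded_subset[OF bounded_cbox ubox_subset_cbox])
  then show ?thesis
    using that by (auto simp: bounded_pos)
qed

text \<open>
  The powers of \<open>q\<close> concentrate at 0, the only point of the closed cube where \<open>q\<close> reaches its
  maximum, so that a function orthogonal to all of them cannot be positive at 0.
\<close>

lemma concentrating_kernel:
  fixes u q :: "real ^ 'n \<Rightarrow> real"
  assumes u: "continuous_on UNIV u" and q: "continuous_on UNIV q"
    and q0: "q 0 = 1" and q1: "\<And>v. 0 \<le> q v \<and> q v \<le> 1"
    and lt: "\<And>v. v \<in> cbox (\<chi> j. - 1 / 2) (\<chi> j. 1 / 2) \<Longrightarrow> v \<noteq> 0 \<Longrightarrow> q v < 1"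
    and Z: "\<And>N. (LINT v:ubox|lborel. q v ^ N * u v) = 0"
  shows "u 0 \<le> 0"
proof (rule ccontr)
  assume "\<not> u 0 \<le> 0"
  then have u0: "u 0 > 0" by simp
  define Q :: "(real ^ 'n) set" where "Q = cbox (\<chi> j. - 1 / 2) (\<chi> j. 1 / 2)"
  have "isCont u 0"
    using u by (simp add: continuous_on_eq_continuous_at)
  then obtain d where d: "d > 0" "\<And>v. norm v < d \<Longrightarrow> \<bar>u v - u 0\<bar> < u 0 / 2"
    unfolding continuous_at_eps_delta using u0
    by (metis diff_zero dist_norm half_gt_zero real_norm_def)
  have ud: "u v > u 0 / 2" if "norm v < d" for v
    using d(2)[OF that] by linarith
  \<comment> \<open>What remains of the cube outside the ball is compact, so \<open>q\<close>
    attains a maximum below 1 there. If nothing remains, the bound 0 will do.\<close>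
  obtain r where r: "0 \<le> r" "r < 1" "\<And>v. v \<in> Q \<Longrightarrow> norm v \<ge> d \<Longrightarrow> q v \<le> r"
  proof (cases "Q - ball 0 d = {}")
    case True
    have "v \<notin> Q" if "norm v \<ge> d" for v
      using True that by auto
    then show ?thesis by (intro that[of 0]) auto
  next
    case False
    have "compact (Q - ball 0 d)"
      by (simp add: Q_def compact_diff)
    then obtain w where w: "w \<in> Q - ball 0 d" "\<And>v. v \<in> Q - ball 0 d \<Longrightarrow> q v \<le> q w"
      using continuous_attains_sup[OF _ False continuous_on_subset[OF q]] by blast
    have "w \<noteq> 0" using w d by auto
    then have "q w < 1" using lt w by (auto simp: Q_def)
    then show ?thesis
      using w q1 by (intro that[of "q w"]) auto
  qed
  \<comment> \<open>Any number strictly between \<open>r\<close> and 1 would serve: \<open>q\<close>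
    exceeds it near the origin and stays below \<open>r\<close> far away, so the ratio of the two
    contributions is a power of \<open>r / r'\<close>.\<close>
  define r' where "r' = (1 + r) / 2"
  have r': "r < r'" "r' < 1" "r' > 0" using r by (auto simp: r'_def)
  have "isCont q 0"
    using q by (simp add: continuous_on_eq_continuous_at)
  then obtain e where e: "e > 0" "\<And>v. norm v < e \<Longrightarrow> \<bar>q v - 1\<bar> < 1 - r'"
    unfolding continuous_at_eps_delta using r' q0
    by (metis diff_gt_0_iff_gt diff_zero dist_norm real_norm_def)
  have qe: "q v > r'" if "norm v < e" for v
    using e(2)[OF that] by linarith
  \<comment> \<open>The bound 1/2 keeps the ball inside \<open>ubox\<close>.\<close>
  define \<delta> where "\<delta> = min (min d e) (1/2)"
  have \<delta>: "\<delta> > 0" using d e by (simp add: \<delta>_def)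
  have "compact (u ` Q)"
    by (rule compact_continuous_image[OF continuous_on_subset[OF u]]) (auto simp: Q_def)
  then obtain M where M: "M > 0" "\<And>v. v \<in> Q \<Longrightarrow> \<bar>u v\<bar> \<le> M"
    by (metis bounded_pos compact_imp_bounded imageI real_norm_def)
  \<comment> \<open>Within distance \<delta> the integrand is at least
    \<open>u 0 / 2 * r' ^ N\<close>, up to distance \<open>d\<close> it is nonnegative, and beyond
    that the loss is at most \<open>M * r ^ N\<close>.\<close>
  have point: "(u 0 / 2 * r' ^ N) * indicator (ball (0 :: real ^ 'n) \<delta>) v - M * r ^ N \<le> q v ^ N * u v"
    if v: "v \<in> ubox" for v N
  proof -
    have vQ: "v \<in> Q" using v ubox_subset_cbox by (auto simp: Q_def)
    consider "norm v < \<delta>" | "norm v \<ge> \<delta>" "norm v < d" | "norm v \<ge> d" by linarith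
    then show ?thesis
    proof cases
      case 1
      then have "r' ^ N * (u 0 / 2) \<le> q v ^ N * u v"
        using qe[of v] ud[of v] r' u0
        by (intro mult_mono power_mono) (auto simp: \<delta>_def)
      moreover have "0 \<le> M * r ^ N" using M(1) r(1) by simp
      moreover have "u 0 / 2 * r' ^ N * indicator (ball (0 :: real ^ 'n) \<delta>) v = r' ^ N * (u 0 / 2)"
        using 1 by simp
      ultimately show ?thesis by linarith
    next
      case 2
      then have "0 \<le> q v ^ N * u v"
        using q1[of v] ud[of v] u0 by (intro mult_nonneg_nonneg) auto
      moreover have "0 \<le> M * r ^ N" using M r by simp
      ultimately show ?thesis using 2 by simp
    next
      case 3
      have "\<bar>q v ^ N * u v\<bar> \<le> r ^ N * M"
        unfolding abs_mult using r(3)[OF vQ 3] q1[of v] M(2)[OF vQ] M(1)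
        by (intro mult_mono) (auto simp: power_abs intro: power_mono)
      then have "- (M * r ^ N) \<le> q v ^ N * u v" by (simp add: mult.commute abs_le_iff)
      moreover have "norm v \<ge> \<delta>" using 3 by (simp add: \<delta>_def)
      ultimately show ?thesis by simp
    qed
  qed
  have fin: "emeasure lborel (ubox :: (real ^ 'n) set) < \<infinity>"
    by (rule emeasure_bounded_finite) (rule bounded_subset[OF bounded_cbox ubox_subset_cbox])
  have finb: "emeasure lborel (ball (0 :: real ^ 'n) \<delta>) < \<infinity>"
    by (rule emeasure_bounded_finite) simp
  define c1 where "c1 = u 0 / 2 * measure lborel (ball (0 :: real ^ 'n) \<delta>)"
  define c2 where "c2 = M * measure lborel (ubox :: (real ^ 'n) set)"
  have c1: "c1 > 0" using u0 \<delta> by (simp add: c1_def content_ball_pos)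
  have sub: "ball 0 \<delta> \<subseteq> (ubox :: (real ^ 'n) set)"
    using zero_mem_ubox by (force simp: \<delta>_def)
  have bound: "c1 * r' ^ N \<le> c2 * r ^ N" for N
  proof -
    have i1: "set_integrable lborel ubox (\<lambda>v :: real ^ 'n. q v ^ N * u v)"
      by (rule set_integrable_ubox) (intro continuous_intros u q)
    have i3: "set_integrable lborel ubox (\<lambda>v :: real ^ 'n. M * r ^ N)"
      by (rule set_integrable_ubox) (intro continuous_intros)
    have "integrable lborel (\<lambda>v :: real ^ 'n. indicator (ball (0 :: real ^ 'n) \<delta>) v *\<^sub>R (u 0 / 2 * r' ^ N))"
      by (intro integrable_scaleR_left impI integrable_real_indicator)
         (use finb in auto)
    also have "?this \<longleftrightarrow> set_integrable lborel ubox (\<lambda>v :: real ^ 'n. (u 0 / 2 * r' ^ N) * indicator (ball (0 :: real ^ 'n) \<delta>) v)"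
      unfolding set_integrable_def using sub
      by (intro Bochner_Integration.integrable_cong) (auto split: split_indicator)
    finally have i2: "set_integrable lborel ubox (\<lambda>v :: real ^ 'n. (u 0 / 2 * r' ^ N) * indicator (ball (0 :: real ^ 'n) \<delta>) v)" .
    have "(LINT v:ubox|lborel. (u 0 / 2 * r' ^ N) * indicator (ball (0 :: real ^ 'n) \<delta>) v - M * r ^ N)
          \<le> (LINT v:ubox|lborel. q v ^ N * u v)"
      by (intro set_integral_mono set_integral_diff(1) i1 i2 i3 point)
    moreover have "(LINT v:ubox|lborel. (u 0 / 2 * r' ^ N) * indicator (ball (0 :: real ^ 'n) \<delta>) v - M * r ^ N)
      = (LINT v:ubox|lborel. (u 0 / 2 * r' ^ N) * indicator (ball (0 :: real ^ 'n) \<delta>) v) - (LINT v:(ubox :: (real ^ 'n) set)|lborel. M * r ^ N)"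
      by (rule set_integral_diff(2)[OF i2 i3])
    moreover have "(LINT v:ubox|lborel. (u 0 / 2 * r' ^ N) * indicator (ball (0 :: real ^ 'n) \<delta>) v) = c1 * r' ^ N"
    proof -
      have "(LINT v:ubox|lborel. (u 0 / 2 * r' ^ N) * indicator (ball (0 :: real ^ 'n) \<delta>) v)
          = (LINT v|lborel. indicator (ball (0 :: real ^ 'n) \<delta>) v *\<^sub>R (u 0 / 2 * r' ^ N))"
        unfolding set_lebesgue_integral_def using sub
        by (intro Bochner_Integration.integral_cong) (auto split: split_indicator)
      also have "\<dots> = measure lborel (ball (0 :: real ^ 'n) \<delta>) * (u 0 / 2 * r' ^ N)"
        by (subst integral_scaleR_left) (use finb in \<open>auto intro: integrable_real_indicator\<close>)
      finally show ?thesis by (simp add: c1_def)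
    qed
    moreover have "(LINT v:(ubox :: (real ^ 'n) set)|lborel. M * r ^ N) = c2 * r ^ N"
      unfolding c2_def set_lebesgue_integral_def using fin
      by (subst integral_scaleR_left) (auto intro: integrable_real_indicator)
    ultimately show ?thesis using Z[of N] by linarith
  qed
  have "(\<lambda>N. (r / r') ^ N) \<longlonglongrightarrow> 0"
    by (rule LIMSEQ_realpow_zero) (use r r' in auto)
  then have "(\<lambda>N. c2 * (r / r') ^ N) \<longlonglongrightarrow> c2 * 0"
    by (rule tendsto_mult_left)
  moreover have "c1 \<le> c2 * (r / r') ^ N" for N
    using bound[of N] r' by (simp add: power_divide field_simps)
  ultimately have "c1 \<le> c2 * 0"
    by (intro tendsto_lowerbound) auto
  then show False using c1 by simp
qed

text \<open>
  The trigonometric polynomials \<open>q\<^sup>N\<close> with \<open>q v = (\<Prod>j. (1 + cos (2 \<pi> v\<^sub>j)) / 2)\<close> serve as the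
  concentrating kernel; this avoids Fejer sums in several variables.
\<close>

lemma ubox_coefficients_zero:
  fixes D :: "real ^ 'n \<Rightarrow> complex"
  assumes cD: "continuous_on UNIV D"
    and Z: "\<And>m. (LINT v:ubox|lborel. D v * phase (ivec m) v) = 0"
  shows "D 0 = 0"
proof (rule ccontr)
  assume D0: "D 0 \<noteq> 0"
  define q where "q v = (\<Prod>j\<in>UNIV. (1 + cos (2 * pi * v $ j)) / 2)" for v :: "real ^ 'n"
  \<comment> \<open>The quantifier over all \<open>m\<close> makes the property stable under
    multiplication by a cosine factor, which shifts \<open>m\<close> by a unit vector in either
    direction.\<close>
  define P where "P h \<longleftrightarrow> continuous_on UNIV h \<and> (\<forall>m. (LINT v:ubox|lborel. h v * (D v * phase (ivec m) v)) = 0)"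
    for h :: "real ^ 'n \<Rightarrow> complex"
  have P1: "P (\<lambda>_. 1)"
    using Z by (simp add: P_def)
  have Pj: "P (\<lambda>v. h v * of_real ((1 + cos (2 * pi * v $ j)) / 2))" if h: "P h" for h j
  proof -
    have c[continuous_intros]: "continuous_on UNIV h" using h by (simp add: P_def)
    have z: "(LINT v:ubox|lborel. h v * (D v * phase (ivec m) v)) = 0" for m
      using h by (simp add: P_def)
    have e: "of_real ((1 + cos (2 * pi * v $ j)) / 2) * phase (ivec m) v =
        phase (ivec m) v / 2 + phase (ivec (m + axis j 1)) v / 4 + phase (ivec (m - axis j 1)) v / 4"
      for m and v :: "real ^ 'n"
    proof -
      have a: "ivec (axis j 1) \<bullet> v = v $ j"
      proof -
        have "ivec (axis j 1) = (axis j 1 :: real ^ 'n)"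
          by (simp add: vec_eq_iff axis_def)
        then show ?thesis by (simp add: inner_axis')
      qed
      have "of_real (cos (2 * pi * v $ j)) = (phase (ivec (axis j 1)) v + phase (- ivec (axis j 1)) v) / 2"
        unfolding phase_def inner_minus_left a
        by (simp add: cos_exp_eq flip: cos_of_real) (simp add: mult_ac add.commute)
      then have "of_real ((1 + cos (2 * pi * v $ j)) / 2) * phase (ivec m) v
          = (1 + (phase (ivec (axis j 1)) v + phase (- ivec (axis j 1)) v) / 2) / 2 * phase (ivec m) v"
        by simp
      also have "\<dots> = phase (ivec m) v / 2 + phase (ivec m) v * phase (ivec (axis j 1)) v / 4
          + phase (ivec m) v * phase (- ivec (axis j 1)) v / 4"
        by (simp add: algebra_simps)
      finally show ?thesis
        by (simp add: ivec_add ivec_diff flip: phase_add_left)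
    qed
    have i: "set_integrable lborel ubox (\<lambda>v. h v * (D v * phase (ivec m) v) / c)" for m and c :: complex
      by (rule set_integrable_ubox) (unfold divide_inverse, intro continuous_intros cD)
    have "(LINT v:ubox|lborel. h v * of_real ((1 + cos (2 * pi * v $ j)) / 2) * (D v * phase (ivec m) v)) = 0" for m
    proof -
      have "(LINT v:ubox|lborel. h v * of_real ((1 + cos (2 * pi * v $ j)) / 2) * (D v * phase (ivec m) v))
        = (LINT v:ubox|lborel. h v * (D v * phase (ivec m) v) / 2
             + h v * (D v * phase (ivec (m + axis j 1)) v) / 4
             + h v * (D v * phase (ivec (m - axis j 1)) v) / 4)"
        using e[of _ m] by (intro set_lebesgue_integral_cong) (auto simp: algebra_simps)
      also have "\<dots> = 0"
        by (subst set_integral_add(2)[OF set_integral_add(1)] set_integral_add(2), (rule i)+)+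
           (simp add: z)
      finally show ?thesis .
    qed
    moreover have "continuous_on UNIV (\<lambda>v. h v * of_real ((1 + cos (2 * pi * v $ j)) / 2))"
      by (intro continuous_intros) auto
    ultimately show ?thesis by (simp add: P_def)
  qed
  have PJ: "P (\<lambda>v. h v * of_real (\<Prod>j\<in>J. (1 + cos (2 * pi * v $ j)) / 2))" if "P h" "finite J" for h J
    using that(2) 
  proof induction
    case empty
    then show ?case using that by simp
  next
    case (insert j J)
    from Pj[OF insert.IH, of j] show ?case
      using insert.hyps by (simp add: mult_ac)
  qed
  have PN: "P (\<lambda>v. of_real (q v ^ N))" for N
  proof (induction N)
    case 0
    then show ?case using P1 by simp
  next
    case (Suc N)
    from PJ[OF this finite_class.finite_UNIV] show ?case
      by (simp add: q_def mult_ac)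
  qed
  \<comment> \<open>Multiplying by the conjugate of \<open>D 0\<close> and taking the real part
    gives a real function with the positive value |D 0|^2 at the origin.\<close>
  define u where "u v = Re (cnj (D 0) * D v)" for v
  have "u 0 \<le> 0"
  proof (rule concentrating_kernel[where q = q])
    show "continuous_on UNIV u"
      unfolding u_def by (intro continuous_intros cD)
    show cq: "continuous_on UNIV q"
      unfolding q_def by (intro continuous_intros) auto
    show "q 0 = 1" by (simp add: q_def)
    have fac: "0 \<le> (1 + cos (2 * pi * v $ j)) / 2 \<and> (1 + cos (2 * pi * v $ j)) / 2 \<le> 1" for v :: "real ^ 'n" and j
    proof -
      have *: "0 \<le> (1 + c) / 2 \<and> (1 + c) / 2 \<le> 1" if "- 1 \<le> c" "c \<le> 1" for c :: real
        using that by auto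
      show ?thesis by (rule *[OF cos_ge_minus_one cos_le_one])
    qed
    show "0 \<le> q v \<and> q v \<le> 1" for v
      unfolding q_def using fac by (intro conjI prod_nonneg prod_le_1) auto
    show "q v < 1" if "v \<in> cbox (\<chi> j. - 1 / 2) (\<chi> j. 1 / 2)" "v \<noteq> 0" for v
    proof -
      obtain j where j: "v $ j \<noteq> 0" using \<open>v \<noteq> 0\<close> by (auto simp: vec_eq_iff)
      have vj: "\<bar>v $ j\<bar> \<le> 1/2" using that(1) by (auto simp: mem_box_cart abs_le_iff dest: spec[of _ j])
      have "cos (2 * pi * v $ j) = cos \<bar>2 * pi * v $ j\<bar>" by simp
      also have "\<dots> < cos 0"
        using j vj by (intro cos_monotone_0_pi) (auto simp: abs_mult)
      finally have "(1 + cos (2 * pi * v $ j)) / 2 < 1" by simp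
      moreover have "q v = (1 + cos (2 * pi * v $ j)) / 2 * (\<Prod>j\<in>UNIV - {j}. (1 + cos (2 * pi * v $ j)) / 2)"
        unfolding q_def by (subst prod.remove[of _ j]) auto
      moreover have "(\<Prod>j\<in>UNIV - {j}. (1 + cos (2 * pi * v $ j)) / 2) \<le> 1"
        using fac by (intro prod_le_1) auto
      moreover have "0 \<le> (\<Prod>j\<in>UNIV - {j}. (1 + cos (2 * pi * v $ j)) / 2)"
        using fac by (intro prod_nonneg) auto
      ultimately show ?thesis
        by (smt (verit) mult_left_le fac)
    qed
    show "(LINT v:ubox|lborel. q v ^ N * u v) = 0" for N
    proof -
      have "(LINT v:ubox|lborel. of_real (q v ^ N) * (D v * phase (ivec 0) v)) = 0"
        using PN[of N] unfolding P_def by blast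
      then have z: "(LINT v:ubox|lborel. of_real (q v ^ N) * D v) = 0"
        by simp
      have i: "set_integrable lborel ubox (\<lambda>v. of_real (q v ^ N) * D v)"
        by (rule set_integrable_ubox) (intro continuous_intros cD cq)
      have bl: "bounded_linear (\<lambda>z. Re (cnj (D 0) * z))"
        by (intro bounded_linear_compose[OF bounded_linear_Re] bounded_linear_mult_right)
      have "(LINT v:ubox|lborel. q v ^ N * u v) = (LINT v|lborel. Re (cnj (D 0) * (indicator ubox v *\<^sub>R (of_real (q v ^ N) * D v))))"
        unfolding set_lebesgue_integral_def
        by (rule Bochner_Integration.integral_cong) (auto simp: u_def algebra_simps)
      also have "\<dots> = Re (cnj (D 0) * (LINT v:ubox|lborel. of_real (q v ^ N) * D v))"
        unfolding set_lebesgue_integral_def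
        by (rule integral_bounded_linear[OF bl]) (use i in \<open>simp add: set_integrable_def\<close>)
      finally show ?thesis using z by simp
    qed
  qed
  moreover have "u 0 = (norm (D 0))\<^sup>2"
    by (simp only: cmod_power2) (simp add: u_def power2_eq_square)
  ultimately show False using D0 by simp
qed


text \<open>Orthogonality of the characters. Both the indicator of the cube and the character factor
  over the coordinates, and a coordinate with \<open>m $ j\<close> nonzero contributes an integral
  over full periods.\<close>

lemma set_lebesgue_integral_phase_ubox:
  fixes m :: "int ^ 'n"
  shows "(LINT v:ubox|lborel. phase (ivec m) v) = (if m = 0 then 1 else 0)"
proof -
  define g where "g j x = indicator {- 1 / 2..<1 / 2 :: real} x *\<^sub>R exp (- 2 * of_real pi * \<i> * of_real (of_int (m $ j) * x))"
    for j x
  have gj: "integrable lborel (g j)" "(LINT x|lborel. g j x) = (if m $ j = 0 then 1 else 0)" for j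
  proof -
    define e where "e x = exp (- 2 * of_real pi * \<i> * of_real (of_int (m $ j) * x))" for x
    have ce: "continuous_on S e" for S
      unfolding e_def by (intro continuous_intros)
    have i: "set_integrable lborel {- 1 / 2..1 / 2} e"
      by (rule borel_integrable_atLeastAtMost'[OF ce])
    have i': "set_integrable lborel {- 1 / 2..<1 / 2} e"
      by (rule set_integrable_subset[OF i]) auto
    then show "integrable lborel (g j)"
      unfolding set_integrable_def e_def g_def by simp
    \<comment> \<open>The fundamental theorem of calculus wants the closed interval, which differs
      from the half-open one by a null set.\<close>
    have "(LINT x|lborel. g j x) = (LINT x|lborel. indicator {- 1 / 2..1 / 2} x *\<^sub>R e x)"
    proof (rule integral_cong_AE)
      show "g j \<in> borel_measurable lborel"
        using i' unfolding set_integrable_def e_def g_def by (simp add: borel_measurable_integrable)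
      show "(\<lambda>x. indicator {- 1 / 2..1 / 2} x *\<^sub>R e x) \<in> borel_measurable lborel"
        using i unfolding set_integrable_def by (simp add: borel_measurable_integrable)
      show "AE x in lborel. g j x = indicator {- 1 / 2..1 / 2} x *\<^sub>R e x"
        using AE_lborel_singleton[of "1 / 2 :: real"]
        by eventually_elim (auto simp: g_def e_def indicator_def)
    qed
    also have "\<dots> = (if m $ j = 0 then 1 else 0)"
    proof (cases "m $ j = 0")
      case True
      then have "e = (\<lambda>_. 1)" by (simp add: e_def fun_eq_iff)
      then show ?thesis using True by simp
    next
      case False
      define a where "a = - 2 * of_real pi * \<i> * of_int (m $ j)"
      have a: "a \<noteq> 0" using False by (simp add: a_def)
      have e: "e x = exp (a * of_real x)" for x
        by (simp add: e_def a_def mult_ac)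
      have "(LINT x|lborel. indicator {- 1 / 2..1 / 2} x *\<^sub>R e x)
          = exp (a * of_real (1 / 2)) / a - exp (a * of_real (- 1 / 2)) / a"
      proof (rule integral_FTC_atLeastAtMost[where F = "\<lambda>x. exp (a * of_real x) / a"])
        show "((\<lambda>x. exp (a * of_real x) / a) has_vector_derivative e x) (at x within {- 1 / 2..1 / 2})" for x
        proof -
          have "((\<lambda>z. exp (a * z) / a) has_field_derivative exp (a * of_real x)) (at (of_real x))"
            using a by (auto intro!: derivative_eq_intros)
          then have "((\<lambda>z. exp (a * of_real z) / a) has_vector_derivative exp (a * of_real x)) (at x within {- 1 / 2..1 / 2})"
            by (intro has_vector_derivative_real_field)
          then show ?thesis by (simp add: e)
        qed
      qed (auto intro: ce)
      also have "exp (a * of_real (- 1 / 2)) = exp (a * of_real (1 / 2))"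
      proof -
        have "exp (a * of_real (- 1 / 2)) = exp (a * of_real (1 / 2)) * exp (2 * of_int (m $ j) * pi * \<i>)"
          unfolding a_def exp_add[symmetric] by (simp add: algebra_simps)
        also have "exp (2 * of_int (m $ j) * pi * \<i>) = 1"
          by (rule exp_integer_2pi) auto
        finally show ?thesis by simp
      qed
      finally show ?thesis using False by simp
    qed
    finally show "(LINT x|lborel. g j x) = (if m $ j = 0 then 1 else 0)" .
  qed
  have ind: "indicator (ubox :: (real ^ 'n) set) v = (\<Prod>j\<in>UNIV. indicator {- 1 / 2..<1 / 2 :: real} (v $ j) :: real)" for v
    by (auto simp: ubox_def indicator_def prod_zero_iff)
  have "(LINT v:ubox|lborel. phase (ivec m) v) = (LINT v|lborel. (\<Prod>j\<in>UNIV. g j (v $ j)))"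
    unfolding set_lebesgue_integral_def phase_eq_prod g_def ind
    by (rule Bochner_Integration.integral_cong) (simp_all add: scaleR_conv_of_real prod.distrib)
  also have "\<dots> = (\<Prod>j\<in>UNIV. LINT x|lborel. g j x)"
    by (rule integral_prod_vec[OF gj(1)])
  also have "\<dots> = (\<Prod>j\<in>UNIV. if m $ j = 0 then 1 else 0)"
    by (intro prod.cong refl gj)
  also have "\<dots> = (if m = 0 then 1 else 0)"
    by (auto simp: vec_eq_iff prod_zero_iff)
  finally show ?thesis .
qed

section \<open>Periodisation and the summation formula\<close>

text \<open>Peetre's inequality 1 + |w| <= (1 + |v|) (1 + |v + w|), raised to the power s. It gives
  all integer translates of a decaying function a common summable majorant on bounded sets.\<close>

lemma powr_shift_le:
  fixes v :: "'a :: real_normed_vector"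
  assumes "norm v \<le> R" "s \<ge> 0"
  shows "(1 + norm (v + w)) powr (- s) \<le> (1 + R) powr s * (1 + norm w) powr (- s)"
proof -
  have *: "norm w \<le> norm (v + w) + norm v"
    using norm_triangle_ineq4[of "v + w" v] by simp
  have "1 + norm w \<le> (1 + norm v) * (1 + norm (v + w))"
  proof -
    have "(1 + norm v) * (1 + norm (v + w)) = 1 + norm v + norm (v + w) + norm v * norm (v + w)"
      by (simp add: algebra_simps)
    moreover have "0 \<le> norm v * norm (v + w)" by simp
    moreover note *
    ultimately show ?thesis by linarith
  qed
  also have "\<dots> \<le> (1 + R) * (1 + norm (v + w))"
    using assms by (intro mult_right_mono) auto
  finally have "(1 + norm w) powr s \<le> ((1 + R) * (1 + norm (v + w))) powr s"
    using assms by (intro powr_mono2) auto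
  also have "\<dots> = (1 + R) powr s * (1 + norm (v + w)) powr s"
    by (rule powr_mult)
  finally have *: "(1 + norm w) powr s \<le> (1 + R) powr s * (1 + norm (v + w)) powr s" .
  have "0 < (1 + norm w) powr s" "0 < (1 + norm (v + w)) powr s"
    by (smt (verit) norm_ge_zero powr_gt_zero)+
  with * show ?thesis
    by (simp add: powr_minus field_simps)
qed

lemma
  fixes g :: "'a :: euclidean_space \<Rightarrow> 'b :: {banach, second_countable_topology}"
  assumes [measurable]: "g \<in> borel_measurable borel"
  shows integrable_lborel_translation: "integrable lborel (\<lambda>v. g (v + c)) \<longleftrightarrow> integrable lborel g"
    and integral_lborel_translation: "(LINT v|lborel. g (v + c)) = (LINT v|lborel. g v)"
proof -
  have "integrable (distr lborel borel ((+) c)) g \<longleftrightarrow> integrable lborel (\<lambda>v. g (c + v))"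
    by (rule integrable_distr_eq) simp_all
  then show "integrable lborel (\<lambda>v. g (v + c)) \<longleftrightarrow> integrable lborel g"
    by (simp add: lborel_distr_plus add.commute)
  have "(LINT v|distr lborel borel ((+) c). g v) = (LINT v|lborel. g (c + v))"
    by (rule integral_distr) simp_all
  then show "(LINT v|lborel. g (v + c)) = (LINT v|lborel. g v)"
    by (simp add: lborel_distr_plus add.commute)
qed

lemma continuous_on_infsum:
  fixes f :: "'i \<Rightarrow> 'a :: topological_space \<Rightarrow> 'b :: banach"
  assumes "\<And>i. i \<in> I \<Longrightarrow> continuous_on X (f i)"
    and "\<And>i x. i \<in> I \<Longrightarrow> x \<in> X \<Longrightarrow> norm (f i x) \<le> M i" "M summable_on I"
  shows "continuous_on X (\<lambda>x. \<Sum>\<^sub>\<infinity>i\<in>I. f i x)"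
proof (rule uniform_limit_theorem)
  show "uniform_limit X (\<lambda>J x. \<Sum>i\<in>J. f i x) (\<lambda>x. \<Sum>\<^sub>\<infinity>i\<in>I. f i x) (finite_subsets_at_top I)"
    by (rule Weierstrass_m_test_general) (use assms in auto)
  show "\<forall>\<^sub>F J in finite_subsets_at_top I. continuous_on X (\<lambda>x. \<Sum>i\<in>J. f i x)"
    by (rule eventually_finite_subsets_at_top_weakI) (auto intro!: continuous_on_sum assms(1))
qed simp

lemma summable_on_norm_comparison:
  fixes f :: "'i \<Rightarrow> 'b :: banach"
  assumes "g summable_on I" "\<And>i. i \<in> I \<Longrightarrow> norm (f i) \<le> g i"
  shows "f summable_on I"
  by (rule abs_summable_summable, rule summable_on_comparison_test[OF assms(1)]) (use assms(2) in auto)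

text \<open>\<open>F\<close> is the periodisation of \<open>f\<close> and \<open>S\<close> the
  Fourier series with coefficients \<open>h\<close>. Both are continuous, the first by the majorant
  for the translates and the second by the summability of \<open>h\<close>, and both have the
  coefficients \<open>h\<close> over the cube. So all coefficients of \<open>F - S\<close> vanish
  and \<open>F 0 = S 0\<close>.\<close>

theorem poisson_summation:
  fixes f :: "real ^ 'n \<Rightarrow> complex"
  assumes f: "continuous_on UNIV f"
    and decay: "\<And>v. norm (f v) \<le> C * (1 + norm v) powr (- s)" and s: "s > real CARD('n)"
    and dual: "(\<lambda>m. LINT v|lborel. f v * phase (ivec m) v) summable_on UNIV"
  shows "(\<lambda>k. f (ivec k)) summable_on UNIV"
    and "(\<Sum>\<^sub>\<infinity>k. f (ivec k)) = (\<Sum>\<^sub>\<infinity>m. LINT v|lborel. f v * phase (ivec m) v)"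
proof -
  define h where "h m = (LINT v|lborel. f v * phase (ivec m) v)" for m
  define F where "F v = (\<Sum>\<^sub>\<infinity>k. f (v + ivec k))" for v
  define S where "S v = (\<Sum>\<^sub>\<infinity>m. h m * phase (- ivec m) v)" for v
  have s0: "s \<ge> 0" using s by simp
  have "norm (f 0) \<le> C" using decay[of 0] by simp
  then have C: "C \<ge> 0" by (rule order_trans[OF norm_ge_zero])
  have fM: "norm (f (v + ivec k)) \<le> C * ((1 + R) powr s * (1 + norm (ivec k)) powr (- s))"
    if "norm v \<le> R" for v k R
    using decay[of "v + ivec k"] mult_left_mono[OF powr_shift_le[OF that s0, of "ivec k"] C] by linarith
  have Msum: "(\<lambda>k :: int ^ 'n. C * ((1 + R) powr s * (1 + norm (ivec k)) powr (- s))) summable_on UNIV" for R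
    by (intro summable_on_cmult_right summable_on_ivec s)
  have fsum: "(\<lambda>k. f (v + ivec k)) summable_on UNIV" for v
    by (rule summable_on_norm_comparison[OF Msum fM[OF order_refl]])
  then show "(\<lambda>k. f (ivec k)) summable_on UNIV" using fsum[of 0] by simp
  have cF: "continuous_on UNIV F"
  proof -
    have "isCont F v" for v
    proof -
      have "continuous_on (ball 0 (norm v + 1)) F"
        unfolding F_def
        by (rule continuous_on_infsum[OF _ fM[of _ "norm v + 1"] Msum])
           (auto intro!: continuous_intros continuous_on_compose2[OF f])
      then show ?thesis
        by (simp add: continuous_on_eq_continuous_at)
    qed
    then show ?thesis by (simp add: continuous_at_imp_continuous_on)
  qed
  have hs: "(\<lambda>m. norm (h m)) summable_on UNIV"
    using dual by (simp add: h_def summable_on_iff_abs_summable_on_complex)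
  have cS: "continuous_on UNIV S"
    unfolding S_def by (rule continuous_on_infsum[OF _ _ hs]) (auto intro!: continuous_intros simp: norm_mult)
  obtain R where R: "R > 0" "\<And>v :: real ^ 'n. v \<in> ubox \<Longrightarrow> norm v \<le> R"
    by (rule norm_le_ubox) blast
  have fin: "emeasure lborel (ubox :: (real ^ 'n) set) < \<infinity>"
    by (rule emeasure_bounded_finite) (rule bounded_subset[OF bounded_cbox ubox_subset_cbox])
  have box_norm: "(LINT v|lborel. norm (indicator ubox v *\<^sub>R g v)) \<le> B * measure lborel (ubox :: (real ^ 'n) set)"
    if "continuous_on UNIV g" "\<And>v. v \<in> ubox \<Longrightarrow> norm (g v) \<le> B" for B and g :: "real ^ 'n \<Rightarrow> complex"
  proof -
    have i1: "integrable lborel (\<lambda>v. norm (indicator ubox v *\<^sub>R g v))"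
      using set_integrable_ubox[OF that(1)] unfolding set_integrable_def by (rule integrable_norm)
    have i2: "integrable lborel (\<lambda>v. indicator (ubox :: (real ^ 'n) set) v *\<^sub>R B)"
      using fin by (intro integrable_scaleR_left impI integrable_real_indicator) auto
    have "(LINT v|lborel. norm (indicator ubox v *\<^sub>R g v)) \<le> (LINT v|lborel. indicator (ubox :: (real ^ 'n) set) v *\<^sub>R B)"
      by (rule integral_mono[OF i1 i2]) (use that(2) in \<open>auto simp: indicator_def\<close>)
    also have "\<dots> = B * measure lborel (ubox :: (real ^ 'n) set)"
      using fin by (subst integral_scaleR_left) (auto intro: integrable_real_indicator)
    finally show ?thesis .
  qed
  have coeffF: "(LINT v:ubox|lborel. F v * phase (ivec m) v) = h m" for m
  proof -
    define g where "g v = f v * phase (ivec m) v" for v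
    have cg: "continuous_on UNIV g"
      unfolding g_def by (intro continuous_intros f)
    have cgk: "continuous_on UNIV (\<lambda>v. g (v + ivec k))" for k
      by (intro continuous_on_compose2[OF cg] continuous_intros) auto
    have gk: "g (v + ivec k) = f (v + ivec k) * phase (ivec m) v" for v k
      by (simp add: g_def phase_add_right)
    let ?M = "\<lambda>k :: int ^ 'n. C * ((1 + R) powr s * (1 + norm (ivec k)) powr (- s)) * measure lborel (ubox :: (real ^ 'n) set)"
    have Ms: "?M summable_on UNIV"
      by (intro summable_on_cmult_left Msum)
    have nb: "(LINT v|lborel. norm (indicator ubox v *\<^sub>R g (v + ivec k))) \<le> ?M k" for k
      by (rule box_norm[OF cgk]) (use fM R in \<open>auto simp: gk norm_mult\<close>)
    have int1: "integrable lborel (\<lambda>v. indicator ubox v *\<^sub>R g (v + ivec k))" for k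
      using set_integrable_ubox[OF cgk] by (simp add: set_integrable_def)
    \<comment> \<open>Unfolding: the same family of integrals is summed twice, here as the integral
      of the periodisation over the cube and in \<open>H2\<close>, after translating by
      \<open>ivec k\<close>, as the integral of \<open>g\<close> over the whole space cut into
      cubes. Uniqueness of the sum identifies the two.\<close>
    have H1: "((\<lambda>k. LINT v|lborel. indicator ubox v *\<^sub>R g (v + ivec k)) has_sum
       (LINT v|lborel. (\<Sum>\<^sub>\<infinity>k. indicator ubox v *\<^sub>R g (v + ivec k)))) UNIV"
    proof (rule infsum_lebesgue_integral(2)[OF _ int1])
      show "(\<lambda>k. LINT v|lborel. norm (indicator ubox v *\<^sub>R g (v + ivec k))) summable_on UNIV"
        by (rule summable_on_comparison_test[OF Ms nb]) auto
      show "(\<lambda>k. indicator ubox v *\<^sub>R g (v + ivec k)) summable_on UNIV" for v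
        unfolding gk by (intro summable_on_scaleR_right summable_on_cmult_left fsum)
    qed auto
    have shift: "(LINT v|lborel. indicator ubox (v - ivec k) *\<^sub>R g v) = (LINT v|lborel. indicator ubox v *\<^sub>R g (v + ivec k))"
      "integrable lborel (\<lambda>v. indicator ubox (v - ivec k) *\<^sub>R g v)"
      "(LINT v|lborel. norm (indicator ubox (v - ivec k) *\<^sub>R g v)) = (LINT v|lborel. norm (indicator ubox v *\<^sub>R g (v + ivec k)))" for k
    proof -
      have gm: "(\<lambda>v. indicator ubox (v - ivec k) *\<^sub>R g v) \<in> borel_measurable borel"
        using borel_measurable_continuous_onI[OF cg] by measurable
      show "(LINT v|lborel. indicator ubox (v - ivec k) *\<^sub>R g v) = (LINT v|lborel. indicator ubox v *\<^sub>R g (v + ivec k))"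
        using integral_lborel_translation[OF gm, of "ivec k"] by simp
      show "integrable lborel (\<lambda>v. indicator ubox (v - ivec k) *\<^sub>R g v)"
        using integrable_lborel_translation[OF gm, of "ivec k"] int1[of k] by simp
      show "(LINT v|lborel. norm (indicator ubox (v - ivec k) *\<^sub>R g v)) = (LINT v|lborel. norm (indicator ubox v *\<^sub>R g (v + ivec k)))"
        using integral_lborel_translation[OF measurable_compose[OF gm borel_measurable_norm], of "ivec k"] by simp
    qed
    \<comment> \<open>The integer point is found by rounding each coordinate to the nearest integer,
      halves upwards, which is how the half-open cube selects it.\<close>
    have ex1: "\<exists>!k. v - ivec k \<in> ubox" for v :: "real ^ 'n"
    proof (rule ex1I[of _ "\<chi> j. \<lfloor>v $ j + 1/2\<rfloor>"])
      show "v - ivec (\<chi> j. \<lfloor>v $ j + 1/2\<rfloor>) \<in> ubox"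
        unfolding ubox_def mem_Collect_eq
      proof
        fix j :: 'n
        show "- 1 / 2 \<le> (v - ivec (\<chi> j. \<lfloor>v $ j + 1/2\<rfloor>)) $ j \<and> (v - ivec (\<chi> j. \<lfloor>v $ j + 1/2\<rfloor>)) $ j < 1 / 2"
          using floor_correct[of "v $ j + 1/2"] by simp linarith
      qed
      fix k assume k: "v - ivec k \<in> ubox"
      have "k $ j = \<lfloor>v $ j + 1/2\<rfloor>" for j
      proof -
        have "- 1 / 2 \<le> (v - ivec k) $ j \<and> (v - ivec k) $ j < 1 / 2"
          using k unfolding ubox_def by blast
        then show ?thesis by (intro floor_unique[symmetric]) auto
      qed
      then show "k = (\<chi> j. \<lfloor>v $ j + 1/2\<rfloor>)" by (simp add: vec_eq_iff)
    qed
    have pt: "((\<lambda>k. indicator ubox (v - ivec k) *\<^sub>R g v) has_sum g v) UNIV" for v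
    proof -
      obtain k0 where k0: "v - ivec k0 \<in> ubox" "\<And>k. v - ivec k \<in> ubox \<Longrightarrow> k = k0"
        using ex1[of v] by blast
      have "((\<lambda>k. indicator ubox (v - ivec k) *\<^sub>R g v) has_sum g v) {k0}"
        using has_sum_finite[of "{k0}" "\<lambda>k. indicator ubox (v - ivec k) *\<^sub>R g v"] k0(1) by simp
      moreover have "indicator ubox (v - ivec k) *\<^sub>R g v = 0" if "k \<noteq> k0" for k
        using k0(2)[of k] that by (auto simp: indicator_def)
      ultimately show ?thesis
        using has_sum_cong_neutral[of UNIV "{k0}" "\<lambda>k. indicator ubox (v - ivec k) *\<^sub>R g v"
            "\<lambda>k. indicator ubox (v - ivec k) *\<^sub>R g v" "g v"] by auto
    qed
    have H2: "((\<lambda>k. LINT v|lborel. indicator ubox (v - ivec k) *\<^sub>R g v) has_sum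
       (LINT v|lborel. (\<Sum>\<^sub>\<infinity>k. indicator ubox (v - ivec k) *\<^sub>R g v))) UNIV"
    proof (rule infsum_lebesgue_integral(2)[OF _ shift(2)])
      show "(\<lambda>k. LINT v|lborel. norm (indicator ubox (v - ivec k) *\<^sub>R g v)) summable_on UNIV"
        unfolding shift(3) by (rule summable_on_comparison_test[OF Ms nb]) auto
      show "(\<lambda>k. indicator ubox (v - ivec k) *\<^sub>R g v) summable_on UNIV" for v
        using pt by (rule has_sum_imp_summable)
    qed auto
    have "(LINT v:ubox|lborel. F v * phase (ivec m) v) = (LINT v|lborel. (\<Sum>\<^sub>\<infinity>k. indicator ubox v *\<^sub>R g (v + ivec k)))"
      unfolding set_lebesgue_integral_def F_def gk
      by (rule Bochner_Integration.integral_cong)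
         (simp_all add: infsum_scaleR_right infsum_cmult_left fsum)
    also have "\<dots> = (LINT v|lborel. (\<Sum>\<^sub>\<infinity>k. indicator ubox (v - ivec k) *\<^sub>R g v))"
      using H1 H2 unfolding shift(1) by (rule has_sum_unique)
    also have "\<dots> = h m"
      unfolding h_def g_def[symmetric] by (simp add: infsumI[OF pt])
    finally show ?thesis .
  qed
  have coeffS: "(LINT v:ubox|lborel. S v * phase (ivec m) v) = h m" for m
  proof -
    have c: "continuous_on UNIV (\<lambda>v. h l * phase (ivec (m - l)) v)" for l
      by (intro continuous_intros)
    \<comment> \<open>Multiplying the series by the character of frequency \<open>m\<close> turns
      frequency \<open>- l\<close> into \<open>m - l\<close>; after integration orthogonality leaves
      only \<open>l = m\<close>.\<close>
    have H: "((\<lambda>l. LINT v|lborel. indicator ubox v *\<^sub>R (h l * phase (ivec (m - l)) v)) has_sum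
       (LINT v|lborel. (\<Sum>\<^sub>\<infinity>l. indicator ubox v *\<^sub>R (h l * phase (ivec (m - l)) v)))) UNIV"
    proof (rule infsum_lebesgue_integral(2))
      show "integrable lborel (\<lambda>v. indicator ubox v *\<^sub>R (h l * phase (ivec (m - l)) v))" for l
        using set_integrable_ubox[OF c] by (simp add: set_integrable_def)
      show "(\<lambda>l. LINT v|lborel. norm (indicator ubox v *\<^sub>R (h l * phase (ivec (m - l)) v))) summable_on UNIV"
        by (rule summable_on_comparison_test[OF summable_on_cmult_left[OF hs] box_norm[OF c]])
           (auto simp: norm_mult)
      show "(\<lambda>l. indicator ubox v *\<^sub>R (h l * phase (ivec (m - l)) v)) summable_on UNIV" for v
        by (intro summable_on_scaleR_right summable_on_norm_comparison[OF hs]) (simp add: norm_mult)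
    qed auto
    have "(\<Sum>\<^sub>\<infinity>l. indicator ubox v *\<^sub>R (h l * phase (ivec (m - l)) v)) = indicator ubox v *\<^sub>R (S v * phase (ivec m) v)" for v
    proof -
      have "(\<lambda>l. h l * phase (- ivec l) v) summable_on UNIV"
        by (rule summable_on_norm_comparison[OF hs]) (simp add: norm_mult)
      then have "S v * phase (ivec m) v = (\<Sum>\<^sub>\<infinity>l. h l * phase (- ivec l) v * phase (ivec m) v)"
        unfolding S_def by (intro infsum_cmult_left[symmetric])
      moreover have "h l * phase (ivec (m - l)) v = h l * phase (- ivec l) v * phase (ivec m) v" for l
        by (simp add: ivec_diff mult.assoc flip: phase_add_left)
      ultimately show ?thesis
        by (simp only: infsum_scaleR_right)
    qed
    then have "(LINT v:ubox|lborel. S v * phase (ivec m) v) =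
        (\<Sum>\<^sub>\<infinity>l. LINT v|lborel. indicator ubox v *\<^sub>R (h l * phase (ivec (m - l)) v))"
      unfolding set_lebesgue_integral_def using infsumI[OF H] by simp
    also have "\<dots> = (\<Sum>\<^sub>\<infinity>l. if l = m then h m else 0)"
    proof (rule infsum_cong)
      fix l
      have "(LINT v|lborel. indicator ubox v *\<^sub>R (h l * phase (ivec (m - l)) v)) = h l * (LINT v:ubox|lborel. phase (ivec (m - l)) v)"
        unfolding set_lebesgue_integral_def by (simp flip: mult_scaleR_right)
      also have "\<dots> = (if l = m then h m else 0)"
        by (simp add: set_lebesgue_integral_phase_ubox)
      finally show "(LINT v|lborel. indicator ubox v *\<^sub>R (h l * phase (ivec (m - l)) v)) = (if l = m then h m else 0)" .
    qed
    also have "\<dots> = (\<Sum>\<^sub>\<infinity>l\<in>{m}. h m)"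
      by (rule infsum_cong_neutral) auto
    also have "\<dots> = h m" by simp
    finally show ?thesis .
  qed
  have "F 0 - S 0 = 0"
  proof (rule ubox_coefficients_zero)
    show "continuous_on UNIV (\<lambda>v. F v - S v)"
      by (intro continuous_intros cF cS)
    show "(LINT v:ubox|lborel. (F v - S v) * phase (ivec m) v) = 0" for m
    proof -
      have "set_integrable lborel ubox (\<lambda>v. F v * phase (ivec m) v)"
        "set_integrable lborel ubox (\<lambda>v. S v * phase (ivec m) v)"
        by (intro set_integrable_ubox continuous_intros cF cS)+
      then show ?thesis
        by (simp add: left_diff_distrib set_integral_diff coeffF coeffS)
    qed
  qed
  then show "(\<Sum>\<^sub>\<infinity>k. f (ivec k)) = (\<Sum>\<^sub>\<infinity>m. LINT v|lborel. f v * phase (ivec m) v)"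
    by (simp add: F_def S_def h_def)
qed

section \<open>Fourier transforms of Gaussians times monomials\<close>

text \<open>The scalar belonging to one coordinate of \<open>p_poly\<close>;
  \<open>p_poly_eq_prod\<close> recovers the polynomial as the product of these scalars and the
  powers of the variables.\<close>

definition p_coeff :: "nat \<Rightarrow> nat \<Rightarrow> complex" where
  "p_coeff n k = (- of_real pi) ^ (n - k) * falling (of_nat (n - k)) k * of_nat (n choose k) * 2 ^ (n - 2 * k)"

text \<open>
  Up to the scaling by \<open>s\<close> this is a Hermite polynomial: the \<open>n\<close>-th derivative of
  \<open>exp (- \<pi> s x\<^sup>2)\<close> is \<open>hermite_gauss n s x * exp (- \<pi> s x\<^sup>2)\<close>.
\<close>

definition hermite_gauss :: "nat \<Rightarrow> complex \<Rightarrow> complex \<Rightarrow> complex" where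
  "hermite_gauss n s x = (\<Sum>k | 2 * k \<le> n. p_coeff n k * x ^ (n - 2 * k) * s ^ (n - k))"

lemma finite_double_le [simp]: "finite {k :: nat. 2 * k \<le> n}"
  by (rule finite_subset[of _ "{..n}"]) auto

lemma falling_of_nat: "k \<le> n \<Longrightarrow> falling (of_nat n) k = (fact n / fact (n - k) :: complex)"
proof (induction k)
  case 0
  then show ?case by (simp add: falling_def)
next
  case (Suc k)
  have "falling (of_nat n) (Suc k) = falling (of_nat n) k * (of_nat (n - k) :: complex)"
    using Suc.prems by (simp add: falling_def of_nat_diff)
  also have "\<dots> = fact n / fact (n - k) * of_nat (n - k)"
    using Suc by simp
  also have "fact (n - k) = of_nat (n - k) * (fact (n - Suc k) :: complex)"
    using Suc.prems by (subst fact_reduce) auto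
  finally show ?case using Suc.prems by simp
qed

text \<open>The factorial of n - k cancels between the falling factorial and the binomial
  coefficient. What remains is the usual Hermite coefficient n! / (k! (n - 2k)!), from which both
  recurrences below can be read off.\<close>

lemma p_coeff_eq:
  assumes "2 * k \<le> n"
  shows "p_coeff n k = (- of_real pi) ^ (n - k) * 2 ^ (n - 2 * k) * (fact n / (fact k * fact (n - 2 * k)))"
proof -
  have "falling (of_nat (n - k)) k = (fact (n - k) / fact (n - k - k) :: complex)"
    by (rule falling_of_nat) (use assms in auto)
  moreover have "(of_nat (n choose k) :: complex) = fact n / (fact k * fact (n - k))"
    by (rule binomial_fact) (use assms in auto)
  moreover have "n - k - k = n - 2 * k" by simp
  ultimately show ?thesis
    by (simp add: p_coeff_def mult_ac)
qed

text \<open>The product rule in coefficients: the first summand comes from differentiating the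
  Gaussian, the second from differentiating the power of x in the term of index k - 1. It drives the
  Hermite recurrence as well as the derivatives of the Crandall function.\<close>

lemma p_coeff_recurrence:
  assumes "2 * k \<le> Suc n"
  shows "p_coeff (Suc n) k * x ^ (Suc n - 2 * k) =
    - 2 * of_real pi * x * (if 2 * k \<le> n then p_coeff n k * x ^ (n - 2 * k) else 0) +
    (if k = 0 then 0 else p_coeff n (k - 1) * (of_nat (n - 2 * (k - 1)) * x ^ (n - 2 * (k - 1) - 1)))"
proof -
  \<comment> \<open>At the lower end there is no term of index k - 1, at the upper end 2k = n + 1
    there is no term of index k; in between both contribute.\<close>
  consider "k = 0" | "k > 0" "2 * k \<le> n" | "k > 0" "2 * k = Suc n"
    using assms by linarith
  then show ?thesis
  proof cases
    case 1
    then show ?thesis by (simp add: p_coeff_eq del: fact_Suc)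
  next
    case 2
    obtain l where k: "k = Suc l" using 2 by (cases k) auto
    obtain m where n: "n = 2 * k + m" using le_Suc_ex[OF 2(2)] by blast
    have e: "n - 2 * (k - 1) = Suc (Suc m)" "Suc n - 2 * k = Suc m" "n - 2 * k = m"
      "Suc n - k = Suc (k + m)" "n - k = k + m" "n - (k - 1) = Suc (k + m)" "k - 1 = l"
      using k n by auto
    have f: "of_nat (Suc (2 * k + m)) = (of_nat (Suc m) + 2 * of_nat k :: complex)"
      by simp
    have "p_coeff (Suc n) k = (- of_real pi) ^ Suc (k + m) * 2 ^ Suc m * (of_nat (Suc n) * fact n / (fact k * fact (Suc m)))"
      using assms by (simp add: p_coeff_eq e del: power_Suc fact_Suc) (simp add: fact_Suc)
    \<comment> \<open>The split Suc n = Suc m + 2 k: the first share cancels against the factorial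
      of Suc m, the second against that of k.\<close>
    also have "(of_nat (Suc n) * fact n / (fact k * fact (Suc m)) :: complex)
        = fact n / (fact k * fact m) + 2 * (fact n * of_nat (Suc (Suc m)) / (fact l * fact (Suc (Suc m))))"
    proof -
      have nz: "(fact k :: complex) \<noteq> 0" "(fact l :: complex) \<noteq> 0" "(fact m :: complex) \<noteq> 0"
        "(of_nat (Suc m) :: complex) \<noteq> 0" "(of_nat (Suc (Suc m)) :: complex) \<noteq> 0" "(of_nat k :: complex) \<noteq> 0"
        using k by (simp_all del: of_nat_Suc)
      have fs: "(fact k :: complex) = of_nat k * fact l" "(fact (Suc m) :: complex) = of_nat (Suc m) * fact m"
        "(fact (Suc (Suc m)) :: complex) = of_nat (Suc (Suc m)) * (of_nat (Suc m) * fact m)"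
        unfolding k by (simp_all add: algebra_simps)
      have "(of_nat (Suc n) :: complex) = of_nat (Suc m) + 2 * of_nat k"
        by (simp add: n)
      then show ?thesis
        unfolding fs using nz by (simp add: field_simps del: of_nat_Suc)
    qed
    finally have c: "p_coeff (Suc n) k = (- of_real pi) ^ Suc (k + m) * 2 ^ Suc m *
       (fact n / (fact k * fact m) + 2 * (fact n / (fact l * fact (Suc (Suc m))) * of_nat (Suc (Suc m))))"
      by (simp only: times_divide_eq_left)
    have c1: "p_coeff n k = (- of_real pi) ^ (k + m) * 2 ^ m * (fact n / (fact k * fact m))"
      using 2 by (simp add: p_coeff_eq e)
    have c2: "p_coeff n (k - 1) = (- of_real pi) ^ Suc (k + m) * 2 ^ Suc (Suc m) * (fact n / (fact l * fact (Suc (Suc m))))"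
    proof -
      have "n - l = Suc (k + m)" "n - 2 * l = Suc (Suc m)" "2 * l \<le> n" using k n by auto
      then show ?thesis
        unfolding e(7) by (simp add: p_coeff_eq del: power_Suc fact_Suc)
    qed
    have alg: "P * (- pc) * 2 ^ Suc m * (F + 2 * (G * M)) * x ^ Suc m =
       - 2 * pc * x * (P * 2 ^ m * F * x ^ m) + P * (- pc) * 2 ^ Suc (Suc m) * G * (M * x ^ Suc m)"
      for P F G M pc :: complex
      by (simp add: algebra_simps)
    have k0: "(k = 0) = False" "(2 * k \<le> n) = True" using 2 by auto
    show ?thesis
      using alg[of "(- of_real pi) ^ (k + m)" "of_real pi"]
      by (simp only: k0 if_True if_False e(1-3) c c1 c2 diff_Suc_1 power_Suc2[of "- of_real pi"])
  next
    case 3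
    obtain l where k: "k = Suc l" using 3 by (cases k) auto
    with 3 have n: "n = 2 * l + 1" by simp
    have f: "(fact (Suc n) :: complex) = 2 * of_nat k * fact n"
      using 3 by (simp add: fact_Suc) (metis Suc_eq_plus1 of_nat_Suc of_nat_mult of_nat_numeral)
    have fk: "(fact k :: complex) = of_nat k * fact l" by (simp add: k)
    have "(of_nat k :: complex) \<noteq> 0" using k by (simp del: of_nat_Suc)
    have "p_coeff (Suc n) k = (- of_real pi) ^ (Suc n - k) * (fact (Suc n) / fact k)"
      using 3 by (simp add: p_coeff_eq del: fact_Suc)
    also have "\<dots> = (- of_real pi) ^ (Suc n - k) * (2 * (fact n / fact l))"
      unfolding f fk using \<open>(of_nat k :: complex) \<noteq> 0\<close> by simp
    also have "\<dots> = p_coeff n (k - 1)"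
      using k n by (simp add: p_coeff_eq)
    finally show ?thesis using 3 k n by simp
  qed
qed

text \<open>The Appell property of Hermite polynomials, coefficient by coefficient: differentiation
  lowers the degree by one and multiplies by -2 \<pi> n. For 2k = n the left side vanishes through
  its factor n - 2k.\<close>

lemma p_coeff_appell:
  assumes "2 * k \<le> n" "n > 0"
  shows "p_coeff n k * of_nat (n - 2 * k) = - 2 * of_real pi * of_nat n * (if 2 * k \<le> n - 1 then p_coeff (n - 1) k else 0)"
proof (cases "2 * k \<le> n - 1")
  case True
  obtain m where "n - 1 = 2 * k + m" using le_Suc_ex[OF True] by blast
  with assms(2) have n: "n = Suc (2 * k + m)" by simp
  have e: "n - 2 * k = Suc m" "n - k = Suc (k + m)" "n - 1 = 2 * k + m" "2 * k + m - k = k + m" "2 * k + m - 2 * k = m"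
    using n by auto
  have nz: "(of_nat (Suc m) :: complex) \<noteq> 0" by (simp del: of_nat_Suc)
  have "p_coeff n k * of_nat (n - 2 * k) = (- of_real pi) ^ Suc (k + m) * 2 ^ Suc m * (fact n / (fact k * fact (Suc m))) * of_nat (Suc m)"
    using assms by (simp add: p_coeff_eq e del: fact_Suc of_nat_Suc power_Suc)
  also have "\<dots> = (- of_real pi) ^ Suc (k + m) * 2 ^ Suc m * (of_nat n * fact (2 * k + m) / (fact k * fact m))"
    using nz by (simp add: n fact_Suc del: of_nat_Suc power_Suc)
  also have "\<dots> = - 2 * of_real pi * of_nat n * p_coeff (n - 1) k"
  proof -
    have "p_coeff (2 * k + m) k = (- of_real pi) ^ (k + m) * 2 ^ m * (fact (2 * k + m) / (fact k * fact m))"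
      by (simp add: p_coeff_eq e)
    then show ?thesis unfolding e(3) by simp
  qed
  finally show ?thesis using True by simp
next
  case False
  then have "n = 2 * k" using assms by auto
  then show ?thesis using False by simp
qed

lemma hermite_gauss_0 [simp]: "hermite_gauss 0 s x = 1"
  by (simp add: hermite_gauss_def p_coeff_def falling_def)

lemma sum_double_shift:
  fixes F :: "nat \<Rightarrow> complex"
  shows "(\<Sum>k | 2 * k \<le> Suc n. if k = 0 then 0 else F (k - 1)) = (\<Sum>k | 2 * Suc k \<le> Suc n. F k)"
proof -
  have "{k. 2 * k \<le> Suc n} = insert 0 (Suc ` {k. 2 * Suc k \<le> Suc n})"
  proof (intro equalityI subsetI)
    fix k assume "k \<in> {k. 2 * k \<le> Suc n}"
    then show "k \<in> insert 0 (Suc ` {k. 2 * Suc k \<le> Suc n})"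
      by (cases k) auto
  qed auto
  moreover have "finite {k. 2 * Suc k \<le> Suc n}"
    by (rule finite_subset[of _ "{..n}"]) auto
  ultimately show ?thesis
    by (simp add: sum.reindex)
qed

text \<open>The coefficient recurrence expresses the next polynomial by the present one and its
  derivative, and the Appell property trades the derivative for the polynomial before. This is the
  shape in which integration by parts delivers the Fourier integrals. For \<open>n = 0\<close> the
  truncated index \<open>n - 1\<close> is multiplied by 0.\<close>

lemma hermite_gauss_Suc:
  "hermite_gauss (Suc n) s x = - 2 * of_real pi * s * x * hermite_gauss n s x
     - 2 * of_real pi * s * of_nat n * hermite_gauss (n - 1) s x"
proof -
  have "hermite_gauss (Suc n) s x = (\<Sum>k | 2 * k \<le> Suc n.
      (if 2 * k \<le> n then - 2 * of_real pi * s * x * (p_coeff n k * x ^ (n - 2 * k) * s ^ (n - k)) else 0) +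
      (if k = 0 then 0 else - 2 * of_real pi * s * of_nat n * ((if 2 * (k - 1) \<le> n - 1 then p_coeff (n - 1) (k - 1) else 0)
         * x ^ (n - 1 - 2 * (k - 1)) * s ^ (n - 1 - (k - 1)))))"
    unfolding hermite_gauss_def
  proof (rule sum.cong)
    fix k assume "k \<in> {k. 2 * k \<le> Suc n}"
    then have k: "2 * k \<le> Suc n" by simp
    have 1: "s ^ (Suc n - k) = s * s ^ (n - k)" if "2 * k \<le> n"
      using that by (simp add: Suc_diff_le)
    have 2: "s ^ (Suc n - k) = s * s ^ (n - 1 - (k - 1))" if "k > 0"
    proof -
      have "Suc n - k = Suc (n - 1 - (k - 1))" using that k by simp
      then show ?thesis by simp
    qed
    have 3: "p_coeff n (k - 1) * (of_nat (n - 2 * (k - 1)) * x ^ (n - 2 * (k - 1) - 1)) =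
       - 2 * of_real pi * of_nat n * (if 2 * (k - 1) \<le> n - 1 then p_coeff (n - 1) (k - 1) else 0) * x ^ (n - 1 - 2 * (k - 1))" if "k > 0"
    proof -
      have "n > 0" "2 * (k - 1) \<le> n" using that k by auto
      moreover have "n - 2 * (k - 1) - 1 = n - 1 - 2 * (k - 1)" by simp
      ultimately show ?thesis
        using p_coeff_appell[of "k - 1" n] by (simp only: mult.assoc[symmetric])
    qed
    show "p_coeff (Suc n) k * x ^ (Suc n - 2 * k) * s ^ (Suc n - k) =
      (if 2 * k \<le> n then - 2 * of_real pi * s * x * (p_coeff n k * x ^ (n - 2 * k) * s ^ (n - k)) else 0) +
      (if k = 0 then 0 else - 2 * of_real pi * s * of_nat n * ((if 2 * (k - 1) \<le> n - 1 then p_coeff (n - 1) (k - 1) else 0)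
         * x ^ (n - 1 - 2 * (k - 1)) * s ^ (n - 1 - (k - 1))))"
      unfolding p_coeff_recurrence[OF k] distrib_right
    proof (rule arg_cong2[of _ _ _ _ "(+)"])
      show "- 2 * of_real pi * x * (if 2 * k \<le> n then p_coeff n k * x ^ (n - 2 * k) else 0) * s ^ (Suc n - k) =
        (if 2 * k \<le> n then - 2 * of_real pi * s * x * (p_coeff n k * x ^ (n - 2 * k) * s ^ (n - k)) else 0)"
        using 1 by simp
      show "(if k = 0 then 0 else p_coeff n (k - 1) * (of_nat (n - 2 * (k - 1)) * x ^ (n - 2 * (k - 1) - 1))) * s ^ (Suc n - k) =
        (if k = 0 then 0 else - 2 * of_real pi * s * of_nat n * ((if 2 * (k - 1) \<le> n - 1 then p_coeff (n - 1) (k - 1) else 0)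
         * x ^ (n - 1 - 2 * (k - 1)) * s ^ (n - 1 - (k - 1))))"
      proof (cases "k = 0")
        case False
        then have k0: "k > 0" by simp
        show ?thesis
          unfolding if_not_P[OF False] 3[OF k0] 2[OF k0] by (simp only: mult_ac)
      qed simp
    qed
  qed simp
  also have "\<dots> = (\<Sum>k | 2 * k \<le> Suc n.
      (if 2 * k \<le> n then - 2 * of_real pi * s * x * (p_coeff n k * x ^ (n - 2 * k) * s ^ (n - k)) else 0)) +
      (\<Sum>k | 2 * k \<le> Suc n. (if k = 0 then 0 else - 2 * of_real pi * s * of_nat n * ((if 2 * (k - 1) \<le> n - 1 then p_coeff (n - 1) (k - 1) else 0)
         * x ^ (n - 1 - 2 * (k - 1)) * s ^ (n - 1 - (k - 1)))))"
    by (rule sum.distrib)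
  also have "(\<Sum>k | 2 * k \<le> Suc n.
      (if 2 * k \<le> n then - 2 * of_real pi * s * x * (p_coeff n k * x ^ (n - 2 * k) * s ^ (n - k)) else 0))
      = - 2 * of_real pi * s * x * hermite_gauss n s x"
    unfolding hermite_gauss_def sum_distrib_left
    by (rule sum.mono_neutral_cong_right) auto
  also have "(\<Sum>k | 2 * k \<le> Suc n. (if k = 0 then 0 else - 2 * of_real pi * s * of_nat n * ((if 2 * (k - 1) \<le> n - 1 then p_coeff (n - 1) (k - 1) else 0)
         * x ^ (n - 1 - 2 * (k - 1)) * s ^ (n - 1 - (k - 1))))) =
     (\<Sum>k | 2 * Suc k \<le> Suc n. - 2 * of_real pi * s * of_nat n * ((if 2 * k \<le> n - 1 then p_coeff (n - 1) k else 0)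
         * x ^ (n - 1 - 2 * k) * s ^ (n - 1 - k)))"
    by (rule sum_double_shift)
  also have "\<dots> = - 2 * of_real pi * s * of_nat n * hermite_gauss (n - 1) s x"
  proof (cases "n = 0")
    case False
    then have "{k. 2 * Suc k \<le> Suc n} = {k. 2 * k \<le> n - 1}" by auto
    then show ?thesis
      unfolding hermite_gauss_def sum_distrib_left by (intro sum.cong) auto
  qed simp
  finally show ?thesis by simp
qed

section \<open>Fourier integrals in one variable\<close>

lemma power_le_fact_exp:
  fixes x :: real
  assumes "x \<ge> 0"
  shows "x ^ N \<le> fact N * exp x"
proof -
  have "(\<Sum>n\<in>{N}. x ^ n /\<^sub>R fact n) \<le> (\<Sum>n. x ^ n /\<^sub>R fact n)"
    by (rule sum_le_suminf[OF summable_exp_generic]) (use assms in auto)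
  then have "x ^ N / fact N \<le> exp x"
    by (simp add: exp_def divide_inverse mult.commute)
  then show ?thesis by (simp add: field_simps)
qed

text \<open>The power is at most N! exp (1 + r), and completing the square bounds 1 + r - t r^2 by 1
  + 1 / (4t); this is the origin of the constant.\<close>

lemma gaussian_decay:
  assumes "t > 0"
  obtains C where "C > 0" "\<And>r :: real. r \<ge> 0 \<Longrightarrow> (1 + r) ^ N * exp (- t * r\<^sup>2) \<le> C"
proof (rule that)
  show "fact N * exp (1 + 1 / (4 * t)) > (0 :: real)" by simp
  fix r :: real assume r: "r \<ge> 0"
  have "(1 + r) ^ N * exp (- t * r\<^sup>2) \<le> fact N * exp (1 + r) * exp (- t * r\<^sup>2)"
    using r by (intro mult_right_mono power_le_fact_exp) auto
  also have "\<dots> = fact N * exp (1 + r - t * r\<^sup>2)"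
    by (simp add: exp_add exp_diff exp_minus field_simps)
  also have "\<dots> \<le> fact N * exp (1 + 1 / (4 * t))"
  proof -
    have "0 \<le> t * (r - 1 / (2 * t))\<^sup>2" using assms by simp
    also have "\<dots> = t * r\<^sup>2 - r + 1 / (4 * t)"
      using assms by (simp add: power2_eq_square field_simps)
    finally show ?thesis by simp
  qed
  finally show "(1 + r) ^ N * exp (- t * r\<^sup>2) \<le> fact N * exp (1 + 1 / (4 * t))" .
qed

definition gauss_wave :: "nat \<Rightarrow> real \<Rightarrow> real \<Rightarrow> real \<Rightarrow> complex" where
  "gauss_wave n t \<xi> x = of_real (x ^ n * exp (- pi * t * x\<^sup>2)) * exp (- 2 * of_real pi * \<i> * of_real (\<xi> * x))"

lemma gauss_wave_alt:
  "gauss_wave n t \<xi> x = of_real x ^ n * exp (- of_real pi * of_real t * (of_real x)\<^sup>2) *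
     exp (- 2 * of_real pi * \<i> * (of_real \<xi> * of_real x))"
proof -
  have "of_real (exp (- pi * t * x\<^sup>2)) = exp (- of_real pi * of_real t * (of_real x)\<^sup>2 :: complex)"
    by (simp flip: exp_of_real)
  then show ?thesis by (simp only: gauss_wave_def of_real_mult of_real_power)
qed

lemma continuous_on_gauss_wave: "continuous_on S (gauss_wave n t \<xi>)"
  unfolding gauss_wave_def by (intro continuous_intros)

text \<open>With c = sqrt (2 \<pi> t) the Gaussian is a multiple of the standard normal density at c
  x, whose moments are integrable; the oscillating factor has modulus 1.\<close>

lemma integrable_gauss_wave:
  assumes t: "t > 0"
  shows "integrable lborel (gauss_wave n t \<xi>)"
proof -
  define c where "c = sqrt (2 * pi * t)"
  have c: "c > 0" using t by (simp add: c_def)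
  have c2: "c\<^sup>2 = 2 * pi * t" using t by (simp add: c_def)
  have "integrable lborel (\<lambda>x. std_normal_density (0 + c * x) * (0 + c * x) ^ n)"
    by (rule lborel_integrable_real_affine[OF integrable_std_normal_moment]) (use c in simp)
  then have "integrable lborel (\<lambda>x. (sqrt (2 * pi) / c ^ n) * (std_normal_density (c * x) * (c * x) ^ n))"
    by simp
  also have "(\<lambda>x. (sqrt (2 * pi) / c ^ n) * (std_normal_density (c * x) * (c * x) ^ n)) = (\<lambda>x. x ^ n * exp (- pi * t * x\<^sup>2))"
    using c by (auto simp: std_normal_density_def power_mult_distrib c2 fun_eq_iff field_simps)
  finally have "integrable lborel (\<lambda>x. x ^ n * exp (- pi * t * x\<^sup>2))" .
  then show ?thesis
    by (rule Bochner_Integration.integrable_bound)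
       (use borel_measurable_continuous_onI[OF continuous_on_gauss_wave] in \<open>auto simp: gauss_wave_def norm_mult simp del: of_real_mult of_real_power\<close>)
qed

text \<open>This is the characteristic function of the standard normal distribution at u = -2 \<pi>
  \<xi> / c, after the substitution x -> c x with c = sqrt (2 \<pi> t).\<close>

lemma gauss_wave_base:
  assumes t: "t > 0"
  shows "(LINT x|lborel. gauss_wave 0 t \<xi> x) = of_real (exp (- pi * \<xi>\<^sup>2 / t) / sqrt t)"
proof -
  define c where "c = sqrt (2 * pi * t)"
  have c: "c > 0" using t by (simp add: c_def)
  have c2: "c\<^sup>2 = 2 * pi * t" using t by (simp add: c_def)
  define u where "u = - 2 * pi * \<xi> / c"
  have "of_real (exp (- u\<^sup>2 / 2)) = char std_normal_distribution u"
    by (simp add: char_std_normal_distribution)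
  also have "\<dots> = (LINT x|lborel. std_normal_density x *\<^sub>R iexp (u * x))"
    unfolding char_def by (subst integral_density) auto
  also have "\<dots> = \<bar>c\<bar> *\<^sub>R (LINT x|lborel. std_normal_density (0 + c * x) *\<^sub>R iexp (u * (0 + c * x)))"
    by (rule lborel_integral_real_affine) (use c in simp)
  also have "(\<lambda>x. std_normal_density (0 + c * x) *\<^sub>R iexp (u * (0 + c * x))) = (\<lambda>x. of_real (1 / sqrt (2 * pi)) * gauss_wave 0 t \<xi> x)"
  proof
    fix x :: real
    have "- (c * x)\<^sup>2 / 2 = - pi * t * x\<^sup>2"
      by (simp add: power_mult_distrib c2)
    then have 1: "std_normal_density (0 + c * x) = 1 / sqrt (2 * pi) * exp (- pi * t * x\<^sup>2)"
      unfolding std_normal_density_def by simp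
    have 2: "u * (0 + c * x) = - 2 * pi * (\<xi> * x)" using c by (simp add: u_def)
    show "std_normal_density (0 + c * x) *\<^sub>R iexp (u * (0 + c * x)) = of_real (1 / sqrt (2 * pi)) * gauss_wave 0 t \<xi> x"
    proof -
      have "iexp (- 2 * pi * (\<xi> * x)) = exp (- 2 * of_real pi * \<i> * of_real (\<xi> * x))"
        by (rule arg_cong[where f = exp]) simp
      then show ?thesis
        unfolding 1 2 gauss_wave_def by (simp only: scaleR_conv_of_real of_real_mult power_0 mult_1 mult.assoc)
    qed
  qed
  finally have "of_real (exp (- u\<^sup>2 / 2)) = of_real (c / sqrt (2 * pi)) * (LINT x|lborel. gauss_wave 0 t \<xi> x)"
    using c by (simp add: scaleR_conv_of_real)
  moreover have "c / sqrt (2 * pi) = sqrt t" by (simp add: c_def real_sqrt_mult)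
  moreover have "- u\<^sup>2 / 2 = - pi * \<xi>\<^sup>2 / t"
  proof -
    have "u\<^sup>2 = 4 * pi\<^sup>2 * \<xi>\<^sup>2 / (2 * pi * t)"
      by (simp add: u_def power_divide power_mult_distrib c2)
    then show ?thesis using t by (simp add: power2_eq_square)
  qed
  ultimately have "of_real (exp (- pi * \<xi>\<^sup>2 / t)) = of_real (sqrt t) * (LINT x|lborel. gauss_wave 0 t \<xi> x)"
    by (simp only:)
  then show ?thesis using t
    by (simp add: eq_divide_eq mult.commute)
qed

text \<open>Integration by parts without boundary terms: \<open>f\<close> is the derivative of
  \<open>gauss_wave n t \<xi>\<close>, which tends to 0 at both ends, so the integral of
  \<open>f\<close> vanishes.\<close>

lemma gauss_wave_recurrence:
  assumes t: "t > 0"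
  shows "2 * of_real (pi * t) * (LINT x|lborel. gauss_wave (Suc n) t \<xi> x) =
     of_nat n * (LINT x|lborel. gauss_wave (n - 1) t \<xi> x) - 2 * of_real pi * \<i> * of_real \<xi> * (LINT x|lborel. gauss_wave n t \<xi> x)"
proof -
  define f where "f x = of_nat n * gauss_wave (n - 1) t \<xi> x - 2 * of_real pi * \<i> * of_real \<xi> * gauss_wave n t \<xi> x
     - 2 * of_real (pi * t) * gauss_wave (Suc n) t \<xi> x" for x
  have int: "integrable lborel f"
    unfolding f_def by (intro Bochner_Integration.integrable_diff integrable_mult_right integrable_gauss_wave t)
  \<comment> \<open>The exponent \<open>Suc n\<close> is one more than boundedness of the wave asks
    for; the surplus factor 1 / (1 + |x|) forces the limit 0.\<close>
  obtain C where C: "C > 0" "\<And>r :: real. r \<ge> 0 \<Longrightarrow> (1 + r) ^ Suc n * exp (- (pi * t) * r\<^sup>2) \<le> C"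
    using gaussian_decay[of "pi * t" "Suc n"] t by auto
  have bound: "norm (gauss_wave n t \<xi> x) \<le> C / (1 + \<bar>x\<bar>)" for x
  proof -
    have "norm (gauss_wave n t \<xi> x) = \<bar>x\<bar> ^ n * exp (- (pi * t) * \<bar>x\<bar>\<^sup>2)"
      by (simp add: gauss_wave_def norm_mult norm_power abs_mult power_abs)
    also have "\<dots> \<le> (1 + \<bar>x\<bar>) ^ n * exp (- (pi * t) * \<bar>x\<bar>\<^sup>2)"
      by (intro mult_right_mono power_mono) auto
    also have "\<dots> = (1 + \<bar>x\<bar>) ^ Suc n * exp (- (pi * t) * \<bar>x\<bar>\<^sup>2) / (1 + \<bar>x\<bar>)"
      by simp
    also have "\<dots> \<le> C / (1 + \<bar>x\<bar>)"
      by (intro divide_right_mono C) auto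
    finally show ?thesis .
  qed
  have lim: "(gauss_wave n t \<xi> \<longlongrightarrow> 0) F" if "filterlim abs at_top F" for F
  proof (rule Lim_null_comparison)
    show "((\<lambda>x. C / (1 + \<bar>x\<bar>)) \<longlongrightarrow> 0) F"
      by (intro tendsto_divide_0[OF tendsto_const] filterlim_at_top_imp_at_infinity
           filterlim_tendsto_add_at_top[OF tendsto_const] that)
  qed (use bound in auto)
  have "(LBINT x=-\<infinity>..\<infinity>. f x) = 0 - 0"
  proof (rule interval_integral_FTC_integrable)
    show "(gauss_wave n t \<xi> has_vector_derivative f x) (at x)" for x
    proof -
      have "((\<lambda>z. z ^ n * exp (- of_real pi * of_real t * z\<^sup>2) * exp (- 2 * of_real pi * \<i> * (of_real \<xi> * z))) has_field_derivative
         f x) (at (of_real x))"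
        unfolding f_def gauss_wave_alt
        by (rule derivative_eq_intros refl | simp)+ (simp add: algebra_simps)
      then have "((\<lambda>z. of_real z ^ n * exp (- of_real pi * of_real t * (of_real z)\<^sup>2) * exp (- 2 * of_real pi * \<i> * (of_real \<xi> * of_real z)))
         has_vector_derivative f x) (at x)"
        by (rule has_vector_derivative_real_field)
      also have "(\<lambda>z. of_real z ^ n * exp (- of_real pi * of_real t * (of_real z)\<^sup>2) * exp (- 2 * of_real pi * \<i> * (of_real \<xi> * of_real z)))
         = gauss_wave n t \<xi>"
        by (rule ext) (simp only: gauss_wave_alt)
      finally show ?thesis .
    qed
    show "isCont f x" for x
      unfolding f_def gauss_wave_alt by (intro continuous_intros)
    show "set_integrable lborel (einterval (-\<infinity>) \<infinity>) f"
      using int by (simp add: set_integrable_def)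
    show "((gauss_wave n t \<xi> \<circ> real_of_ereal) \<longlongrightarrow> 0) (at_right (-\<infinity>))"
      unfolding ereal_tendsto_simps
    proof (rule lim)
      have "\<forall>x\<le>- Z. Z \<le> \<bar>x\<bar>" for Z :: real by auto
      then show "filterlim (abs :: real \<Rightarrow> real) at_top at_bot"
        unfolding filterlim_at_top eventually_at_bot_linorder by blast
    qed
    show "((gauss_wave n t \<xi> \<circ> real_of_ereal) \<longlongrightarrow> 0) (at_left \<infinity>)"
      unfolding ereal_tendsto_simps by (rule lim) (rule filterlim_abs_real)
  qed simp
  then have "(LINT x|lborel. f x) = 0"
    by (simp add: interval_lebesgue_integral_def set_lebesgue_integral_def)
  also have "(LINT x|lborel. f x) = of_nat n * (LINT x|lborel. gauss_wave (n - 1) t \<xi> x) - 2 * of_real pi * \<i> * of_real \<xi> * (LINT x|lborel. gauss_wave n t \<xi> x)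
     - 2 * of_real (pi * t) * (LINT x|lborel. gauss_wave (Suc n) t \<xi> x)"
    unfolding f_def using integrable_gauss_wave[OF t, of _ \<xi>]
    by (subst Bochner_Integration.integral_diff, intro Bochner_Integration.integrable_diff integrable_mult_right, simp_all)
  finally show ?thesis by simp
qed

text \<open>Multiplied by the powers of -2 \<pi> i, the integrals satisfy the Hermite recurrence
  with s = 1 / t. Strong induction is used because the recurrence reaches back two steps.\<close>

lemma integral_gauss_wave:
  assumes t: "t > 0"
  shows "(LINT x|lborel. gauss_wave n t \<xi> x) =
    hermite_gauss n (1 / of_real t) (of_real \<xi>) * of_real (exp (- pi * \<xi>\<^sup>2 / t) / sqrt t) / (- 2 * of_real pi * \<i>) ^ n"
proof (induction n rule: less_induct)
  case (less n)
  define E where "E = complex_of_real (exp (- pi * \<xi>\<^sup>2 / t) / sqrt t)"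
  define a where "a = - 2 * complex_of_real pi * \<i>"
  have a: "a \<noteq> 0" by (simp add: a_def)
  show ?case
  proof (cases n)
    case 0
    then show ?thesis using gauss_wave_base[OF t] by simp
  next
    case (Suc m)
    define I where "I k = (LINT x|lborel. gauss_wave k t \<xi> x)" for k
    define H where "H k = hermite_gauss k (1 / of_real t) (of_real \<xi>)" for k
    have IH: "I k = H k * E / a ^ k" if "k \<le> m" for k
      using less[of k] that Suc unfolding I_def H_def E_def a_def by simp
    have t0: "complex_of_real t \<noteq> 0" using t by simp
    \<comment> \<open>Divided by 2 \<pi> t, this square becomes -2 \<pi> / t, the factor in the
      Hermite recurrence at s = 1 / t.\<close>
    have a2: "a * a = - 4 * of_real pi * of_real pi" by (simp add: a_def)
    have R: "2 * of_real (pi * t) * I (Suc m) = of_nat m * I (m - 1) + a * of_real \<xi> * I m"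
      using gauss_wave_recurrence[OF t, of m \<xi>] by (simp add: I_def a_def)
    have HS: "H (Suc m) = - 2 * of_real pi * (1 / of_real t) * of_real \<xi> * H m
        - 2 * of_real pi * (1 / of_real t) * of_nat m * H (m - 1)"
      unfolding H_def by (rule hermite_gauss_Suc)
    have m1: "of_nat m * I (m - 1) = of_nat m * H (m - 1) * E * a / a ^ m"
      using a IH[of "m - 1"] by (cases m) (simp_all add: field_simps)
    have "2 * of_real (pi * t) * I (Suc m) * a ^ Suc m = (of_nat m * H (m - 1) * E * a + a * of_real \<xi> * (H m * E)) * a"
      unfolding R m1 using IH[of m] a by (simp add: field_simps)
    also have "\<dots> = (of_nat m * H (m - 1) * E + of_real \<xi> * (H m * E)) * (a * a)"
      by (simp add: algebra_simps)
    also have "\<dots> = 2 * of_real (pi * t) * (H (Suc m) * E)"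
      unfolding HS a2 using t0 by (simp add: field_simps)
    finally have "I (Suc m) * a ^ Suc m = H (Suc m) * E"
      using t0 by (simp add: mult.assoc del: power_Suc)
    moreover have "a ^ Suc m \<noteq> 0" using a by simp
    ultimately have "I (Suc m) = H (Suc m) * E / a ^ Suc m"
      by (metis nonzero_eq_divide_eq)
    then show ?thesis
      unfolding Suc I_def H_def E_def a_def .
  qed
qed

section \<open>Linear changes of variables\<close>

lemma matrix_inv_left_cancel [simp]:
  assumes "invertible (A :: real ^ 'n ^ 'n)"
  shows "matrix_inv A *v (A *v v) = v" "A *v (matrix_inv A *v v) = v"
proof -
  have "A ** matrix_inv A = mat 1 \<and> matrix_inv A ** A = mat 1"
    using assms unfolding invertible_def matrix_inv_def by (rule someI_ex)
  then show "matrix_inv A *v (A *v v) = v" "A *v (matrix_inv A *v v) = v"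
    by (simp_all add: matrix_vector_mul_assoc)
qed

text \<open>Lebesgue measure is determined by its values on boxes. The preimage of a box is its
  image under the inverse matrix, whose volume is smaller by the factor |det A|, and the density
  compensates for that.\<close>

lemma lborel_linear_image:
  fixes A :: "real ^ 'n :: {finite, wellorder} ^ 'n :: _"
  assumes A: "invertible A"
  shows "lborel = density (distr lborel borel ((*v) A)) (\<lambda>_. ennreal \<bar>det A\<bar>)"
proof (rule lborel_eqI)
  fix l u :: "real ^ 'n :: {finite, wellorder}"
  assume lu: "\<And>b. b \<in> Basis \<Longrightarrow> l \<bullet> b \<le> u \<bullet> b"
  let ?B = "matrix_inv A"
  have [measurable]: "(*v) A \<in> borel_measurable borel"
    by (intro borel_measurable_continuous_onI linear_continuous_on matrix_vector_mul_bounded_linear)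
  have vi: "(*v) A -` box l u = (*v) ?B ` box l u"
    using A by (auto simp: image_iff) (metis matrix_inv_left_cancel(1))
  have m: "(*v) A -` box l u \<in> sets borel"
    using measurable_sets[of "(*v) A" borel borel "box l u"] by simp
  have "A ** ?B = mat 1"
    using A unfolding invertible_def matrix_inv_def by (rule someI2_ex) auto
  then have "det A * det ?B = 1"
    by (simp flip: det_mul)
  then have d: "\<bar>det A\<bar> * \<bar>det ?B\<bar> = 1" by (simp flip: abs_mult)
  have "measure lebesgue ((*v) ?B ` box l u) = \<bar>det (matrix ((*v) ?B))\<bar> * measure lebesgue (box l u)"
    by (rule measure_linear_image) simp_all
  moreover have lm: "(*v) ?B ` box l u \<in> lmeasurable"
    by (rule measurable_linear_image) simp_all
  ultimately have "measure lebesgue ((*v) A -` box l u) = \<bar>det ?B\<bar> * (\<Prod>b\<in>Basis. (u - l) \<bullet> b)"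
    using lu by (simp add: vi matrix_of_matrix_vector_mul)
  moreover have "emeasure lborel ((*v) A -` box l u) = ennreal (measure lebesgue ((*v) A -` box l u))"
    using emeasure_eq_measure2[OF lm] m by (simp add: vi)
  ultimately have "emeasure lborel ((*v) A -` box l u) = ennreal (\<bar>det ?B\<bar> * (\<Prod>b\<in>Basis. (u - l) \<bullet> b))"
    by simp
  moreover have "emeasure (density (distr lborel borel ((*v) A)) (\<lambda>_. ennreal \<bar>det A\<bar>)) (box l u)
     = ennreal \<bar>det A\<bar> * emeasure lborel ((*v) A -` box l u)"
    by (subst emeasure_density_const) (auto simp: emeasure_distr)
  ultimately show "emeasure (density (distr lborel borel ((*v) A)) (\<lambda>_. ennreal \<bar>det A\<bar>)) (box l u)
     = ennreal (\<Prod>b\<in>Basis. (u - l) \<bullet> b)"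
    using d by (simp flip: ennreal_mult' add: mult.assoc[symmetric])
qed simp

lemma integral_lborel_linear_wellorder:
  fixes A :: "real ^ 'n :: {finite, wellorder} ^ 'n :: _" and g :: "real ^ 'n :: _ \<Rightarrow> complex"
  assumes A: "invertible A" and g: "g \<in> borel_measurable borel"
  shows "\<bar>det A\<bar> *\<^sub>R (LINT v|lborel. g (A *v v)) = (LINT w|lborel. g w)"
proof -
  have [measurable]: "(*v) A \<in> borel_measurable borel"
    by (intro borel_measurable_continuous_onI linear_continuous_on matrix_vector_mul_bounded_linear)
  have "(LINT w|lborel. g w) = (LINT w|density (distr lborel borel ((*v) A)) (\<lambda>_. ennreal \<bar>det A\<bar>). g w)"
    using lborel_linear_image[OF A] by simp
  also have "\<dots> = (LINT w|distr lborel borel ((*v) A). \<bar>det A\<bar> *\<^sub>R g w)"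
    using g by (subst integral_density) auto
  also have "\<dots> = (LINT v|lborel. \<bar>det A\<bar> *\<^sub>R g (A *v v))"
    using g by (subst integral_distr) auto
  finally show ?thesis by simp
qed

text \<open>
  The change of variables theorems of the library ask for an index type of class
  \<^class>\<open>wellorder\<close>; this copy of a finite type is in that class, and the results are carried back.
\<close>

typedef 'a ranked = "UNIV :: 'a set"
  morphisms unrank ranked_of by simp

lemma unrank_ranked_of [simp]: "unrank (ranked_of x) = x" "ranked_of (unrank i) = i"
  by (simp_all add: ranked_of_inverse unrank_inverse)

lemma bij_unrank: "bij unrank"
  by (rule bij_betwI[where g = ranked_of]) auto

instance ranked :: (finite) finite
proof
  have "surj (ranked_of :: 'a \<Rightarrow> 'a ranked)"
    by (rule surjI[where f = unrank]) simp
  then show "finite (UNIV :: 'a ranked set)"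
    using finite_surj[OF finite_class.finite_UNIV, of "UNIV :: 'a ranked set" ranked_of] by simp
qed

instantiation ranked :: (finite) wellorder
begin

definition less_eq_ranked :: "'a ranked \<Rightarrow> 'a ranked \<Rightarrow> bool" where
  "less_eq_ranked x y \<longleftrightarrow> to_nat (unrank x) \<le> to_nat (unrank y)"

definition less_ranked :: "'a ranked \<Rightarrow> 'a ranked \<Rightarrow> bool" where
  "less_ranked x y \<longleftrightarrow> to_nat (unrank x) < to_nat (unrank y)"

instance
proof
  fix P :: "'a ranked \<Rightarrow> bool" and a
  assume step: "\<And>x. (\<And>y. y < x \<Longrightarrow> P y) \<Longrightarrow> P x"
  show "P a"
    by (induction "to_nat (unrank a)" arbitrary: a rule: less_induct)
       (rule step, simp add: less_ranked_def)
qed (auto simp: less_eq_ranked_def less_ranked_def unrank_inject)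

end

text \<open>Conjugating a transposition by the bijection gives a transposition, so a decomposition
  into transpositions keeps its length and hence its parity.\<close>

lemma sign_conjugate:
  assumes "permutation p"
  shows "sign (ranked_of \<circ> p \<circ> unrank) = sign p"
proof -
  have sw: "swapidseq n (ranked_of \<circ> p \<circ> unrank)" if "swapidseq n p" for n and p :: "'a \<Rightarrow> 'a"
    using that
  proof induction
    case id
    have "ranked_of \<circ> id \<circ> unrank = (id :: 'a ranked \<Rightarrow> 'a ranked)"
      by (rule ext) simp
    then show ?case by (simp only: swapidseq.id)
  next
    case (comp_Suc n p a b)
    have "ranked_of \<circ> (Transposition.transpose a b \<circ> p) \<circ> unrank
        = Transposition.transpose (ranked_of a) (ranked_of b) \<circ> (ranked_of \<circ> p \<circ> unrank)"
      by (auto simp: fun_eq_iff Transposition.transpose_def ranked_of_inject)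
    moreover have "ranked_of a \<noteq> ranked_of b"
      using comp_Suc.hyps by (simp add: ranked_of_inject)
    then have "swapidseq (Suc n) (Transposition.transpose (ranked_of a) (ranked_of b) \<circ> (ranked_of \<circ> p \<circ> unrank))"
      by (rule swapidseq.comp_Suc[OF comp_Suc.IH])
    ultimately show ?case by (simp only:)
  qed
  obtain n where n: "swapidseq n p" using assms by (auto simp: permutation_def)
  have "evenperm (ranked_of \<circ> p \<circ> unrank) = evenperm p"
    using evenperm_unique[OF n refl] evenperm_unique[OF sw[OF n] refl] by simp
  then show ?thesis by (simp add: sign_def)
qed

text \<open>Conjugation by \<open>unrank\<close> is a bijection between the two permutation groups;
  it preserves the signs and, after re-indexing, the products in the Leibniz formula.\<close>

lemma det_ranked:
  fixes A :: "real ^ 'n ^ 'n"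
  shows "det (\<chi> i j. A $ unrank i $ unrank j) = det A"
proof -
  let ?c = "\<lambda>p :: 'n \<Rightarrow> 'n. ranked_of \<circ> p \<circ> unrank"
  have bij: "bij_betw ?c {p. p permutes UNIV} {p. p permutes UNIV}"
  proof (rule bij_betwI[where g = "\<lambda>q. unrank \<circ> q \<circ> ranked_of"])
    have br: "bij ranked_of"
      by (rule bij_betwI[where g = unrank]) auto
    show "?c \<in> {p. p permutes UNIV} \<rightarrow> {p. p permutes UNIV}"
    proof (rule funcsetI)
      fix p :: "'n \<Rightarrow> 'n" assume "p \<in> {p. p permutes UNIV}"
      then have "bij p" by (simp add: permutes_bij)
      then have "bij (?c p)" by (intro bij_comp br bij_unrank)
      then show "?c p \<in> {p. p permutes UNIV}" by (intro CollectI bij_imp_permutes) simp_all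
    qed
    show "(\<lambda>q :: 'n ranked \<Rightarrow> 'n ranked. unrank \<circ> q \<circ> ranked_of) \<in> {p. p permutes UNIV} \<rightarrow> {p. p permutes UNIV}"
    proof (rule funcsetI)
      fix q :: "'n ranked \<Rightarrow> 'n ranked" assume "q \<in> {p. p permutes UNIV}"
      then have "bij q" by (simp add: permutes_bij)
      then have "bij (unrank \<circ> q \<circ> ranked_of)" by (intro bij_comp br bij_unrank)
      then show "unrank \<circ> q \<circ> ranked_of \<in> {p. p permutes UNIV}" by (intro CollectI bij_imp_permutes) simp_all
    qed
  qed (auto simp: fun_eq_iff)
  have "det (\<chi> i j. A $ unrank i $ unrank j) =
      (\<Sum>p | p permutes UNIV. of_int (sign (?c p)) * (\<Prod>i\<in>UNIV. A $ unrank i $ unrank (?c p i)))"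
    unfolding det_def by (subst sum.reindex_bij_betw[OF bij, symmetric]) simp
  also have "\<dots> = (\<Sum>p | p permutes UNIV. of_int (sign p) * (\<Prod>i\<in>UNIV. A $ i $ p i))"
  proof (rule sum.cong)
    fix p :: "'n \<Rightarrow> 'n" assume "p \<in> {p. p permutes UNIV}"
    then have "sign (?c p) = sign p"
      by (intro sign_conjugate) (auto simp: permutation_permutes)
    moreover have "(\<Prod>i\<in>UNIV. A $ unrank i $ unrank (?c p i)) = (\<Prod>i\<in>UNIV. A $ i $ p i)"
      using prod.reindex_bij_betw[OF bij_unrank, of "\<lambda>i. A $ i $ p i"] by simp
    ultimately show "of_int (sign (?c p)) * (\<Prod>i\<in>UNIV. A $ unrank i $ unrank (?c p i)) = of_int (sign p) * (\<Prod>i\<in>UNIV. A $ i $ p i)"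
      by simp
  qed simp
  finally show ?thesis by (simp add: det_def)
qed

lemma lborel_ranked:
  "(lborel :: (real ^ 'n) measure) = distr lborel borel (\<lambda>w :: real ^ 'n ranked. \<chi> i. w $ ranked_of i)"
proof (rule lborel_eqI)
  let ?g = "\<lambda>w :: real ^ 'n ranked. (\<chi> i. w $ ranked_of i) :: real ^ 'n"
  have [measurable]: "?g \<in> borel_measurable borel"
    by (intro borel_measurable_continuous_onI continuous_intros)
  fix l u :: "real ^ 'n"
  assume lu: "\<And>b. b \<in> Basis \<Longrightarrow> l \<bullet> b \<le> u \<bullet> b"
  have lu': "l $ i \<le> u $ i" for i
    using lu[of "axis i 1"] by (simp add: inner_axis)
  let ?l = "\<chi> i. l $ unrank i" and ?u = "\<chi> i. u $ unrank i"
  have "?g -` box l u = box ?l ?u"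
  proof (rule set_eqI)
    fix w
    have "(\<forall>i. l $ i < w $ ranked_of i \<and> w $ ranked_of i < u $ i) \<longleftrightarrow>
        (\<forall>i. l $ unrank i < w $ i \<and> w $ i < u $ unrank i)"
      by (metis unrank_ranked_of)
    then show "w \<in> ?g -` box l u \<longleftrightarrow> w \<in> box ?l ?u"
      by (simp add: mem_box_cart)
  qed
  then have "emeasure (distr lborel borel ?g) (box l u) = emeasure lborel (box ?l ?u)"
    by (subst emeasure_distr) simp_all
  also have "\<dots> = ennreal (\<Prod>b\<in>Basis. (?u - ?l) \<bullet> b)"
    by (rule emeasure_lborel_box) (auto simp: Basis_vec_def inner_axis lu')
  also have "(\<Prod>b\<in>Basis. (?u - ?l) \<bullet> b) = (\<Prod>b\<in>Basis. (u - l) \<bullet> b)"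
    using prod.reindex_bij_betw[OF bij_unrank, of "\<lambda>i. u $ i - l $ i"]
    by (simp add: prod_Basis_vec inner_axis)
  finally show "emeasure (distr lborel borel ?g) (box l u) = ennreal (\<Prod>b\<in>Basis. (u - l) \<bullet> b)" .
qed simp

text \<open>Relabelling the coordinates by \<open>h\<close> preserves Lebesgue measure and
  intertwines \<open>A\<close> with its relabelled copy, which has the same determinant.\<close>

lemma integral_lborel_linear:
  fixes A :: "real ^ 'n ^ 'n" and g :: "real ^ 'n :: _ \<Rightarrow> complex"
  assumes A: "invertible A" and g: "g \<in> borel_measurable borel"
  shows "\<bar>det A\<bar> *\<^sub>R (LINT v|lborel. g (A *v v)) = (LINT w|lborel. g w)"
proof -
  define h where "h w = (\<chi> i. w $ ranked_of i)" for w :: "real ^ 'n ranked"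
  define A' where "A' = (\<chi> i j. A $ unrank i $ unrank j)"
  have hm [measurable]: "h \<in> borel_measurable borel"
    unfolding h_def by (intro borel_measurable_continuous_onI continuous_intros)
  have [measurable]: "(*v) A \<in> borel_measurable borel"
    by (intro borel_measurable_continuous_onI linear_continuous_on matrix_vector_mul_bounded_linear)
  have L: "(lborel :: (real ^ 'n) measure) = distr lborel borel h"
    unfolding h_def by (rule lborel_ranked)
  have tr: "(LINT v|lborel. G v) = (LINT w|lborel. G (h w))" if [measurable]: "G \<in> borel_measurable borel"
    for G :: "real ^ 'n \<Rightarrow> complex"
    by (subst L, subst integral_distr) auto
  have d: "det A' = det A" unfolding A'_def by (rule det_ranked)
  have "invertible A'"
    using A by (simp add: invertible_det_nz d)
  have hA: "h (A' *v w) = A *v h w" for w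
  proof -
    have "(\<Sum>j\<in>UNIV. A $ i $ unrank j * w $ j) = (\<Sum>j\<in>UNIV. A $ i $ j * w $ ranked_of j)" for i
      using sum.reindex_bij_betw[OF bij_unrank, of "\<lambda>j. A $ i $ j * w $ ranked_of j"] by simp
    then show ?thesis
      by (simp add: h_def A'_def matrix_vector_mult_def vec_eq_iff)
  qed
  have "\<bar>det A\<bar> *\<^sub>R (LINT v|lborel. g (A *v v)) = \<bar>det A'\<bar> *\<^sub>R (LINT w|lborel. g (h (A' *v w)))"
    unfolding hA d by (subst tr) (use g in auto)
  also have "\<dots> = (LINT w|lborel. g (h w))"
    by (rule integral_lborel_linear_wellorder[OF \<open>invertible A'\<close>]) (use g in measurable)
  also have "\<dots> = (LINT w|lborel. g w)"
    using tr[OF g] by simp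
  finally show ?thesis .
qed

section \<open>The theta transformation\<close>

text \<open>From v = B^-1 (B v + b) - B^-1 b follows |v| <= L |B v + b| + L |b|, where L bounds the
  inverse matrix; K = 1 + L + L |b| absorbs every term.\<close>

lemma affine_norm_lower_bound:
  fixes B :: "real ^ 'n ^ 'n"
  assumes "invertible B"
  obtains K where "K > 0" "\<And>v. 1 + norm v \<le> K * (1 + norm (B *v v + b))"
proof -
  obtain L where L: "L > 0" "\<And>v. norm (matrix_inv B *v v) \<le> norm v * L"
    using bounded_linear.pos_bounded[OF matrix_vector_mul_bounded_linear[of "matrix_inv B"]] by blast
  have "1 + norm v \<le> (1 + L + L * norm b) * (1 + norm (B *v v + b))" for v
  proof -
    have "v = matrix_inv B *v (B *v v + b) - matrix_inv B *v b"
      using assms by (simp add: matrix_vector_right_distrib)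
    then have "norm v \<le> norm (matrix_inv B *v (B *v v + b)) + norm (matrix_inv B *v b)"
      using norm_triangle_ineq4 by metis
    also have "\<dots> \<le> norm (B *v v + b) * L + norm b * L"
      by (intro add_mono L)
    finally have "norm v \<le> norm (B *v v + b) * L + norm b * L" .
    moreover have "0 \<le> L * norm b * norm (B *v v + b)" using L by simp
    moreover have "(1 + L + L * norm b) * (1 + norm (B *v v + b)) =
      1 + L + norm b * L + norm (B *v v + b) + norm (B *v v + b) * L + L * norm b * norm (B *v v + b)"
      by (simp add: algebra_simps)
    ultimately show ?thesis using L(1) norm_ge_zero[of "B *v v + b"] by linarith
  qed
  then show ?thesis using L by (intro that[of "1 + L + L * norm b"]) (auto intro!: add_pos_nonneg)
qed

lemma affine_powr_bound:
  fixes B :: "real ^ 'n ^ 'n"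
  assumes "invertible B" "s \<ge> 0"
  obtains K where "K > 0" "\<And>v. (1 + norm (B *v v + b)) powr (- s) \<le> K * (1 + norm v) powr (- s)"
proof -
  obtain K where K: "K > 0" "\<And>v. 1 + norm v \<le> K * (1 + norm (B *v v + b))"
    using affine_norm_lower_bound[OF assms(1), of b] by blast
  have "(1 + norm (B *v v + b)) powr (- s) \<le> K powr s * (1 + norm v) powr (- s)" for v
  proof -
    have p: "0 < 1 + norm v" "0 < 1 + norm (B *v v + b)"
      by (smt (verit) norm_ge_zero)+
    have "(1 + norm v) powr s \<le> (K * (1 + norm (B *v v + b))) powr s"
      using K(2)[of v] p assms(2) by (intro powr_mono2) auto
    also have "\<dots> = K powr s * (1 + norm (B *v v + b)) powr s"
      by (rule powr_mult)
    finally show ?thesis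
      using p by (simp add: powr_minus field_simps)
  qed
  then show ?thesis using K(1) that[of "K powr s"] by simp
qed

lemma summable_on_affine_ivec:
  fixes B :: "real ^ 'n ^ 'n"
  assumes "invertible B" "s > real CARD('n)"
  shows "(\<lambda>k. (1 + norm (B *v ivec k + b)) powr (- s)) summable_on UNIV"
proof -
  have s: "s \<ge> 0" using assms(2) by simp
  obtain K where "\<And>v. (1 + norm (B *v v + b)) powr (- s) \<le> K * (1 + norm v) powr (- s)"
    using affine_powr_bound[OF assms(1) s, of b] by blast
  then show ?thesis
    by (intro summable_on_comparison_test[OF summable_on_cmult_right[OF summable_on_ivec[OF assms(2)]]]) auto
qed

lemma lat_eq: "lat A = range (\<lambda>k. A *v ivec k)"
  by (simp add: lat_def ivec_def)

lemma inj_matrix_ivec: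
  fixes A :: "real ^ 'n ^ 'n"
  assumes "invertible A"
  shows "inj (\<lambda>k. A *v ivec k + b)"
proof (rule injI)
  fix k l :: "int ^ 'n"
  assume "A *v ivec k + b = A *v ivec l + b"
  then have "matrix_inv A *v (A *v ivec k) = matrix_inv A *v (A *v ivec l)" by simp
  then have "ivec k = ivec l" using assms by simp
  then show "k = l" by (rule injD[OF inj_ivec])
qed

lemma invertible_dual:
  assumes "invertible (A :: real ^ 'n ^ 'n)"
  shows "invertible (transpose (matrix_inv A))"
proof -
  have "A ** matrix_inv A = mat 1 \<and> matrix_inv A ** A = mat 1"
    using assms unfolding invertible_def matrix_inv_def by (rule someI_ex)
  then have "transpose (matrix_inv A) ** transpose A = mat 1 \<and> transpose A ** transpose (matrix_inv A) = mat 1"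
    by (metis matrix_transpose_mul transpose_mat)
  then show ?thesis unfolding invertible_def by blast
qed

text \<open>The defining property of the dual lattice. A character of integer frequency m in the
  coordinates v thereby becomes a character of dual frequency in the point A v.\<close>

lemma dual_inner:
  assumes "invertible (A :: real ^ 'n ^ 'n)"
  shows "(transpose (matrix_inv A) *v m) \<bullet> (A *v v) = m \<bullet> v"
  by (simp only: transpose_matrix_vector dot_lmul_matrix matrix_inv_left_cancel[OF assms])

lemma countable_lat [simp]: "countable (lat (A :: real ^ 'n ^ 'n))"
  unfolding lat_eq by simp

lemma norm_mi_pow_le: "norm (mi_pow (w :: real ^ 'n) \<alpha>) \<le> norm w ^ mi_abs \<alpha>"
  unfolding mi_pow_def mi_abs_def power_sum
  by (simp add: abs_prod power_abs) (intro prod_mono conjI power_mono component_le_norm_cart, auto)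

section \<open>Gaussians and Hermite polynomials in several variables\<close>

definition gauss_mono :: "nat ^ 'n \<Rightarrow> real \<Rightarrow> real ^ 'n \<Rightarrow> complex" where
  "gauss_mono \<alpha> t w = of_real (mi_pow w \<alpha> * exp (- pi * t * (norm w)\<^sup>2))"

text \<open>A tensor product of Hermite polynomials: the derivative of order \<alpha> of exp (-
  \<pi> s |p|^2) is this polynomial times the same Gaussian.\<close>

definition hermite_vec :: "nat ^ 'n \<Rightarrow> complex \<Rightarrow> real ^ 'n \<Rightarrow> complex" where
  "hermite_vec \<alpha> s p = (\<Prod>j\<in>UNIV. hermite_gauss (\<alpha> $ j) s (of_real (p $ j)))"

lemma norm_squared_vec: "(norm (w :: real ^ 'n))\<^sup>2 = (\<Sum>j\<in>UNIV. (w $ j)\<^sup>2)"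
  by (simp add: norm_vec_def L2_set_def sum_nonneg)

lemma gauss_mono_phase:
  "gauss_mono \<alpha> t w * phase p w = (\<Prod>j\<in>UNIV. gauss_wave (\<alpha> $ j) t (p $ j) (w $ j))"
proof -
  have "exp (- pi * t * (norm w)\<^sup>2) = (\<Prod>j\<in>UNIV. exp (- pi * t * (w $ j)\<^sup>2))"
    by (simp add: norm_squared_vec sum_distrib_left exp_sum flip: sum_negf)
  then show ?thesis
    unfolding gauss_mono_def phase_eq_prod gauss_wave_def mi_pow_def
    by (simp add: prod.distrib flip: of_real_prod of_real_mult)
qed

lemma continuous_on_gauss_mono: "continuous_on S (gauss_mono \<alpha> t)"
  unfolding gauss_mono_def mi_pow_def by (intro continuous_intros)

lemma integral_gauss_mono_phase:
  fixes p :: "real ^ 'n"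
  assumes t: "t > 0"
  shows "(LINT w|lborel. gauss_mono \<alpha> t w * phase p w) =
    hermite_vec \<alpha> (1 / of_real t) p * of_real (exp (- pi * (norm p)\<^sup>2 / t) / sqrt t ^ CARD('n)) / (- 2 * of_real pi * \<i>) ^ mi_abs \<alpha>"
proof -
  have e: "exp (- pi * (norm p)\<^sup>2 / t) = (\<Prod>j\<in>UNIV. exp (- pi * (p $ j)\<^sup>2 / t))"
    by (simp add: norm_squared_vec sum_distrib_left sum_divide_distrib exp_sum flip: sum_negf)
  have "(LINT w|lborel. gauss_mono \<alpha> t w * phase p w) = (\<Prod>j\<in>UNIV. LINT x|lborel. gauss_wave (\<alpha> $ j) t (p $ j) x)"
    unfolding gauss_mono_phase by (rule integral_prod_vec) (rule integrable_gauss_wave[OF t])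
  also have "\<dots> = hermite_vec \<alpha> (1 / of_real t) p * of_real (\<Prod>j\<in>(UNIV :: 'n set). exp (- pi * (p $ j)\<^sup>2 / t) / sqrt t) / (- 2 * of_real pi * \<i>) ^ mi_abs \<alpha>"
    unfolding integral_gauss_wave[OF t] hermite_vec_def prod_dividef prod.distrib mi_abs_def power_sum
      of_real_prod[symmetric] ..
  finally show ?thesis
    unfolding e prod_dividef by simp
qed

lemma norm_gauss_mono_le:
  fixes N :: nat
  assumes "t > 0"
  obtains C where "C > 0" "\<And>w :: real ^ 'n. norm (gauss_mono \<alpha> t w) \<le> C * (1 + norm w) powr (- real N)"
proof -
  obtain C where C: "C > 0" "\<And>r :: real. r \<ge> 0 \<Longrightarrow> (1 + r) ^ (mi_abs \<alpha> + N) * exp (- (pi * t) * r\<^sup>2) \<le> C"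
    using gaussian_decay[of "pi * t" "mi_abs \<alpha> + N"] assms by auto
  have "norm (gauss_mono \<alpha> t w) \<le> C * (1 + norm w) powr (- real N)" for w :: "real ^ 'n"
  proof -
    have p: "0 < 1 + norm w" by (smt (verit) norm_ge_zero)
    have "norm (gauss_mono \<alpha> t w) = norm (mi_pow w \<alpha>) * exp (- (pi * t) * (norm w)\<^sup>2)"
      by (simp add: gauss_mono_def norm_mult)
    also have "norm (mi_pow w \<alpha>) \<le> (1 + norm w) ^ mi_abs \<alpha>"
      by (rule order_trans[OF norm_mi_pow_le]) (auto intro: power_mono)
    finally have "norm (gauss_mono \<alpha> t w) \<le> (1 + norm w) ^ mi_abs \<alpha> * exp (- (pi * t) * (norm w)\<^sup>2)"
      by simp
    also have "\<dots> \<le> C / (1 + norm w) ^ N"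
      using C(2)[of "norm w"] p by (simp add: power_add field_simps)
    also have "\<dots> = C * (1 + norm w) powr (- real N)"
      using p by (simp add: powr_minus powr_realpow divide_inverse)
    finally show ?thesis .
  qed
  then show ?thesis by (rule that[OF C(1)])
qed

lemma norm_hermite_gauss_le:
  obtains C where "C > 0" "\<And>x. norm (hermite_gauss n s (of_real x)) \<le> C * (1 + \<bar>x\<bar>) ^ n"
proof -
  define C where "C = (\<Sum>k | 2 * k \<le> n. norm (p_coeff n k) * norm s ^ (n - k)) + 1"
  have C: "C > 0" unfolding C_def by (intro add_nonneg_pos sum_nonneg) auto
  have "norm (hermite_gauss n s (of_real x)) \<le> C * (1 + \<bar>x\<bar>) ^ n" for x
  proof -
    have "norm (hermite_gauss n s (of_real x)) \<le> (\<Sum>k | 2 * k \<le> n. norm (p_coeff n k) * norm s ^ (n - k) * (1 + \<bar>x\<bar>) ^ n)"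
      unfolding hermite_gauss_def
    proof (rule sum_norm_le)
      fix k assume "k \<in> {k. 2 * k \<le> n}"
      have "\<bar>x\<bar> ^ (n - 2 * k) \<le> (1 + \<bar>x\<bar>) ^ (n - 2 * k)" by (intro power_mono) auto
      also have "\<dots> \<le> (1 + \<bar>x\<bar>) ^ n" by (intro power_increasing) auto
      finally have "norm (p_coeff n k) * norm s ^ (n - k) * \<bar>x\<bar> ^ (n - 2 * k) \<le> norm (p_coeff n k) * norm s ^ (n - k) * (1 + \<bar>x\<bar>) ^ n"
        by (intro mult_left_mono) auto
      then show "norm (p_coeff n k * of_real x ^ (n - 2 * k) * s ^ (n - k)) \<le> norm (p_coeff n k) * norm s ^ (n - k) * (1 + \<bar>x\<bar>) ^ n"
        by (simp only: norm_mult norm_power norm_of_real mult.assoc mult.commute[of "\<bar>x\<bar> ^ _"])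
    qed
    also have "\<dots> \<le> C * (1 + \<bar>x\<bar>) ^ n"
      unfolding C_def sum_distrib_right[symmetric] by (intro mult_right_mono) auto
    finally show ?thesis .
  qed
  then show ?thesis by (rule that[OF C])
qed

lemma norm_hermite_vec_le:
  obtains C where "C > 0" "\<And>p :: real ^ 'n. norm (hermite_vec \<alpha> s p) \<le> C * (1 + norm p) ^ mi_abs \<alpha>"
proof -
  have "\<exists>C. \<forall>j. C j > 0 \<and> (\<forall>x. norm (hermite_gauss (\<alpha> $ j) s (of_real x)) \<le> C j * (1 + \<bar>x\<bar>) ^ (\<alpha> $ j))"
    by (rule choice) (metis norm_hermite_gauss_le)
  then obtain C where C: "\<And>j. C j > 0" "\<And>j x. norm (hermite_gauss (\<alpha> $ j) s (of_real x)) \<le> C j * (1 + \<bar>x\<bar>) ^ (\<alpha> $ j)"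
    by blast
  have "norm (hermite_vec \<alpha> s p) \<le> (\<Prod>j\<in>UNIV. C j) * (1 + norm p) ^ mi_abs \<alpha>" for p :: "real ^ 'n"
  proof -
    have "norm (hermite_vec \<alpha> s p) \<le> (\<Prod>j\<in>UNIV. C j * (1 + norm p) ^ (\<alpha> $ j))"
      unfolding hermite_vec_def prod_norm[symmetric]
    proof (rule prod_mono, intro conjI)
      fix j
      have "norm (hermite_gauss (\<alpha> $ j) s (of_real (p $ j))) \<le> C j * (1 + \<bar>p $ j\<bar>) ^ (\<alpha> $ j)"
        by (rule C)
      also have "\<dots> \<le> C j * (1 + norm p) ^ (\<alpha> $ j)"
        using C(1)[of j] component_le_norm_cart[of p j] by (intro mult_left_mono power_mono) auto
      finally show "norm (hermite_gauss (\<alpha> $ j) s (of_real (p $ j))) \<le> C j * (1 + norm p) ^ (\<alpha> $ j)" .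
    qed auto
    then show ?thesis by (simp add: prod.distrib mi_abs_def power_sum)
  qed
  moreover have "(\<Prod>j\<in>UNIV. C j) > 0" using C(1) by (simp add: prod_pos)
  ultimately show ?thesis by (intro that)
qed

lemma norm_hermite_exp_le:
  fixes N :: nat
  assumes "t > 0"
  obtains C where "C > 0"
    "\<And>p :: real ^ 'n. norm (hermite_vec \<alpha> s p * of_real (exp (- pi * (norm p)\<^sup>2 / t))) \<le> C * (1 + norm p) powr (- real N)"
proof -
  obtain C0 where C0: "C0 > 0" "\<And>p :: real ^ 'n. norm (hermite_vec \<alpha> s p) \<le> C0 * (1 + norm p) ^ mi_abs \<alpha>"
    using norm_hermite_vec_le by blast
  obtain C where C: "C > 0" "\<And>r :: real. r \<ge> 0 \<Longrightarrow> (1 + r) ^ (mi_abs \<alpha> + N) * exp (- (pi / t) * r\<^sup>2) \<le> C"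
    using gaussian_decay[of "pi / t" "mi_abs \<alpha> + N"] assms by auto
  have "norm (hermite_vec \<alpha> s p * of_real (exp (- pi * (norm p)\<^sup>2 / t))) \<le> (C0 * C) * (1 + norm p) powr (- real N)" for p :: "real ^ 'n"
  proof -
    have p: "0 < 1 + norm p" by (smt (verit) norm_ge_zero)
    have "norm (hermite_vec \<alpha> s p * of_real (exp (- pi * (norm p)\<^sup>2 / t))) \<le> C0 * (1 + norm p) ^ mi_abs \<alpha> * exp (- (pi / t) * (norm p)\<^sup>2)"
      using C0(2)[of p] by (simp add: norm_mult)
    also have "\<dots> \<le> C0 * (C / (1 + norm p) ^ N)"
      unfolding mult.assoc using C(2)[of "norm p"] p C0(1)
      by (intro mult_left_mono) (auto simp: power_add field_simps)
    also have "\<dots> = (C0 * C) * (1 + norm p) powr (- real N)"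
      using p by (simp add: powr_minus powr_realpow divide_inverse)
    finally show ?thesis .
  qed
  moreover have "C0 * C > 0" using C0 C by simp
  ultimately show ?thesis by (intro that)
qed

text \<open>Poisson summation for \<open>f\<close>, the summand of the theta series as a function of
  the integer coordinates. The substitution w = A v - x produces the factor 1 / |det A| and the
  phase in x, and merges the dual point of \<open>m\<close> with \<open>y\<close> into the frequency
  p; what is left is the Fourier transform of a Gaussian times a monomial.\<close>

theorem theta_transformation:
  fixes A :: "real ^ 'n ^ 'n" and x y :: "real ^ 'n"
  assumes A: "invertible A" and t: "t > 0"
  defines "D \<equiv> (\<lambda>q. q + y) ` dual_lat A"
  shows "(\<lambda>z. gauss_mono \<alpha> t (z - x) * phase y z) summable_on lat A"
    and "(\<lambda>p. hermite_vec \<alpha> (1 / of_real t) p * of_real (exp (- pi * (norm p)\<^sup>2 / t)) * phase x p) summable_on D"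
    and "(\<Sum>\<^sub>\<infinity>z\<in>lat A. gauss_mono \<alpha> t (z - x) * phase y z) =
      1 / ((- 2 * of_real pi * \<i>) ^ mi_abs \<alpha> * of_real (covol A * sqrt t ^ CARD('n))) *
      (\<Sum>\<^sub>\<infinity>p\<in>D. hermite_vec \<alpha> (1 / of_real t) p * of_real (exp (- pi * (norm p)\<^sup>2 / t)) * phase x p)"
proof -
  define B where "B = transpose (matrix_inv A)"
  have B: "invertible B" unfolding B_def by (rule invertible_dual[OF A])
  \<comment> \<open>Both sides decay faster than any power; an exponent larger than the dimension is
    enough for summability.\<close>
  define N where "N = CARD('n) + 1"
  have N: "real N > real CARD('n)" by (simp add: N_def)
  define f where "f v = gauss_mono \<alpha> t (A *v v - x) * phase y (A *v v)" for v
  define h where "h p = hermite_vec \<alpha> (1 / of_real t) p * of_real (exp (- pi * (norm p)\<^sup>2 / t)) * phase x p" for p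
  define c where "c = 1 / ((- 2 * of_real pi * \<i>) ^ mi_abs \<alpha> * of_real (covol A * sqrt t ^ CARD('n)))"
  have det: "\<bar>det A\<bar> > 0" using A invertible_det_nz by auto
  have D: "D = range (\<lambda>m. B *v ivec m + y)"
    unfolding D_def dual_lat_def lat_eq B_def by auto
  have fcont: "continuous_on UNIV f"
    unfolding f_def
    by (intro continuous_intros continuous_on_compose2[OF continuous_on_gauss_mono] linear_continuous_on
         matrix_vector_mul_bounded_linear) auto
  obtain C1 where C1: "C1 > 0" "\<And>w :: real ^ 'n. norm (gauss_mono \<alpha> t w) \<le> C1 * (1 + norm w) powr (- real N)"
    using norm_gauss_mono_le[OF t] by blast
  obtain K where K: "K > 0" "\<And>v. (1 + norm (A *v v + - x)) powr (- real N) \<le> K * (1 + norm v) powr (- real N)"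
    using affine_powr_bound[OF A, of "real N" "- x"] by auto
  have fdecay: "norm (f v) \<le> C1 * K * (1 + norm v) powr (- real N)" for v
  proof -
    have "norm (f v) \<le> C1 * (1 + norm (A *v v + - x)) powr (- real N)"
      using C1(2)[of "A *v v - x"] by (simp add: f_def norm_mult)
    also have "\<dots> \<le> C1 * (K * (1 + norm v) powr (- real N))"
      using C1(1) K(2) by (intro mult_left_mono) auto
    finally show ?thesis by simp
  qed
  have ft: "(LINT v|lborel. f v * phase (ivec m) v) = c * h (B *v ivec m + y)" for m
  proof -
    define p where "p = B *v ivec m + y"
    have ph: "phase (ivec m) v = phase (B *v ivec m) (A *v v)" for v
      unfolding B_def phase_def dual_inner[OF A] ..
    define G where "G w = gauss_mono \<alpha> t (w - x) * phase p w" for w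
    have cG: "continuous_on UNIV G"
      unfolding G_def by (intro continuous_intros continuous_on_compose2[OF continuous_on_gauss_mono]) auto
    have "of_real \<bar>det A\<bar> * (LINT v|lborel. f v * phase (ivec m) v) = \<bar>det A\<bar> *\<^sub>R (LINT v|lborel. G (A *v v))"
      unfolding f_def ph G_def p_def by (simp add: phase_add_left scaleR_conv_of_real mult_ac)
    also have "\<dots> = (LINT w|lborel. G w)"
      by (rule integral_lborel_linear[OF A borel_measurable_continuous_onI[OF cG]])
    also have "\<dots> = (LINT w|lborel. G (w + x))"
      by (rule integral_lborel_translation[OF borel_measurable_continuous_onI[OF cG], symmetric])
    also have "\<dots> = (LINT w|lborel. gauss_mono \<alpha> t w * phase p w) * phase x p"
      by (simp add: G_def phase_add_right phase_commute[of x p] flip: mult.assoc)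
    finally have "of_real \<bar>det A\<bar> * (LINT v|lborel. f v * phase (ivec m) v) =
        (LINT w|lborel. gauss_mono \<alpha> t w * phase p w) * phase x p" .
    moreover have "L = 1 / (a * of_real (\<bar>det A\<bar> * s)) * (H * of_real E * q)"
      if "of_real \<bar>det A\<bar> * L = H * of_real (E / s) / a * q" for L H q a :: complex and E s :: real
    proof -
      have "complex_of_real \<bar>det A\<bar> \<noteq> 0" using det by simp
      then have "L = H * of_real (E / s) / a * q / of_real \<bar>det A\<bar>"
        unfolding that[symmetric] by simp
      then show ?thesis by (simp add: mult_ac)
    qed
    ultimately show ?thesis
      unfolding integral_gauss_mono_phase[OF t] c_def h_def p_def[symmetric] covol_def by blast
  qed
  obtain C2 where C2: "C2 > 0"
    "\<And>p :: real ^ 'n. norm (hermite_vec \<alpha> (1 / of_real t) p * of_real (exp (- pi * (norm p)\<^sup>2 / t))) \<le> C2 * (1 + norm p) powr (- real N)"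
    using norm_hermite_exp_le[OF t] by blast
  have hsum: "(\<lambda>m. h (B *v ivec m + y)) summable_on UNIV"
    by (rule summable_on_norm_comparison[OF summable_on_cmult_right[OF summable_on_affine_ivec[OF B N]]])
       (use C2(2) in \<open>simp add: h_def norm_mult\<close>)
  have P: "(\<lambda>k. f (ivec k)) summable_on UNIV"
    "(\<Sum>\<^sub>\<infinity>k. f (ivec k)) = (\<Sum>\<^sub>\<infinity>m. LINT v|lborel. f v * phase (ivec m) v)"
    using poisson_summation[OF fcont fdecay N] summable_on_cmult_right[OF hsum, of c] unfolding ft by simp_all
  have injA: "inj (\<lambda>k. A *v ivec k)" using inj_matrix_ivec[OF A, of 0] by simp
  show "(\<lambda>z. gauss_mono \<alpha> t (z - x) * phase y z) summable_on lat A"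
    using P(1) unfolding lat_eq summable_on_reindex[OF injA] by (simp add: f_def o_def)
  have "h summable_on D" using hsum
    unfolding D summable_on_reindex[OF inj_matrix_ivec[OF B]] by (simp add: o_def)
  then show "(\<lambda>p. hermite_vec \<alpha> (1 / of_real t) p * of_real (exp (- pi * (norm p)\<^sup>2 / t)) * phase x p) summable_on D"
    by (simp only: h_def[abs_def])
  have "(\<Sum>\<^sub>\<infinity>z\<in>lat A. gauss_mono \<alpha> t (z - x) * phase y z) = (\<Sum>\<^sub>\<infinity>k. f (ivec k))"
    unfolding lat_eq infsum_reindex[OF injA] by (simp add: f_def o_def)
  also have "\<dots> = c * (\<Sum>\<^sub>\<infinity>m. h (B *v ivec m + y))"
    unfolding P(2) ft by (intro infsum_cmult_right hsum)
  also have "(\<Sum>\<^sub>\<infinity>m. h (B *v ivec m + y)) = (\<Sum>\<^sub>\<infinity>p\<in>D. h p)"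
    unfolding D infsum_reindex[OF inj_matrix_ivec[OF B]] by (simp add: o_def)
  finally show "(\<Sum>\<^sub>\<infinity>z\<in>lat A. gauss_mono \<alpha> t (z - x) * phase y z) =
      1 / ((- 2 * of_real pi * \<i>) ^ mi_abs \<alpha> * of_real (covol A * sqrt t ^ CARD('n))) *
      (\<Sum>\<^sub>\<infinity>p\<in>D. hermite_vec \<alpha> (1 / of_real t) p * of_real (exp (- pi * (norm p)\<^sup>2 / t)) * phase x p)"
    by (simp only: c_def h_def)
qed

section \<open>The incomplete Gamma function\<close>

lemma set_integral_atLeast_tendsto:
  fixes f :: "real \<Rightarrow> complex"
  assumes "set_integrable lborel {a..} f"
  shows "(\<lambda>n. integral {a..a + real n} f) \<longlonglongrightarrow> (LINT t:{a..}|lborel. f t)"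
proof -
  have "(\<lambda>n. LINT t:{a..a + real n}|lborel. f t) \<longlonglongrightarrow> (LINT t:(\<Union>n. {a..a + real n})|lborel. f t)"
  proof (rule set_integral_cont_up)
    show "incseq (\<lambda>n. {a..a + real n})" by (auto simp: incseq_def)
    have "(\<Union>n. {a..a + real n}) \<subseteq> {a..}" by auto
    then show "set_integrable lborel (\<Union>n. {a..a + real n}) f"
      by (rule set_integrable_subset[OF assms _, rotated]) auto
  qed auto
  moreover have "(\<Union>n. {a..a + real n}) = {a..}"
  proof (intro equalityI subsetI)
    fix t assume "t \<in> {a..}"
    moreover obtain n where "t - a \<le> real n" using real_arch_simple by blast
    ultimately have "t \<in> {a..a + real n}" by auto
    then show "t \<in> (\<Union>n. {a..a + real n})" by blast
  qed auto
  moreover have "(LINT t:{a..a + real n}|lborel. f t) = integral {a..a + real n} f" for n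
    by (rule set_borel_integral_eq_integral(2), rule set_integrable_subset[OF assms]) auto
  ultimately show ?thesis by simp
qed

lemma set_integral_FTC_atLeast:
  fixes f F :: "real \<Rightarrow> complex"
  assumes "set_integrable lborel {a..} f"
    and "\<And>t. t \<ge> a \<Longrightarrow> (F has_vector_derivative f t) (at t within {a..})"
    and "(F \<longlongrightarrow> L) at_top"
  shows "(LINT t:{a..}|lborel. f t) = L - F a"
proof (rule LIMSEQ_unique[OF set_integral_atLeast_tendsto[OF assms(1)]])
  have "integral {a..a + real n} f = F (a + real n) - F a" for n
  proof (rule integral_unique, rule fundamental_theorem_of_calculus)
    fix t assume "t \<in> {a..a + real n}"
    then show "(F has_vector_derivative f t) (at t within {a..a + real n})"
      by (intro has_vector_derivative_within_subset[OF assms(2)]) auto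
  qed simp
  moreover have "(\<lambda>n. F (a + real n) - F a) \<longlonglongrightarrow> L - F a"
    by (intro tendsto_intros filterlim_compose[OF assms(3)] filterlim_tendsto_add_at_top[OF tendsto_const] filterlim_real_sequentially)
  ultimately show "(\<lambda>n. integral {a..a + real n} f) \<longlonglongrightarrow> L - F a" by simp
qed

text \<open>
  The derivative is only identified as the limit of integrals over compact intervals, so that no
  bound on \<open>f'\<close> is needed: locally uniform limits of holomorphic functions can be differentiated.
\<close>

lemma parameter_integral_derivative:
  fixes f f' :: "complex \<Rightarrow> real \<Rightarrow> complex"
  assumes d: "d > 0"
    and fd: "\<And>w t. w \<in> ball z d \<Longrightarrow> t \<ge> a \<Longrightarrow> ((\<lambda>w. f w t) has_field_derivative f' w t) (at w)"
    and c: "\<And>w. w \<in> ball z d \<Longrightarrow> continuous_on {a..} (f w)"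
    and c': "continuous_on (ball z d \<times> {a..}) (\<lambda>(w, t). f' w t)"
    and h: "set_integrable lborel {a..} h"
    and bound: "\<And>w t. w \<in> ball z d \<Longrightarrow> t \<ge> a \<Longrightarrow> norm (f w t) \<le> h t"
  obtains D where "((\<lambda>w. LINT t:{a..}|lborel. f w t) has_field_derivative D) (at z)"
    "(\<lambda>n. integral {a..a + real n} (f' z)) \<longlonglongrightarrow> D"
proof -
  define F where "F w = (LINT t:{a..}|lborel. f w t)" for w
  have int: "set_integrable lborel {a..} (f w)" if "w \<in> ball z d" for w
  proof (rule set_integrable_bound[OF h])
    have "set_borel_measurable borel {a..} (f w)"
      by (rule borel_measurable_continuous_on_indicator[OF _ c[OF that], folded set_borel_measurable_def]) simp
    then show "set_borel_measurable lborel {a..} (f w)" by (simp add: set_borel_measurable_def)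
    show "AE t in lborel. t \<in> {a..} \<longrightarrow> norm (f w t) \<le> norm (h t)"
    proof (intro AE_I2 impI)
      fix t assume "t \<in> {a..}"
      then have "norm (f w t) \<le> h t" using bound[OF that] by simp
      then show "norm (f w t) \<le> norm (h t)" by simp
    qed
  qed
  have step1: "((\<lambda>x. integral {a..a + real n} (f x)) has_field_derivative integral {a..a + real n} (f' w)) (at w)"
    if w: "w \<in> ball z d" for n w
  proof -
    have "((\<lambda>x. integral (cbox a (a + real n)) (f x)) has_field_derivative integral (cbox a (a + real n)) (f' w)) (at w within ball z d)"
    proof (rule leibniz_rule_field_derivative[where f = f and fx = f'])
      show "((\<lambda>x. f x t) has_field_derivative f' x t) (at x within ball z d)"
        if "x \<in> ball z d" "t \<in> cbox a (a + real n)" for x t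
        by (rule has_field_derivative_at_within[OF fd]) (use that in auto)
      show "f x integrable_on cbox a (a + real n)" if "x \<in> ball z d" for x
        by (intro integrable_continuous continuous_on_subset[OF c[OF that]]) auto
      show "continuous_on (ball z d \<times> cbox a (a + real n)) (\<lambda>(x, t). f' x t)"
        by (rule continuous_on_subset[OF c']) auto
    qed (use w in auto)
    then show "((\<lambda>x. integral {a..a + real n} (f x)) has_field_derivative integral {a..a + real n} (f' w)) (at w)"
      using w by (simp add: at_within_open[of w "ball z d"])
  qed
  have step2: "\<exists>e>0. cball w e \<subseteq> ball z d \<and> uniform_limit (cball w e) (\<lambda>n x. integral {a..a + real n} (f x)) F sequentially"
    if w: "w \<in> ball z d" for w
  proof -
    obtain e where e: "e > 0" "cball w e \<subseteq> ball z d"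
      using open_contains_cball[of "ball z d", THEN iffD1, OF open_ball] w by blast
    \<comment> \<open>For every \<open>x\<close> in the ball the truncation error is at most the
      tail of the integral of \<open>h\<close>, which does not depend on \<open>x\<close>.\<close>
    have "uniform_limit (ball z d) (\<lambda>n x. integral {a..a + real n} (f x)) F sequentially"
    proof (rule uniform_limitI)
      fix \<epsilon> :: real assume \<epsilon>: "\<epsilon> > 0"
      have "(\<lambda>n. integral {a..a + real n} (\<lambda>t. complex_of_real (h t))) \<longlonglongrightarrow> (LINT t:{a..}|lborel. complex_of_real (h t))"
        by (rule set_integral_atLeast_tendsto) (use h in \<open>simp add: set_integrable_def scaleR_conv_of_real flip: of_real_mult\<close>)
      then have "\<forall>\<^sub>F n in sequentially. dist (integral {a..a + real n} (\<lambda>t. complex_of_real (h t))) (LINT t:{a..}|lborel. complex_of_real (h t)) < \<epsilon>"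
        using \<epsilon> tendstoD by blast
      then show "\<forall>\<^sub>F n in sequentially. \<forall>x\<in>ball z d. dist (integral {a..a + real n} (f x)) (F x) < \<epsilon>"
      proof eventually_elim
        case (elim n)
        have split: "(LINT t:{a..}|lborel. g t) = integral {a..a + real n} g + (LINT t:{a + real n<..}|lborel. g t)"
          if g: "set_integrable lborel {a..} g" for g :: "real \<Rightarrow> complex"
        proof -
          have g1: "set_integrable lborel {a..a + real n} g"
            by (rule set_integrable_subset[OF g]) auto
          have g2: "set_integrable lborel {a + real n<..} g"
            by (rule set_integrable_subset[OF g]) auto
          have "{a..} = {a..a + real n} \<union> {a + real n<..}" by auto
          moreover have "{a..a + real n} \<inter> {a + real n<..} = {}" by auto
          ultimately show ?thesis
            using set_integral_Un[OF _ g1 g2] set_borel_integral_eq_integral(2)[OF g1] by simp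
        qed
        have hc: "set_integrable lborel {a..} (\<lambda>t. complex_of_real (h t))"
          using h by (simp add: set_integrable_def scaleR_conv_of_real flip: of_real_mult)
        have h2: "set_integrable lborel {a + real n<..} h"
          by (rule set_integrable_subset[OF h]) auto
        have "norm (LINT t:{a + real n<..}|lborel. complex_of_real (h t)) < \<epsilon>"
          using elim unfolding split[OF hc] by (simp add: dist_norm norm_minus_commute)
        moreover have "(LINT t:{a + real n<..}|lborel. complex_of_real (h t)) = of_real (LINT t:{a + real n<..}|lborel. h t)"
          by (simp add: set_lebesgue_integral_def scaleR_conv_of_real flip: of_real_mult)
        ultimately have H: "(LINT t:{a + real n<..}|lborel. h t) < \<epsilon>" by simp
        show ?case
        proof
          fix x assume x: "x \<in> ball z d"
          have f2: "set_integrable lborel {a + real n<..} (f x)"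
            by (rule set_integrable_subset[OF int[OF x]]) auto
          have "dist (integral {a..a + real n} (f x)) (F x) = norm (LINT t:{a + real n<..}|lborel. f x t)"
            unfolding F_def split[OF int[OF x]] by (simp add: dist_norm)
          also have "\<dots> \<le> (LINT t:{a + real n<..}|lborel. norm (f x t))"
            by (rule set_integral_norm_bound[OF f2])
          also have "\<dots> \<le> (LINT t:{a + real n<..}|lborel. h t)"
            by (rule set_integral_mono[OF set_integrable_norm[OF f2] h2]) (use bound[OF x] in auto)
          finally show "dist (integral {a..a + real n} (f x)) (F x) < \<epsilon>" using H by simp
        qed
      qed
    qed
    then show "\<exists>e>0. cball w e \<subseteq> ball z d \<and> uniform_limit (cball w e) (\<lambda>n x. integral {a..a + real n} (f x)) F sequentially"
      using e by (meson uniform_limit_on_subset)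
  qed
  obtain g' where "\<forall>x\<in>ball z d. (F has_field_derivative g' x) (at x) \<and> (\<lambda>n. integral {a..a + real n} (f' x)) \<longlonglongrightarrow> g' x"
    using has_complex_derivative_uniform_sequence[OF open_ball, of z d "\<lambda>n x. integral {a..a + real n} (f x)" "\<lambda>n x. integral {a..a + real n} (f' x)" F]
      step1 step2 by blast
  then have "(F has_field_derivative g' z) (at z)" "(\<lambda>n. integral {a..a + real n} (f' z)) \<longlonglongrightarrow> g' z"
    using d by simp_all
  then show ?thesis unfolding F_def[abs_def] by (rule that)
qed

text \<open>The modulus of w^s is exp (Re s ln |w| - Im s arg w). The argument is at most \<pi> in
  size, and |ln |w|| is at most ln (R / min 1 c) since c <= |w| <= R and R >= 1.\<close>

lemma norm_powr_le_exp:
  fixes w s :: complex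
  assumes "Re w > 0" "norm w \<le> R" "c \<le> norm w" "c > 0" "R \<ge> 1" "norm s \<le> S"
  shows "norm (w powr s) \<le> exp (pi * S) * (R / min 1 c) powr S"
proof -
  have w0: "w \<noteq> 0" using assms(1) by auto
  have S: "S \<ge> 0" using assms(6) norm_ge_zero[of s] by linarith
  have l: "ln (norm w) \<le> ln (R / min 1 c)" "- ln (norm w) \<le> ln (R / min 1 c)"
  proof -
    have "norm w * min 1 c \<le> R * 1" using assms by (intro mult_mono) auto
    then have "norm w \<le> R / min 1 c" using assms by (simp add: field_simps)
    then show "ln (norm w) \<le> ln (R / min 1 c)" using w0 assms by (subst ln_le_cancel_iff) auto
    have "min 1 c \<le> norm w * R" using assms mult_mono[of c "norm w" 1 R] by auto
    then have "1 / norm w \<le> R / min 1 c" using assms w0 by (simp add: field_simps min_def)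
    then have "ln (1 / norm w) \<le> ln (R / min 1 c)" using w0 assms by (subst ln_le_cancel_iff) auto
    then show "- ln (norm w) \<le> ln (R / min 1 c)" using w0 by (simp add: ln_div)
  qed
  have "norm (w powr s) = exp (Re s * ln (norm w) - Im s * Im (Ln w))"
    using w0 by (simp add: powr_def)
  also have "\<dots> \<le> exp (S * ln (R / min 1 c) + pi * S)"
  proof -
    have "Re s * ln (norm w) \<le> \<bar>Re s\<bar> * \<bar>ln (norm w)\<bar>"
      using abs_ge_self[of "Re s * ln (norm w)"] by (simp add: abs_mult)
    also have "\<dots> \<le> S * ln (R / min 1 c)"
      using abs_Re_le_cmod[of s] assms(6) l S by (intro mult_mono) auto
    finally have 1: "Re s * ln (norm w) \<le> S * ln (R / min 1 c)" .
    have "- (Im s * Im (Ln w)) \<le> \<bar>Im s\<bar> * \<bar>Im (Ln w)\<bar>"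
      by (metis abs_ge_minus_self abs_mult)
    also have "\<dots> \<le> S * pi"
      using abs_Im_le_cmod[of s] assms(6) Im_Ln_le_pi[OF w0] mpi_less_Im_Ln[OF w0]
      by (intro mult_mono) auto
    finally show ?thesis using 1 by (simp add: mult.commute)
  qed
  also have "\<dots> = exp (pi * S) * (R / min 1 c) powr S"
    using assms by (simp add: powr_def exp_add mult.commute)
  finally show ?thesis .
qed

lemma set_integrable_lborel_nonneg:
  fixes f :: "'a :: euclidean_space \<Rightarrow> real"
  assumes "f integrable_on S" "\<And>x. x \<in> S \<Longrightarrow> 0 \<le> f x" "set_borel_measurable borel S f"
  shows "set_integrable lborel S f" and "(LINT x:S|lborel. f x) = integral S f"
proof -
  have "f absolutely_integrable_on S"
    by (rule nonnegative_absolutely_integrable_1[OF assms(1,2)])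
  then show "set_integrable lborel S f"
    using assms(3) unfolding set_integrable_def set_borel_measurable_def
    by (subst (asm) integrable_completion) simp_all
  then show "(LINT x:S|lborel. f x) = integral S f"
    by (rule set_borel_integral_eq_integral)
qed

lemma set_borel_measurable_continuous:
  fixes f :: "'a :: topological_space \<Rightarrow> 'b :: real_normed_vector"
  shows
  "S \<in> sets borel \<Longrightarrow> continuous_on S f \<Longrightarrow> set_borel_measurable borel S f"
  unfolding set_borel_measurable_def by (rule borel_measurable_continuous_on_indicator)

lemma set_integrable_exp_decay: "set_integrable lborel {0..} (\<lambda>r :: real. C * exp (- r / 2))"
proof -
  have "(\<lambda>r :: real. exp (- (1 / 2) * r)) integrable_on {0..}"
    by (rule integrable_on_exp_minus_to_infinity) simp
  then have "set_integrable lborel {0..} (\<lambda>r :: real. exp (- (1 / 2) * r))"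
    by (rule set_integrable_lborel_nonneg) (auto intro!: set_borel_measurable_continuous continuous_intros)
  then show ?thesis by (intro set_integrable_mult_right) simp
qed

text \<open>Half of the decay exp (- r) is spent on absorbing the power, the other half is kept as a
  majorant. The bound is uniform for w near z, so that it also permits differentiation with respect
  to w.\<close>

lemma gamma_ray_bound:
  fixes z s :: complex
  assumes z: "Re z > 0"
  obtains d C where "d > 0" "\<And>w. w \<in> ball z d \<Longrightarrow> Re w > 0"
    "\<And>w r. w \<in> ball z d \<Longrightarrow> r \<ge> 0 \<Longrightarrow>
      norm ((w + of_real r) powr s * exp (- (w + of_real r))) \<le> C * exp (- r / 2)"
proof -
  \<comment> \<open>Every point of the ball then has real part larger than \<open>d\<close>.\<close>
  define d where "d = Re z / 2"
  define m where "m = min 1 d"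
  define R where "R = norm z + d + 1"
  define S where "S = norm s"
  define N where "N = nat \<lceil>S\<rceil>"
  have d: "d > 0" using z by (simp add: d_def)
  have m: "m > 0" "m \<le> 1" using d by (auto simp: m_def)
  have Rew: "Re w > d" "norm w \<le> R - 1" if "w \<in> ball z d" for w
  proof -
    have "norm (z - w) < d" using that by (simp add: dist_norm)
    moreover have "Re (z - w) \<le> norm (z - w)" by (rule complex_Re_le_cmod)
    ultimately show "Re w > d" by (simp add: d_def)
    have "norm w \<le> norm z + norm (z - w)"
      using norm_triangle_ineq4[of z "z - w"] by simp
    with \<open>norm (z - w) < d\<close> show "norm w \<le> R - 1" by (simp add: R_def)
  qed
  define C where "C = exp (pi * S) * (fact N * (2 / m) ^ N * exp (R / 2))"
  have "norm ((w + of_real r) powr s * exp (- (w + of_real r))) \<le> C * exp (- r / 2)"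
    if w: "w \<in> ball z d" and r: "r \<ge> 0" for w r
  proof -
    have "norm ((w + of_real r) powr s) \<le> exp (pi * S) * ((R + r) / min 1 d) powr S"
    proof (rule norm_powr_le_exp)
      show "Re (w + of_real r) > 0" using Rew[OF w] d r by simp
      show "norm (w + of_real r) \<le> R + r"
        using norm_triangle_ineq[of w "of_real r"] Rew[OF w] r by simp
      show "d \<le> norm (w + of_real r)"
        using complex_Re_le_cmod[of "w + of_real r"] Rew[OF w] r by simp
      show "1 \<le> R + r" using d r by (simp add: R_def add_nonneg_nonneg)
    qed (simp_all add: d S_def)
    also have "((R + r) / min 1 d) powr S \<le> fact N * (2 / m) ^ N * exp ((R + r) / 2)"
    proof -
      \<comment> \<open>As y >= 1, the real exponent may be rounded up to \<open>N\<close>; writing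
        y = (2 / m) (m y / 2) sends exactly (R + r) / 2 into the exponential.\<close>
      define y where "y = (R + r) / m"
      have "R + r \<ge> 1" using d r by (simp add: R_def add_nonneg_nonneg)
      then have y: "y \<ge> 1" using m by (simp add: y_def field_simps)
      have "y powr S \<le> y powr real N"
        unfolding N_def using y by (intro powr_mono) linarith+
      also have "\<dots> = (2 / m) ^ N * (m * y / 2) ^ N"
        using y m by (simp add: powr_realpow power_mult_distrib[symmetric])
      also have "(m * y / 2) ^ N \<le> fact N * exp (m * y / 2)"
        by (rule power_le_fact_exp) (use m y in auto)
      also have "m * y / 2 = (R + r) / 2" using m by (simp add: y_def)
      finally show ?thesis
        using m by (simp add: y_def m_def[symmetric] mult_ac)
    qed
    finally have "norm ((w + of_real r) powr s) \<le> exp (pi * S) * (fact N * (2 / m) ^ N * exp ((R + r) / 2))"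
      by (simp add: mult_left_mono)
    moreover have "norm (exp (- (w + of_real r))) \<le> exp (- r)"
      using Rew[OF w] d by simp
    ultimately have "norm ((w + of_real r) powr s * exp (- (w + of_real r))) \<le>
        exp (pi * S) * (fact N * (2 / m) ^ N * exp ((R + r) / 2)) * exp (- r)"
      unfolding norm_mult using m by (intro mult_mono) auto
    also have "\<dots> = C * (exp (r / 2) * exp (- r))"
      by (simp add: C_def exp_add add_divide_distrib)
    also have "exp (r / 2) * exp (- r) = exp (- r / 2)"
      by (simp flip: exp_add)
    finally show ?thesis .
  qed
  then show ?thesis using d Rew(1) by (intro that[of d C]) force+
qed

text \<open>The integrand of the incomplete Gamma function with its exponent named \<open>s\<close>,
  so that \<open>upper_Gamma s\<close> integrates \<open>ray (s - 1)\<close>.\<close>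

definition ray :: "complex \<Rightarrow> complex \<Rightarrow> real \<Rightarrow> complex" where
  "ray s w r = (w + of_real r) powr s * exp (- (w + of_real r))"

lemma ray_deriv:
  assumes "Re w > 0" "r \<ge> 0"
  shows "((\<lambda>w. ray s w r) has_field_derivative s * ray (s - 1) w r - ray s w r) (at w)"
proof -
  have "w + of_real r \<notin> \<real>\<^sub>\<le>\<^sub>0"
    using assms by (auto simp: complex_nonpos_Reals_iff)
  then have "((\<lambda>w. (w + of_real r) powr s) has_field_derivative s * (w + of_real r) powr (s - 1)) (at w)"
    by (auto intro!: derivative_eq_intros)
  moreover have "((\<lambda>w. exp (- (w + of_real r))) has_field_derivative - exp (- (w + of_real r))) (at w)"
    by (rule derivative_eq_intros refl | simp)+
  ultimately show ?thesis
    unfolding ray_def by (rule DERIV_cong[OF DERIV_mult]) (simp add: algebra_simps)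
qed

text \<open>As the integrand depends only on w + r, its derivative in r has the same form as the one
  in w. This makes the w-derivative of the integral computable in closed form.\<close>

lemma ray_vector_deriv:
  assumes "Re w > 0" "r \<ge> 0"
  shows "(ray s w has_vector_derivative s * ray (s - 1) w r - ray s w r) (at r within T)"
proof -
  have "((\<lambda>z. (w + z) powr s * exp (- (w + z))) has_field_derivative s * ray (s - 1) w r - ray s w r) (at (of_real r))"
  proof -
    have "w + of_real r \<notin> \<real>\<^sub>\<le>\<^sub>0"
      using assms by (auto simp: complex_nonpos_Reals_iff)
    then have "((\<lambda>z. (w + z) powr s) has_field_derivative s * (w + of_real r) powr (s - 1)) (at (of_real r))"
      by (auto intro!: derivative_eq_intros)
    moreover have "((\<lambda>z. exp (- (w + z))) has_field_derivative - exp (- (w + of_real r))) (at (of_real r))"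
      by (rule derivative_eq_intros refl | simp)+
    ultimately show ?thesis
      unfolding ray_def by (rule DERIV_cong[OF DERIV_mult]) (simp add: algebra_simps)
  qed
  then show ?thesis
    unfolding ray_def[abs_def] by (rule has_vector_derivative_real_field)
qed

lemma continuous_on_ray:
  assumes "\<And>w. w \<in> W \<Longrightarrow> Re w > 0"
  shows "continuous_on (W \<times> {0..}) (\<lambda>(w, r). ray s w r)"
proof -
  have pos: "Re w + r > 0" "w + complex_of_real r \<noteq> 0" if "w \<in> W" "r \<ge> 0" for w r
    using assms[OF that(1)] that(2) by (auto simp: complex_eq_iff)
  show ?thesis
    unfolding ray_def case_prod_unfold
    by (intro continuous_intros) (auto simp: pos less_imp_le)
qed

lemma continuous_on_ray':
  assumes "Re w > 0"
  shows "continuous_on {0..} (ray s w)"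
proof -
  have "continuous_on {0..} (\<lambda>r :: real. (w, r))" by (intro continuous_intros)
  moreover have "continuous_on ({w} \<times> {0..}) (\<lambda>(w, r). ray s w r)"
    by (rule continuous_on_ray) (use assms in simp)
  ultimately show ?thesis
    using continuous_on_compose2[of "{w} \<times> {0..}" "\<lambda>(w, r). ray s w r" "{0..}" "\<lambda>r. (w, r)"] by auto
qed

lemma set_integrable_ray:
  assumes "Re w > 0"
  shows "set_integrable lborel {0..} (ray s w)"
proof -
  obtain d C where d: "d > 0" "\<And>v r. v \<in> ball w d \<Longrightarrow> r \<ge> 0 \<Longrightarrow> norm (ray s v r) \<le> C * exp (- r / 2)"
    using gamma_ray_bound[OF assms, of s] unfolding ray_def by metis
  show ?thesis
  proof (rule set_integrable_bound[OF set_integrable_exp_decay[of C]])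
    show "set_borel_measurable lborel {0..} (ray s w)"
      using borel_measurable_continuous_on_indicator[OF _ continuous_on_ray'[OF assms]]
      by (simp add: set_borel_measurable_def)
    show "AE r in lborel. r \<in> {0..} \<longrightarrow> norm (ray s w r) \<le> norm (C * exp (- r / 2))"
    proof (intro AE_I2 impI)
      fix r :: real assume "r \<in> {0..}"
      then have "norm (ray s w r) \<le> C * exp (- r / 2)" using d by simp
      then show "norm (ray s w r) \<le> norm (C * exp (- r / 2))" by simp
    qed
  qed
qed

lemma upper_Gamma_eq:
  assumes "Re w > 0"
  shows "upper_Gamma s w = (LINT r:{0..}|lborel. ray (s - 1) w r)"
  using set_borel_integral_eq_integral(2)[OF set_integrable_ray[OF assms, of "s - 1"]]
  by (simp only: upper_Gamma_def ray_def[abs_def])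

lemma ray_tendsto_0:
  assumes "Re w > 0"
  shows "(ray s w \<longlongrightarrow> 0) at_top"
proof -
  obtain d C where d: "d > 0" "\<And>v r. v \<in> ball w d \<Longrightarrow> r \<ge> 0 \<Longrightarrow> norm (ray s v r) \<le> C * exp (- r / 2)"
    using gamma_ray_bound[OF assms, of s] unfolding ray_def by metis
  have "((\<lambda>r. C * exp (- r / 2)) \<longlongrightarrow> 0) at_top"
    by real_asymp
  then show ?thesis
    by (rule Lim_null_comparison[rotated], intro eventually_mono[OF eventually_ge_at_top[of 0]]) (use d in auto)
qed

text \<open>The integrand is the r-derivative of \<open>ray s w\<close>, so only the boundary value
  at r = 0 survives. Both the recurrence and the derivative of \<open>upper_Gamma\<close> follow
  from this.\<close>

lemma ray_integral_identity:
  assumes "Re w > 0"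
  shows "(LINT r:{0..}|lborel. s * ray (s - 1) w r - ray s w r) = - (w powr s * exp (- w))"
    and "set_integrable lborel {0..} (\<lambda>r. s * ray (s - 1) w r - ray s w r)"
proof -
  show i: "set_integrable lborel {0..} (\<lambda>r. s * ray (s - 1) w r - ray s w r)"
    by (intro set_integral_diff(1) set_integrable_mult_right impI set_integrable_ray assms)
  have "(LINT r:{0..}|lborel. s * ray (s - 1) w r - ray s w r) = 0 - ray s w 0"
    by (rule set_integral_FTC_atLeast[OF i ray_vector_deriv[OF assms] ray_tendsto_0[OF assms]]) auto
  then show "(LINT r:{0..}|lborel. s * ray (s - 1) w r - ray s w r) = - (w powr s * exp (- w))"
    by (simp add: ray_def)
qed

lemma upper_Gamma_recurrence:
  assumes "Re w > 0"
  shows "upper_Gamma (s + 1) w = s * upper_Gamma s w + w powr s * exp (- w)"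
proof -
  have "(LINT r:{0..}|lborel. s * ray (s - 1) w r - ray s w r) =
      s * (LINT r:{0..}|lborel. ray (s - 1) w r) - (LINT r:{0..}|lborel. ray s w r)"
    by (subst set_integral_diff(2)) (auto intro!: set_integrable_ray assms)
  then have "(LINT r:{0..}|lborel. ray s w r) = s * (LINT r:{0..}|lborel. ray (s - 1) w r) - - (w powr s * exp (- w))"
    unfolding ray_integral_identity(1)[OF assms] by (simp only: diff_diff_eq2 add_diff_cancel_left')
  then show ?thesis
    by (simp add: upper_Gamma_eq[OF assms])
qed

text \<open>Differentiating under the integral yields the integrand of
  \<open>ray_integral_identity\<close> with s - 1 for s, which integrates to a boundary
  value.\<close>

lemma has_field_derivative_upper_Gamma:
  assumes w: "Re w > 0"
  shows "(upper_Gamma s has_field_derivative - (w powr (s - 1) * exp (- w))) (at w)"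
proof -
  obtain d C where d: "d > 0" "\<And>v. v \<in> ball w d \<Longrightarrow> Re v > 0"
     "\<And>v r. v \<in> ball w d \<Longrightarrow> r \<ge> 0 \<Longrightarrow> norm (ray (s - 1) v r) \<le> C * exp (- r / 2)"
    using gamma_ray_bound[OF w, of "s - 1"] unfolding ray_def by metis
  define f' where "f' v r = (s - 1) * ray (s - 1 - 1) v r - ray (s - 1) v r" for v r
  obtain D where D: "((\<lambda>v. LINT r:{0..}|lborel. ray (s - 1) v r) has_field_derivative D) (at w)"
    "(\<lambda>n. integral {0..0 + real n} (f' w)) \<longlonglongrightarrow> D"
  proof (rule parameter_integral_derivative[OF d(1)])
    show "((\<lambda>v. ray (s - 1) v r) has_field_derivative f' v r) (at v)" if "v \<in> ball w d" "0 \<le> r" for v r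
      unfolding f'_def using ray_deriv[OF d(2)[OF that(1)] that(2), of "s - 1"] .
    show "continuous_on {0..} (ray (s - 1) v)" if "v \<in> ball w d" for v
      by (rule continuous_on_ray'[OF d(2)[OF that]])
    have "continuous_on (ball w d \<times> {0..}) (\<lambda>x. (s - 1) * (case x of (v, r) \<Rightarrow> ray (s - 1 - 1) v r) - (case x of (v, r) \<Rightarrow> ray (s - 1) v r))"
      by (intro continuous_intros continuous_on_ray d(2))
    then show "continuous_on (ball w d \<times> {0..}) (\<lambda>(v, r). f' v r)"
      by (simp add: f'_def case_prod_unfold)
    show "set_integrable lborel {0..} (\<lambda>r. C * exp (- r / 2))"
      by (rule set_integrable_exp_decay)
  qed (use d(3) in auto)
  have "(\<lambda>n. integral {0..0 + real n} (f' w)) \<longlonglongrightarrow> (LINT r:{0..}|lborel. f' w r)"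
    unfolding f'_def by (intro set_integral_atLeast_tendsto ray_integral_identity(2) w)
  then have "D = (LINT r:{0..}|lborel. f' w r)"
    by (rule LIMSEQ_unique[OF D(2)])
  also have "\<dots> = - (w powr (s - 1) * exp (- w))"
    unfolding f'_def by (rule ray_integral_identity(1)[OF w])
  finally have "D = - (w powr (s - 1) * exp (- w))" .
  with D(1) have "((\<lambda>v. LINT r:{0..}|lborel. ray (s - 1) v r) has_field_derivative - (w powr (s - 1) * exp (- w))) (at w)"
    by simp
  then show ?thesis
    by (rule has_field_derivative_transform_within_open[of _ _ _ "ball w d"])
       (use d upper_Gamma_eq in auto)
qed

text \<open>
  On \<open>crandall_dom\<close> the Crandall function is \<open>gamma_ratio (\<nu> / 2)\<close> composed with
  \<open>\<lambda>u. \<pi> u\<^sup>2\<close>, and differentiating \<open>gamma_ratio s\<close> only shifts \<open>s\<close> to \<open>s + 1\<close>.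
\<close>

definition gamma_ratio :: "complex \<Rightarrow> complex \<Rightarrow> complex" where
  "gamma_ratio s w = upper_Gamma s w / w powr s"

text \<open>In the quotient rule the numerator s \<Gamma>(s, w) + w^s exp (- w) is \<Gamma>(s + 1,
  w) by the recurrence.\<close>

lemma has_field_derivative_gamma_ratio:
  assumes w: "Re w > 0"
  shows "(gamma_ratio s has_field_derivative - gamma_ratio (s + 1) w) (at w)"
proof -
  have w0: "w \<noteq> 0" "w \<notin> \<real>\<^sub>\<le>\<^sub>0" using w by (auto simp: complex_nonpos_Reals_iff)
  have p: "w powr s \<noteq> 0" "w powr (s + 1) = w powr s * w" "w powr (s - 1) = w powr s / w"
    using w0 by (simp_all add: powr_add powr_diff)
  have "(gamma_ratio s has_field_derivative
     (- (w powr (s - 1) * exp (- w)) * w powr s - upper_Gamma s w * (s * w powr (s - 1))) / (w powr s * w powr s)) (at w)"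
    unfolding gamma_ratio_def[abs_def]
    by (intro DERIV_divide has_field_derivative_upper_Gamma w has_field_derivative_powr p w0)
  also have "(- (w powr (s - 1) * exp (- w)) * w powr s - upper_Gamma s w * (s * w powr (s - 1))) / (w powr s * w powr s)
     = - gamma_ratio (s + 1) w"
    unfolding gamma_ratio_def upper_Gamma_recurrence[OF w] p(2,3) using p(1) w0
    by (simp add: field_simps)
  finally show ?thesis .
qed

section \<open>Derivatives of the Crandall function\<close>

lemma sq_sum_cvec: "sq_sum (cvec u) = of_real ((norm u)\<^sup>2)"
  by (simp add: sq_sum_def cvec_def norm_squared_vec)

lemma Re_sq_sum_crandall_dom:
  assumes "u \<in> crandall_dom"
  shows "Re (sq_sum u) > 0"
proof -
  have "(norm (\<chi> j. Im (u $ j)))\<^sup>2 < (norm (\<chi> j. Re (u $ j)))\<^sup>2"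
    using assms by (intro power_strict_mono) (auto simp: crandall_dom_def)
  then show ?thesis
    by (simp add: norm_squared_vec sq_sum_def Re_power2 sum_subtractf)
qed

lemma open_crandall_dom: "open (crandall_dom :: (complex ^ 'n) set)"
  unfolding crandall_dom_def by (intro open_Collect_less continuous_intros)

lemma cvec_crandall_dom: "u \<noteq> 0 \<Longrightarrow> cvec u \<in> crandall_dom"
proof -
  have "(\<chi> j. Im (cvec u $ j)) = 0" "(\<chi> j. Re (cvec u $ j)) = u"
    by (simp_all add: cvec_def vec_eq_iff)
  then show "u \<noteq> 0 \<Longrightarrow> cvec u \<in> crandall_dom"
    by (simp add: crandall_dom_def)
qed

lemma crandall_eq_gamma_ratio:
  assumes "u \<in> crandall_dom"
  shows "crandall \<nu> u = gamma_ratio (\<nu> / 2) (of_real pi * sq_sum u)"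
proof -
  have "u \<noteq> 0"
    using Re_sq_sum_crandall_dom[OF assms] by (auto simp: sq_sum_def)
  then show ?thesis by (simp add: crandall_def gamma_ratio_def)
qed

section \<open>Differentiation along coordinate lines\<close>

definition line_point :: "'n \<Rightarrow> complex ^ 'n \<Rightarrow> complex \<Rightarrow> complex ^ 'n" where
  "line_point j u w = (\<chi> i. if i = j then w else u $ i)"

lemma line_point_self [simp]: "line_point j u (u $ j) = u"
  by (simp add: line_point_def vec_eq_iff)

lemma pd_line_eq: "pd_line j f u w = f (line_point j u w)"
  by (simp add: pd_line_def line_point_def)

lemma open_line_crandall_dom: "open {w. line_point j u w \<in> crandall_dom}"
proof -
  have "continuous_on UNIV (line_point j u)"
    unfolding line_point_def
  proof (intro continuous_on_vec_lambda)
    show "continuous_on UNIV (\<lambda>w. if i = j then w else u $ i)" for i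
      by (cases "i = j") auto
  qed
  then have "open (line_point j u -` crandall_dom)"
    using open_vimage[OF open_crandall_dom] by blast
  then show ?thesis by (simp add: vimage_def)
qed

text \<open>A coordinate line meets the open set \<open>crandall_dom\<close> in an open set, so a
  formula valid only on that domain may be substituted before differentiating.\<close>

lemma line_derivative_transform:
  assumes u: "u \<in> crandall_dom"
    and eq: "\<And>v. v \<in> crandall_dom \<Longrightarrow> f v = g v"
    and d: "(pd_line j g u has_field_derivative D) (at (u $ j))"
  shows "(pd_line j f u has_field_derivative D) (at (u $ j))"
  by (rule has_field_derivative_transform_within_open[OF d open_line_crandall_dom[of j u]])
     (use u eq in \<open>auto simp: pd_line_eq\<close>)

lemma crandall_line_derivative:
  assumes u: "u \<in> crandall_dom"
  shows "(pd_line j (crandall \<nu>) u has_field_derivative - 2 * of_real pi * u $ j * crandall (\<nu> + 2) u) (at (u $ j))"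
proof (rule line_derivative_transform[OF u crandall_eq_gamma_ratio])
  let ?X = "\<lambda>w. of_real pi * sq_sum (line_point j u w)"
  have sq: "sq_sum (line_point j u w) = w\<^sup>2 + (\<Sum>i\<in>UNIV - {j}. (u $ i)\<^sup>2)" for w
    unfolding sq_sum_def by (subst sum.remove[of _ j]) (auto simp: line_point_def intro!: sum.cong)
  have X: "(?X has_field_derivative of_real pi * (2 * u $ j)) (at (u $ j))"
    unfolding sq by (auto intro!: derivative_eq_intros)
  have "Re (?X (u $ j)) > 0"
    using Re_sq_sum_crandall_dom[OF u] by simp
  from DERIV_chain2[OF has_field_derivative_gamma_ratio[OF this] X]
  have "((\<lambda>w. gamma_ratio (\<nu> / 2) (?X w)) has_field_derivative - gamma_ratio (\<nu> / 2 + 1) (?X (u $ j)) * (of_real pi * (2 * u $ j))) (at (u $ j))" .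
  moreover have "\<nu> / 2 + 1 = (\<nu> + 2) / 2" by simp
  ultimately show "(pd_line j (\<lambda>u. gamma_ratio (\<nu> / 2) (of_real pi * sq_sum u)) u has_field_derivative
      - 2 * of_real pi * u $ j * crandall (\<nu> + 2) u) (at (u $ j))"
    unfolding pd_line_eq[abs_def] crandall_eq_gamma_ratio[OF u] by (simp add: mult_ac)
qed

definition crandall_sum :: "nat ^ 'n \<Rightarrow> complex \<Rightarrow> complex ^ 'n \<Rightarrow> complex" where
  "crandall_sum \<alpha> \<nu> u = (\<Sum>\<beta> | \<forall>j. 2 * \<beta> $ j \<le> \<alpha> $ j.
     p_poly \<alpha> \<beta> u * crandall (\<nu> + 2 * of_nat (mi_abs \<alpha>) - 2 * of_nat (mi_abs \<beta>)) u)"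

lemma p_poly_eq_prod:
  assumes "\<And>j. 2 * \<beta> $ j \<le> \<alpha> $ j"
  shows "p_poly \<alpha> \<beta> y = (\<Prod>j\<in>UNIV. p_coeff (\<alpha> $ j) (\<beta> $ j) * (y $ j) ^ (\<alpha> $ j - 2 * \<beta> $ j))"
proof -
  have "\<beta> $ j \<le> \<alpha> $ j" for j using assms[of j] by linarith
  then have "mi_abs \<alpha> - mi_abs \<beta> = (\<Sum>j\<in>UNIV. \<alpha> $ j - \<beta> $ j)"
    unfolding mi_abs_def by (intro sum_subtractf_nat[symmetric]) simp
  then show ?thesis
    unfolding p_poly_def mi_falling_def mi_binom_def mi_pow_def p_coeff_def
    by (simp add: power_sum prod.distrib power_mult_distrib mult_ac)
qed

text \<open>Each \<beta> is \<gamma> plus its j-th coordinate k. A derivative in direction j then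
  acts on the inner sum over k alone.\<close>

lemma sum_double_le_split:
  fixes F :: "nat ^ 'n \<Rightarrow> complex"
  shows "(\<Sum>\<beta> | \<forall>i. 2 * \<beta> $ i \<le> \<alpha> $ i. F \<beta>) =
    (\<Sum>\<gamma> | (\<forall>i. i \<noteq> j \<longrightarrow> 2 * \<gamma> $ i \<le> \<alpha> $ i) \<and> \<gamma> $ j = 0. \<Sum>k | 2 * k \<le> \<alpha> $ j. F (\<gamma> + axis j k))"
proof -
  let ?G = "{\<gamma>. (\<forall>i. i \<noteq> j \<longrightarrow> 2 * \<gamma> $ i \<le> \<alpha> $ i) \<and> \<gamma> $ j = 0}"
  let ?K = "{k. 2 * k \<le> \<alpha> $ j}"
  have bij: "bij_betw (\<lambda>(\<gamma>, k). \<gamma> + axis j k) (?G \<times> ?K) {\<beta>. \<forall>i. 2 * \<beta> $ i \<le> \<alpha> $ i}"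
  proof (rule bij_betwI[where g = "\<lambda>\<beta>. (\<chi> i. if i = j then 0 else \<beta> $ i, \<beta> $ j)"])
    show "(\<lambda>(\<gamma>, k). \<gamma> + axis j k) \<in> ?G \<times> ?K \<rightarrow> {\<beta>. \<forall>i. 2 * \<beta> $ i \<le> \<alpha> $ i}"
      by (auto simp: axis_def)
    show "(\<lambda>\<beta>. (\<chi> i. if i = j then 0 else \<beta> $ i, \<beta> $ j)) \<in> {\<beta>. \<forall>i. 2 * \<beta> $ i \<le> \<alpha> $ i} \<rightarrow> ?G \<times> ?K"
      by auto
  qed (auto simp: vec_eq_iff axis_def)
  have "(\<Sum>\<beta> | \<forall>i. 2 * \<beta> $ i \<le> \<alpha> $ i. F \<beta>) = (\<Sum>(\<gamma>, k)\<in>?G \<times> ?K. F (\<gamma> + axis j k))"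
    by (subst sum.reindex_bij_betw[OF bij, symmetric]) (simp add: case_prod_unfold)
  also have "\<dots> = (\<Sum>\<gamma>\<in>?G. \<Sum>k\<in>?K. F (\<gamma> + axis j k))"
    by (simp add: sum.cartesian_product)
  finally show ?thesis .
qed

text \<open>\<open>g\<close> stands for the Crandall functions along one line, of which only the
  rule that a derivative raises the order by 2 is used. In the product rule ?A differentiates
  \<open>g\<close> and ?B the power; as (\<mu> + 2) - 2 (k + 1) = \<mu> - 2 k, shifting ?B by one
  brings both to the same order, and \<open>p_coeff_recurrence\<close> adds them up.\<close>

lemma crandall_sum_line_derivative_1d:
  fixes g :: "complex \<Rightarrow> complex \<Rightarrow> complex"
  assumes g: "\<And>\<mu>. (g \<mu> has_field_derivative - 2 * of_real pi * x * g (\<mu> + 2) x) (at x)"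
  shows "((\<lambda>w. \<Sum>k | 2 * k \<le> n. p_coeff n k * w ^ (n - 2 * k) * g (\<mu> - 2 * of_nat k) w) has_field_derivative
     (\<Sum>k | 2 * k \<le> Suc n. p_coeff (Suc n) k * x ^ (Suc n - 2 * k) * g (\<mu> + 2 - 2 * of_nat k) x)) (at x)"
proof -
  let ?A = "\<lambda>k. - 2 * of_real pi * x * (p_coeff n k * x ^ (n - 2 * k)) * g (\<mu> + 2 - 2 * of_nat k) x"
  let ?B = "\<lambda>k. p_coeff n k * (of_nat (n - 2 * k) * x ^ (n - 2 * k - 1)) * g (\<mu> - 2 * of_nat k) x"
  have "((\<lambda>w. \<Sum>k | 2 * k \<le> n. p_coeff n k * w ^ (n - 2 * k) * g (\<mu> - 2 * of_nat k) w) has_field_derivative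
     (\<Sum>k | 2 * k \<le> n. ?A k + ?B k)) (at x)"
  proof (rule DERIV_sum)
    fix k
    have e: "\<mu> - 2 * of_nat k + 2 = \<mu> + 2 - 2 * of_nat k" by simp
    have "((\<lambda>w. p_coeff n k * w ^ (n - 2 * k)) has_field_derivative p_coeff n k * (of_nat (n - 2 * k) * x ^ (n - 2 * k - 1))) (at x)"
      by (auto intro!: derivative_eq_intros)
    from DERIV_mult[OF this g[of "\<mu> - 2 * of_nat k"]]
    show "((\<lambda>w. p_coeff n k * w ^ (n - 2 * k) * g (\<mu> - 2 * of_nat k) w) has_field_derivative ?A k + ?B k) (at x)"
      unfolding e by (rule DERIV_cong) (simp add: algebra_simps)
  qed
  also have "(\<Sum>k | 2 * k \<le> n. ?A k + ?B k) =
     (\<Sum>k | 2 * k \<le> Suc n. (if 2 * k \<le> n then ?A k else 0) + (if k = 0 then 0 else ?B (k - 1)))"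
  proof -
    have 1: "(\<Sum>k | 2 * k \<le> Suc n. if 2 * k \<le> n then ?A k else 0) = (\<Sum>k | 2 * k \<le> n. ?A k)"
      by (rule sum.mono_neutral_cong_right) auto
    have 2: "(\<Sum>k | 2 * k \<le> Suc n. if k = 0 then 0 else ?B (k - 1)) = (\<Sum>k | 2 * Suc k \<le> Suc n. ?B k)"
      by (rule sum_double_shift)
    \<comment> \<open>The only index added on the right can be 2k = n, where ?B vanishes through its
      factor n - 2k.\<close>
    have 3: "(\<Sum>k | 2 * Suc k \<le> Suc n. ?B k) = (\<Sum>k | 2 * k \<le> n. ?B k)"
      by (rule sum.mono_neutral_left) auto
    show ?thesis unfolding sum.distrib 1 2 3 ..
  qed
  also have "\<dots> = (\<Sum>k | 2 * k \<le> Suc n. p_coeff (Suc n) k * x ^ (Suc n - 2 * k) * g (\<mu> + 2 - 2 * of_nat k) x)"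
  proof (rule sum.cong)
    fix k assume "k \<in> {k. 2 * k \<le> Suc n}"
    then have k: "2 * k \<le> Suc n" by simp
    have B: "?B (k - 1) = p_coeff n (k - 1) * (of_nat (n - 2 * (k - 1)) * x ^ (n - 2 * (k - 1) - 1)) * g (\<mu> + 2 - 2 * of_nat k) x"
      if "k \<noteq> 0"
    proof -
      have "\<mu> - 2 * of_nat (k - 1) = \<mu> + 2 - 2 * of_nat k" using that by (cases k) auto
      then show ?thesis by (simp only:)
    qed
    show "(if 2 * k \<le> n then ?A k else 0) + (if k = 0 then 0 else ?B (k - 1)) =
       p_coeff (Suc n) k * x ^ (Suc n - 2 * k) * g (\<mu> + 2 - 2 * of_nat k) x"
      unfolding p_coeff_recurrence[OF k] distrib_right
      using B by (cases "2 * k \<le> n"; cases "k = 0") (simp_all only: if_True if_False mult_zero_left mult_zero_right, simp_all)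
  qed simp
  finally show ?thesis .
qed

text \<open>With coordinate j split off, the factors of the other coordinates, collected in
  \<open>P\<close>, are constant along the line, so the claim is the one-dimensional rule under a
  finite sum.\<close>

lemma crandall_sum_line_derivative:
  assumes u: "u \<in> crandall_dom"
  shows "(pd_line j (crandall_sum \<alpha> \<nu>) u has_field_derivative crandall_sum (\<alpha> + axis j 1) \<nu> u) (at (u $ j))"
proof -
  let ?G = "{\<gamma> :: nat ^ 'a. (\<forall>i. i \<noteq> j \<longrightarrow> 2 * \<gamma> $ i \<le> \<alpha> $ i) \<and> \<gamma> $ j = 0}"
  define P where "P \<gamma> = (\<Prod>i\<in>UNIV - {j}. p_coeff (\<alpha> $ i) (\<gamma> $ i) * (u $ i) ^ (\<alpha> $ i - 2 * \<gamma> $ i))" for \<gamma> :: "nat ^ 'a"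
  define \<mu> where "\<mu> \<gamma> = \<nu> + 2 * of_nat (mi_abs \<alpha>) - 2 * of_nat (mi_abs \<gamma>)" for \<gamma> :: "nat ^ 'a"
  define g where "g m w = crandall m (line_point j u w)" for m w
  have mi_axis: "mi_abs (\<gamma> + axis j k) = mi_abs \<gamma> + k" for \<gamma> and k
    by (simp add: mi_abs_def sum.distrib axis_def)
  have poly: "p_poly (\<alpha> + axis j e) (\<gamma> + axis j k) (line_point j u w) = P \<gamma> * (p_coeff (\<alpha> $ j + e) k * w ^ (\<alpha> $ j + e - 2 * k))"
    if "\<gamma> \<in> ?G" "2 * k \<le> \<alpha> $ j + e" for \<gamma> k e w
  proof -
    have "2 * (\<gamma> + axis j k) $ i \<le> (\<alpha> + axis j e) $ i" for i
      using that by (cases "i = j") (auto simp: axis_def)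
    then have "p_poly (\<alpha> + axis j e) (\<gamma> + axis j k) (line_point j u w) = (\<Prod>i\<in>UNIV. p_coeff ((\<alpha> + axis j e) $ i) ((\<gamma> + axis j k) $ i)
        * (line_point j u w $ i) ^ ((\<alpha> + axis j e) $ i - 2 * (\<gamma> + axis j k) $ i))"
      by (rule p_poly_eq_prod)
    also have "\<dots> = p_coeff (\<alpha> $ j + e) k * w ^ (\<alpha> $ j + e - 2 * k) * P \<gamma>"
      unfolding P_def using that
      by (subst prod.remove[of _ j]) (auto simp: axis_def line_point_def intro!: arg_cong2[of _ _ _ _ "(*)"] prod.cong)
    finally show ?thesis by (simp add: mult.commute)
  qed
  \<comment> \<open>One expansion serves twice: \<open>e = 0\<close> for the function that is
    differentiated, \<open>e = 1\<close> for its derivative.\<close>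
  have sum_eq: "crandall_sum (\<alpha> + axis j e) \<nu> (line_point j u w) =
     (\<Sum>\<gamma>\<in>?G. P \<gamma> * (\<Sum>k | 2 * k \<le> \<alpha> $ j + e. p_coeff (\<alpha> $ j + e) k * w ^ (\<alpha> $ j + e - 2 * k) * g (\<mu> \<gamma> + 2 * of_nat e - 2 * of_nat k) w))"
    for e w
  proof -
    have "crandall_sum (\<alpha> + axis j e) \<nu> (line_point j u w) =
      (\<Sum>\<gamma> | (\<forall>i. i \<noteq> j \<longrightarrow> 2 * \<gamma> $ i \<le> (\<alpha> + axis j e) $ i) \<and> \<gamma> $ j = 0. \<Sum>k | 2 * k \<le> (\<alpha> + axis j e) $ j.
         p_poly (\<alpha> + axis j e) (\<gamma> + axis j k) (line_point j u w) *
         crandall (\<nu> + 2 * of_nat (mi_abs (\<alpha> + axis j e)) - 2 * of_nat (mi_abs (\<gamma> + axis j k))) (line_point j u w))"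
      unfolding crandall_sum_def by (rule sum_double_le_split)
    also have "{\<gamma>. (\<forall>i. i \<noteq> j \<longrightarrow> 2 * \<gamma> $ i \<le> (\<alpha> + axis j e) $ i) \<and> \<gamma> $ j = 0} = ?G"
      by (auto simp: axis_def)
    also have "(\<alpha> + axis j e) $ j = \<alpha> $ j + e" by (simp add: axis_def)
    also have "(\<Sum>\<gamma>\<in>?G. \<Sum>k | 2 * k \<le> \<alpha> $ j + e. p_poly (\<alpha> + axis j e) (\<gamma> + axis j k) (line_point j u w) *
         crandall (\<nu> + 2 * of_nat (mi_abs (\<alpha> + axis j e)) - 2 * of_nat (mi_abs (\<gamma> + axis j k))) (line_point j u w)) =
      (\<Sum>\<gamma>\<in>?G. P \<gamma> * (\<Sum>k | 2 * k \<le> \<alpha> $ j + e. p_coeff (\<alpha> $ j + e) k * w ^ (\<alpha> $ j + e - 2 * k) * g (\<mu> \<gamma> + 2 * of_nat e - 2 * of_nat k) w))"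
    proof (intro sum.cong refl, unfold sum_distrib_left, intro sum.cong refl)
      fix \<gamma> k assume "\<gamma> \<in> ?G" "k \<in> {k. 2 * k \<le> \<alpha> $ j + e}"
      moreover have "\<nu> + 2 * of_nat (mi_abs (\<alpha> + axis j e)) - 2 * of_nat (mi_abs (\<gamma> + axis j k)) = \<mu> \<gamma> + 2 * of_nat e - 2 * of_nat k"
        by (simp add: mi_axis \<mu>_def algebra_simps)
      ultimately show "p_poly (\<alpha> + axis j e) (\<gamma> + axis j k) (line_point j u w) *
         crandall (\<nu> + 2 * of_nat (mi_abs (\<alpha> + axis j e)) - 2 * of_nat (mi_abs (\<gamma> + axis j k))) (line_point j u w) =
         P \<gamma> * (p_coeff (\<alpha> $ j + e) k * w ^ (\<alpha> $ j + e - 2 * k) * g (\<mu> \<gamma> + 2 * of_nat e - 2 * of_nat k) w)"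
        using poly[of \<gamma> k e w] by (simp add: g_def mult.assoc)
    qed
    finally show ?thesis .
  qed
  have g: "(g m has_field_derivative - 2 * of_real pi * (u $ j) * g (m + 2) (u $ j)) (at (u $ j))" for m
    using crandall_line_derivative[OF u, of j m] by (simp add: g_def[abs_def] pd_line_eq[abs_def])
  have "((\<lambda>w. \<Sum>\<gamma>\<in>?G. P \<gamma> * (\<Sum>k | 2 * k \<le> \<alpha> $ j. p_coeff (\<alpha> $ j) k * w ^ (\<alpha> $ j - 2 * k) * g (\<mu> \<gamma> - 2 * of_nat k) w)) has_field_derivative
     (\<Sum>\<gamma>\<in>?G. P \<gamma> * (\<Sum>k | 2 * k \<le> Suc (\<alpha> $ j). p_coeff (Suc (\<alpha> $ j)) k * (u $ j) ^ (Suc (\<alpha> $ j) - 2 * k) * g (\<mu> \<gamma> + 2 - 2 * of_nat k) (u $ j)))) (at (u $ j))"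
    by (intro DERIV_sum DERIV_cmult crandall_sum_line_derivative_1d g)
  moreover have "pd_line j (crandall_sum \<alpha> \<nu>) u = (\<lambda>w. \<Sum>\<gamma>\<in>?G. P \<gamma> * (\<Sum>k | 2 * k \<le> \<alpha> $ j. p_coeff (\<alpha> $ j) k * w ^ (\<alpha> $ j - 2 * k) * g (\<mu> \<gamma> - 2 * of_nat k) w))"
  proof
    fix w
    have a0: "\<alpha> + axis j 0 = \<alpha>" by (simp add: vec_eq_iff axis_def)
    show "pd_line j (crandall_sum \<alpha> \<nu>) u w = (\<Sum>\<gamma>\<in>?G. P \<gamma> * (\<Sum>k | 2 * k \<le> \<alpha> $ j. p_coeff (\<alpha> $ j) k * w ^ (\<alpha> $ j - 2 * k) * g (\<mu> \<gamma> - 2 * of_nat k) w))"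
      using sum_eq[of 0 w] unfolding a0 by (simp add: pd_line_eq)
  qed
  moreover have "crandall_sum (\<alpha> + axis j 1) \<nu> u = (\<Sum>\<gamma>\<in>?G. P \<gamma> * (\<Sum>k | 2 * k \<le> Suc (\<alpha> $ j). p_coeff (Suc (\<alpha> $ j)) k * (u $ j) ^ (Suc (\<alpha> $ j) - 2 * k) * g (\<mu> \<gamma> + 2 - 2 * of_nat k) (u $ j)))"
    using sum_eq[of 1 "u $ j"] by simp
  ultimately show ?thesis
    by (simp only:)
qed

lemma crandall_sum_0: "crandall_sum 0 \<nu> = crandall \<nu>"
proof
  fix u :: "complex ^ 'n"
  have "{\<beta> :: nat ^ 'n. \<forall>j. 2 * \<beta> $ j \<le> 0 $ j} = {0}"
    by (auto simp: vec_eq_iff)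
  then show "crandall_sum 0 \<nu> u = crandall \<nu> u"
    by (simp add: crandall_sum_def p_poly_def mi_abs_def mi_falling_def mi_binom_def mi_pow_def falling_def)
qed

text \<open>The closed form depends only on how often each coordinate occurs, which makes the order
  of differentiation immaterial. Since it holds on an open set, it can be differentiated
  again.\<close>

lemma foldr_pd_crandall:
  assumes "u \<in> crandall_dom"
  shows "foldr pd js (crandall \<nu>) u = crandall_sum (\<chi> j. count_list js j) \<nu> u"
  using assms
proof (induction js arbitrary: u)
  case Nil
  have "(\<chi> j. count_list [] j) = (0 :: nat ^ 'a)" by (simp add: vec_eq_iff)
  then show ?case by (simp only: foldr_Nil id_apply crandall_sum_0)
next
  case (Cons i js)
  have "(pd_line i (foldr pd js (crandall \<nu>)) u has_field_derivative crandall_sum ((\<chi> j. count_list js j) + axis i 1) \<nu> u) (at (u $ i))"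
    by (rule line_derivative_transform[OF Cons.prems Cons.IH crandall_sum_line_derivative[OF Cons.prems]])
  moreover have "(\<chi> j. count_list js j) + axis i 1 = (\<chi> j. count_list (i # js) j)"
    by (auto simp: vec_eq_iff axis_def)
  ultimately have "deriv (pd_line i (foldr pd js (crandall \<nu>)) u) (u $ i) = crandall_sum (\<chi> j. count_list (i # js) j) \<nu> u"
    by (simp only: DERIV_imp_deriv)
  then show ?case
    by (simp only: foldr_Cons o_apply pd_def[of i])
qed

lemma ex_count_list: "\<exists>js. \<forall>j. count_list js j = (\<alpha> :: nat ^ 'n) $ j"
proof -
  obtain js where "mset js = (\<Sum>j\<in>UNIV. replicate_mset (\<alpha> $ j) j)"
    using ex_mset by blast
  then have "count (mset js) j = \<alpha> $ j" for j
    by (simp add: count_sum)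
  then show ?thesis by (auto simp: count_mset intro!: exI[of _ js])
qed

lemma nabla_crandall:
  assumes "u \<in> crandall_dom"
  shows "nabla \<alpha> (crandall \<nu>) u = crandall_sum \<alpha> \<nu> u"
proof -
  have "\<forall>j. count_list (SOME js. \<forall>j. count_list js j = \<alpha> $ j) j = \<alpha> $ j"
    by (rule someI_ex[OF ex_count_list])
  then show ?thesis
    unfolding nabla_def by (simp add: foldr_pd_crandall[OF assms])
qed

lemma nabla_crandall_line_derivative:
  assumes "u \<in> crandall_dom"
  shows "(pd_line j (nabla \<alpha> (crandall \<nu>)) u has_field_derivative nabla (\<alpha> + axis j 1) (crandall \<nu>) u) (at (u $ j))"
  unfolding nabla_crandall[OF assms]
  by (rule line_derivative_transform[OF assms nabla_crandall crandall_sum_line_derivative[OF assms]])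

section \<open>Integral representation and the limit at the origin\<close>

lemma has_bochner_integral_Gamma:
  fixes K X :: real
  assumes K: "K > 0" and X: "X > 0"
  shows "has_bochner_integral lborel (\<lambda>t. indicator {0..} t *\<^sub>R (t powr (K - 1) * exp (- X * t))) (Gamma K * X powr (- K))"
proof -
  define G where "G t = indicator {0..} t *\<^sub>R (t powr (K - 1) / exp t)" for t :: real
  have [measurable]: "G \<in> borel_measurable borel"
    unfolding G_def by measurable
  have "has_bochner_integral lborel G (Gamma K)"
  proof (rule has_bochner_integral_nn_integral)
    show "(\<integral>\<^sup>+ x. ennreal (G x) \<partial>lborel) = ennreal (Gamma K)"
      unfolding Gamma_conv_nn_integral_real[OF K] G_def
      by (intro nn_integral_cong) (auto split: split_indicator)
  qed (use K in \<open>auto simp: G_def Gamma_real_pos less_imp_le\<close>)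
  then have "has_bochner_integral lborel (\<lambda>t. G (0 + X * t)) (Gamma K /\<^sub>R \<bar>X\<bar>)"
    using lborel_has_bochner_integral_real_affine_iff[of X G "Gamma K" 0] X by simp
  then have "has_bochner_integral lborel (\<lambda>t. X powr (1 - K) * G (0 + X * t)) (X powr (1 - K) * (Gamma K /\<^sub>R \<bar>X\<bar>))"
    by (rule has_bochner_integral_mult_right)
  also have "(\<lambda>t. X powr (1 - K) * G (0 + X * t)) = (\<lambda>t. indicator {0..} t *\<^sub>R (t powr (K - 1) * exp (- X * t)))"
  proof
    fix t
    show "X powr (1 - K) * G (0 + X * t) = indicator {0..} t *\<^sub>R (t powr (K - 1) * exp (- X * t))"
    proof (cases "t \<ge> 0")
      case True
      have "X powr (1 - K) * (X * t) powr (K - 1) = t powr (K - 1)"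
        using X by (simp add: powr_mult mult.assoc[symmetric] flip: powr_add)
      then show ?thesis
        using True X by (simp add: G_def exp_minus divide_inverse zero_le_mult_iff)
    next
      case False
      then have "\<not> X * t \<ge> 0" using X by (simp add: zero_le_mult_iff)
      then show ?thesis using False by (simp add: G_def)
    qed
  qed
  also have "X powr (1 - K) * (Gamma K /\<^sub>R \<bar>X\<bar>) = Gamma K * X powr (- K)"
    using X by (simp add: powr_diff powr_minus field_simps)
  finally show ?thesis .
qed

lemma
  fixes K X :: real
  assumes "K > 0" "X > 0"
  shows set_integrable_Gamma: "set_integrable lborel {0..} (\<lambda>t. t powr (K - 1) * exp (- X * t))"
    and set_integral_Gamma: "(LINT t:{0..}|lborel. t powr (K - 1) * exp (- X * t)) = Gamma K * X powr (- K)"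
  using has_bochner_integral_Gamma[OF assms]
  by (auto simp: set_integrable_def set_lebesgue_integral_def has_bochner_integral_iff)

lemma norm_of_real_powr: "t > 0 \<Longrightarrow> norm (of_real t powr s :: complex) = t powr Re s"
  by (simp add: norm_powr_real_powr)

lemma continuous_on_of_real_powr:
  "S \<subseteq> {0<..} \<Longrightarrow> continuous_on S (\<lambda>t. of_real t powr s :: complex)"
  by (intro continuous_intros) (auto simp: complex_nonpos_Reals_iff)

lemma set_integrable_complex_bound:
  fixes f :: "real \<Rightarrow> complex"
  assumes "set_integrable lborel S h" "S \<in> sets borel" "continuous_on S f" "\<And>t. t \<in> S \<Longrightarrow> norm (f t) \<le> h t"
  shows "set_integrable lborel S f"
proof (rule set_integrable_bound[OF assms(1)])
  show "set_borel_measurable lborel S f"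
    using set_borel_measurable_continuous[OF assms(2,3)] by (simp add: set_borel_measurable_def)
  show "AE t in lborel. t \<in> S \<longrightarrow> norm (f t) \<le> norm (h t)"
  proof (intro AE_I2 impI)
    fix t assume "t \<in> S"
    then have "norm (f t) \<le> h t" by (rule assms(4))
    then show "norm (f t) \<le> norm (h t)" by simp
  qed
qed

section \<open>Mellin integrals over t >= 1\<close>

text \<open>The Mellin integrand of an exponential. Over t >= 1 it represents
  \<open>gamma_ratio\<close>, over the whole half-line it gives the Gamma function.\<close>

definition exp_tail :: "complex \<Rightarrow> real \<Rightarrow> real \<Rightarrow> complex" where
  "exp_tail s X t = of_real t powr (s - 1) * of_real (exp (- X * t))"

lemma continuous_on_exp_tail: "S \<subseteq> {0<..} \<Longrightarrow> continuous_on S (exp_tail s X)"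
  unfolding exp_tail_def by (intro continuous_intros continuous_on_of_real_powr) 

lemma norm_exp_tail_le:
  assumes "t \<ge> 1" "Re s \<le> K"
  shows "norm (exp_tail s X t) \<le> t powr (K - 1) * exp (- X * t)"
  using assms by (simp add: exp_tail_def norm_mult norm_of_real_powr powr_mono)

text \<open>For t >= 1 the exponent may be raised to any K above Re s, after which the tail is at
  most the complete Gamma integral. The freedom in K gives decay of arbitrary order in X, uniformly
  in Re s <= K.\<close>

lemma
  assumes "X > 0" "Re s \<le> K" "K > 0"
  shows set_integrable_exp_tail: "set_integrable lborel {1..} (exp_tail s X)"
    and norm_integral_exp_tail_le: "norm (LINT t:{1..}|lborel. exp_tail s X t) \<le> Gamma K * X powr (- K)"
proof -
  let ?h = "\<lambda>t :: real. t powr (K - 1) * exp (- X * t)"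
  have h0: "set_integrable lborel {0..} ?h" using assms by (intro set_integrable_Gamma)
  have h: "set_integrable lborel {1..} ?h" by (rule set_integrable_subset[OF h0]) auto
  show i: "set_integrable lborel {1..} (exp_tail s X)"
    by (rule set_integrable_complex_bound[OF h _ continuous_on_exp_tail norm_exp_tail_le]) (use assms in auto)
  have "norm (LINT t:{1..}|lborel. exp_tail s X t) \<le> (LINT t:{1..}|lborel. norm (exp_tail s X t))"
    by (rule set_integral_norm_bound[OF i])
  also have "\<dots> \<le> (LINT t:{1..}|lborel. ?h t)"
    by (rule set_integral_mono[OF set_integrable_norm[OF i] h norm_exp_tail_le]) (use assms in auto)
  also have "\<dots> \<le> (LINT t:{0..}|lborel. ?h t)"
    unfolding set_lebesgue_integral_def
    by (rule integral_mono) (use h h0 in \<open>auto simp: set_integrable_def split: split_indicator\<close>)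
  also have "\<dots> = Gamma K * X powr (- K)"
    using assms by (intro set_integral_Gamma)
  finally show "norm (LINT t:{1..}|lborel. exp_tail s X t) \<le> Gamma K * X powr (- K)" .
qed

text \<open>The substitution r = X (t - 1) carries the ray starting at X to t >= 1, and the powers
  of X cancel against the denominator of \<open>gamma_ratio\<close>.\<close>

lemma gamma_ratio_real:
  assumes X: "X > 0"
  shows "gamma_ratio s (of_real X) = (LINT t:{1..}|lborel. exp_tail s X t)"
proof -
  have Re: "Re (complex_of_real X) > 0" using X by simp
  have "upper_Gamma s (of_real X) = (LINT r|lborel. indicator {0..} r *\<^sub>R ray (s - 1) (of_real X) r)"
    unfolding upper_Gamma_eq[OF Re] set_lebesgue_integral_def ..
  also have "\<dots> = \<bar>X\<bar> *\<^sub>R (LINT t|lborel. indicator {0..} (- X + X * t) *\<^sub>R ray (s - 1) (of_real X) (- X + X * t))"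
    by (rule lborel_integral_real_affine) (use X in simp)
  also have "(\<lambda>t. indicator {0..} (- X + X * t) *\<^sub>R ray (s - 1) (of_real X) (- X + X * t)) =
     (\<lambda>t. of_real X powr (s - 1) * (indicator {1..} t *\<^sub>R exp_tail s X t))"
  proof
    fix t
    have "- X + X * t \<ge> 0 \<longleftrightarrow> X * 1 \<le> X * t" by auto
    also have "\<dots> \<longleftrightarrow> t \<ge> 1" by (subst mult_le_cancel_left_pos[OF X]) simp
    finally have iff: "- X + X * t \<ge> 0 \<longleftrightarrow> t \<ge> 1" .
    show "indicator {0..} (- X + X * t) *\<^sub>R ray (s - 1) (of_real X) (- X + X * t) = of_real X powr (s - 1) * (indicator {1..} t *\<^sub>R exp_tail s X t)"
    proof (cases "t \<ge> 1")
      case True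
      have "of_real X + complex_of_real (- X + X * t) = of_real X * of_real t" by simp
      moreover have "(of_real X * of_real t) powr (s - 1) = complex_of_real X powr (s - 1) * of_real t powr (s - 1)"
        using True X by (intro powr_times_real) auto
      moreover have "exp (- (complex_of_real X * of_real t)) = of_real (exp (- X * t))"
        by (simp flip: exp_of_real)
      ultimately show ?thesis
        using True iff by (simp only: ray_def exp_tail_def indicator_simps atLeast_iff scaleR_one mult.assoc)
    next
      case False
      then show ?thesis using iff by simp
    qed
  qed
  finally have "upper_Gamma s (of_real X) = of_real X * of_real X powr (s - 1) * (LINT t:{1..}|lborel. exp_tail s X t)"
    using X by (simp add: set_lebesgue_integral_def scaleR_conv_of_real)
  also have "of_real X * of_real X powr (s - 1) = complex_of_real X powr s"
    using X by (simp add: powr_diff)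
  finally show ?thesis
    using X by (simp add: gamma_ratio_def)
qed

lemma crandall_cvec:
  assumes "u \<noteq> 0"
  shows "crandall \<nu> (cvec u) = (LINT t:{1..}|lborel. exp_tail (\<nu> / 2) (pi * (norm u)\<^sup>2) t)"
proof -
  have "pi * (norm u)\<^sup>2 > 0" using assms by simp
  then show ?thesis
    unfolding crandall_eq_gamma_ratio[OF cvec_crandall_dom[OF assms]] sq_sum_cvec
    using gamma_ratio_real[of "pi * (norm u)\<^sup>2" "\<nu> / 2"] by simp
qed

lemma norm_crandall_le:
  assumes "u \<noteq> 0" "Re \<nu> \<le> K" "K > 0"
  shows "norm (crandall \<nu> (cvec u)) \<le> Gamma (K / 2) * pi powr (- K / 2) * norm u powr (- K)"
proof -
  have p: "norm u > 0" using assms by simp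
  have "norm (crandall \<nu> (cvec u)) \<le> Gamma (K / 2) * (pi * (norm u)\<^sup>2) powr (- (K / 2))"
    unfolding crandall_cvec[OF assms(1)] by (rule norm_integral_exp_tail_le) (use assms in auto)
  also have "(pi * (norm u)\<^sup>2) powr (- (K / 2)) = pi powr (- K / 2) * norm u powr (- K)"
    using p by (simp add: powr_mult powr_powr flip: powr_numeral)
  finally show ?thesis by (simp add: mult.assoc)
qed

lemma holomorphic_integral_exp_tail:
  assumes X: "X > 0"
  shows "(\<lambda>s. LINT t:{1..}|lborel. exp_tail s X t) holomorphic_on UNIV"
  unfolding holomorphic_on_open[OF open_UNIV]
proof
  fix s :: complex
  \<comment> \<open>Positive, and at least Re w for all w in the unit ball around s, so that one
    integrable majorant covers the ball.\<close>
  define K where "K = max 1 (Re s + 1)"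
  define f' where "f' w t = complex_of_real (ln t) * exp_tail w X t" for w and t :: real
  have Re: "Re w \<le> K" if "w \<in> ball s 1" for w
    using that complex_Re_le_cmod[of "w - s"] by (simp add: K_def dist_norm norm_minus_commute max_def)
  have ex: "exp_tail w X t = exp ((w - 1) * of_real (ln t)) * of_real (exp (- X * t))" if "t \<ge> 1" for w t
    using that by (simp add: exp_tail_def powr_def Ln_of_real)
  have 1: "((\<lambda>w. exp_tail w X t) has_field_derivative f' w t) (at w)" if "t \<ge> 1" for w t
    unfolding f'_def ex[OF that] by (rule derivative_eq_intros refl | simp)+
  have 2: "continuous_on (ball s 1 \<times> {1..}) (\<lambda>(w, t). f' w t)"
  proof -
    have "continuous_on (ball s 1 \<times> {1..}) (\<lambda>(w, t). complex_of_real (ln t) * (exp ((w - 1) * of_real (ln t)) * of_real (exp (- X * t))))"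
      unfolding case_prod_unfold by (intro continuous_intros) auto
    also have "?this \<longleftrightarrow> ?thesis"
      by (intro continuous_on_cong refl) (auto simp: f'_def ex)
    finally show ?thesis .
  qed
  have h: "set_integrable lborel {1..} (\<lambda>t. t powr (K - 1) * exp (- X * t))"
    by (rule set_integrable_subset[OF set_integrable_Gamma[OF _ X]]) (auto simp: K_def)
  obtain D where "((\<lambda>w. LINT t:{1..}|lborel. exp_tail w X t) has_field_derivative D) (at s)"
    by (rule parameter_integral_derivative[of 1 s 1 "\<lambda>w. exp_tail w X" f', OF _ 1 _ 2 h norm_exp_tail_le[OF _ Re]])
       (auto intro!: continuous_on_exp_tail)
  then show "\<exists>f'. ((\<lambda>s. LINT t:{1..}|lborel. exp_tail s X t) has_field_derivative f') (at s)" by blast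
qed

lemma holomorphic_crandall:
  assumes "u \<noteq> 0"
  shows "(\<lambda>\<nu>. crandall \<nu> (cvec u)) holomorphic_on UNIV"
proof -
  have "(\<lambda>\<nu>. (\<lambda>s. LINT t:{1..}|lborel. exp_tail s (pi * (norm u)\<^sup>2) t) (\<nu> / 2)) holomorphic_on UNIV"
    by (rule holomorphic_on_compose_gen[OF _ holomorphic_integral_exp_tail, unfolded o_def])
       (use assms in \<open>auto intro!: holomorphic_intros\<close>)
  then show ?thesis unfolding crandall_cvec[OF assms] .
qed

section \<open>The integral kernel of the derivatives\<close>

text \<open>Expanding the product over the coordinates gives one term for each \<beta>, whose powers
  of s add up to |\<alpha>| - |\<beta>|. Here the polynomials of the theta transformation are
  recognised as those in the derivatives of the Crandall function.\<close>

lemma hermite_vec_eq_sum: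
  "hermite_vec \<alpha> s u = (\<Sum>\<beta> | \<forall>j. 2 * \<beta> $ j \<le> \<alpha> $ j. p_poly \<alpha> \<beta> (cvec u) * s ^ (mi_abs \<alpha> - mi_abs \<beta>))"
proof -
  have bij: "bij_betw (\<lambda>g. \<chi> j. g j) (PiE UNIV (\<lambda>j. {k. 2 * k \<le> \<alpha> $ j})) {\<beta> :: nat ^ 'a. \<forall>j. 2 * \<beta> $ j \<le> \<alpha> $ j}"
    by (rule bij_betwI[where g = "\<lambda>\<beta> j. \<beta> $ j"]) (auto simp: PiE_def extensional_def Pi_def)
  have "hermite_vec \<alpha> s u = (\<Sum>g\<in>PiE UNIV (\<lambda>j. {k. 2 * k \<le> \<alpha> $ j}).
      \<Prod>j\<in>UNIV. p_coeff (\<alpha> $ j) (g j) * of_real (u $ j) ^ (\<alpha> $ j - 2 * g j) * s ^ (\<alpha> $ j - g j))"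
    unfolding hermite_vec_def hermite_gauss_def by (rule prod_sum_PiE) auto
  also have "\<dots> = (\<Sum>\<beta> | \<forall>j. 2 * \<beta> $ j \<le> \<alpha> $ j. \<Prod>j\<in>UNIV. p_coeff (\<alpha> $ j) (\<beta> $ j) * of_real (u $ j) ^ (\<alpha> $ j - 2 * \<beta> $ j) * s ^ (\<alpha> $ j - \<beta> $ j))"
    by (subst sum.reindex_bij_betw[OF bij, symmetric]) simp
  also have "\<dots> = (\<Sum>\<beta> | \<forall>j. 2 * \<beta> $ j \<le> \<alpha> $ j. p_poly \<alpha> \<beta> (cvec u) * s ^ (mi_abs \<alpha> - mi_abs \<beta>))"
  proof (rule sum.cong)
    fix \<beta> assume "\<beta> \<in> {\<beta> :: nat ^ 'a. \<forall>j. 2 * \<beta> $ j \<le> \<alpha> $ j}"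
    then have b: "2 * \<beta> $ j \<le> \<alpha> $ j" for j by simp
    have "\<beta> $ j \<le> \<alpha> $ j" for j using b[of j] by linarith
    then have "mi_abs \<alpha> - mi_abs \<beta> = (\<Sum>j\<in>UNIV. \<alpha> $ j - \<beta> $ j)"
      unfolding mi_abs_def by (intro sum_subtractf_nat[symmetric]) simp
    then show "(\<Prod>j\<in>UNIV. p_coeff (\<alpha> $ j) (\<beta> $ j) * of_real (u $ j) ^ (\<alpha> $ j - 2 * \<beta> $ j) * s ^ (\<alpha> $ j - \<beta> $ j)) = p_poly \<alpha> \<beta> (cvec u) * s ^ (mi_abs \<alpha> - mi_abs \<beta>)"
      unfolding p_poly_eq_prod[OF b] by (simp add: cvec_def prod.distrib power_sum)
  qed simp
  finally show ?thesis .
qed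

text \<open>Homogeneity of each term, by 2 (n - k) = n + (n - 2k). It allows t or \<open>lam\<close>
  to be moved between the parameter and the argument.\<close>

lemma hermite_gauss_scale:
  "hermite_gauss n (c\<^sup>2 * s) x = c ^ n * hermite_gauss n s (c * x)"
  unfolding hermite_gauss_def sum_distrib_left
proof (rule sum.cong)
  fix k assume "k \<in> {k. 2 * k \<le> n}"
  then have "2 * (n - k) = n + (n - 2 * k)" by auto
  then have "(c\<^sup>2) ^ (n - k) = c ^ n * c ^ (n - 2 * k)"
    by (simp flip: power_mult power_add)
  then show "p_coeff n k * x ^ (n - 2 * k) * (c\<^sup>2 * s) ^ (n - k) = c ^ n * (p_coeff n k * (c * x) ^ (n - 2 * k) * s ^ (n - k))"
    by (simp add: power_mult_distrib mult_ac)
qed simp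

lemma hermite_vec_scale:
  "hermite_vec \<alpha> ((of_real c)\<^sup>2 * s) u = of_real c ^ mi_abs \<alpha> * hermite_vec \<alpha> s (c *\<^sub>R u)"
  unfolding hermite_vec_def hermite_gauss_scale
  by (simp add: prod.distrib mi_abs_def power_sum)

text \<open>The integrand whose integral over t >= 1 is the derivative of the Crandall function.
  Unlike that derivative it also makes sense at u = 0, where it carries the limit.\<close>

definition crandall_kernel :: "nat ^ 'n \<Rightarrow> complex \<Rightarrow> real ^ 'n \<Rightarrow> real \<Rightarrow> complex" where
  "crandall_kernel \<alpha> \<nu> u t =
     of_real t powr (\<nu> / 2 - 1) * (hermite_vec \<alpha> (of_real t) u * of_real (exp (- pi * (norm u)\<^sup>2 * t)))"

text \<open>The order \<nu> + 2 |\<alpha>| - 2 |\<beta>| of each summand amounts to an extra power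
  t^(|\<alpha>| - |\<beta>|) in its tail integral; summed over \<beta>, these powers and the
  \<open>p_poly\<close> form the Hermite polynomial with parameter t.\<close>

lemma nabla_crandall_eq_integral:
  assumes u: "u \<noteq> 0"
  shows "nabla \<alpha> (crandall \<nu>) (cvec u) = (LINT t:{1..}|lborel. crandall_kernel \<alpha> \<nu> u t)"
proof -
  let ?B = "{\<beta> :: nat ^ 'a. \<forall>j. 2 * \<beta> $ j \<le> \<alpha> $ j}"
  let ?X = "pi * (norm u)\<^sup>2"
  let ?s = "\<lambda>\<beta>. (\<nu> + 2 * of_nat (mi_abs \<alpha>) - 2 * of_nat (mi_abs \<beta>)) / 2"
  have X: "?X > 0" using u by simp
  have int: "set_integrable lborel {1..} (exp_tail s ?X)" for s
    by (rule set_integrable_exp_tail[OF X, of s "max 1 (Re s)"]) auto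
  have "nabla \<alpha> (crandall \<nu>) (cvec u) = (\<Sum>\<beta>\<in>?B. p_poly \<alpha> \<beta> (cvec u) * (LINT t:{1..}|lborel. exp_tail (?s \<beta>) ?X t))"
    unfolding nabla_crandall[OF cvec_crandall_dom[OF u]] crandall_sum_def crandall_cvec[OF u] ..
  also have "\<dots> = (\<Sum>\<beta>\<in>?B. LINT t|lborel. indicator {1..} t *\<^sub>R (p_poly \<alpha> \<beta> (cvec u) * exp_tail (?s \<beta>) ?X t))"
    unfolding set_lebesgue_integral_def by (intro sum.cong refl) (simp flip: mult_scaleR_right)
  also have "\<dots> = (LINT t|lborel. (\<Sum>\<beta>\<in>?B. indicator {1..} t *\<^sub>R (p_poly \<alpha> \<beta> (cvec u) * exp_tail (?s \<beta>) ?X t)))"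
  proof (rule Bochner_Integration.integral_sum[symmetric])
    fix \<beta>
    have "integrable lborel (\<lambda>t. p_poly \<alpha> \<beta> (cvec u) * (indicator {1..} t *\<^sub>R exp_tail (?s \<beta>) ?X t))"
      using int by (intro integrable_mult_right) (simp add: set_integrable_def)
    then show "integrable lborel (\<lambda>t. indicator {1..} t *\<^sub>R (p_poly \<alpha> \<beta> (cvec u) * exp_tail (?s \<beta>) ?X t))"
      by simp
  qed
  also have "\<dots> = (LINT t:{1..}|lborel. crandall_kernel \<alpha> \<nu> u t)"
    unfolding set_lebesgue_integral_def scaleR_sum_right[symmetric]
  proof (rule Bochner_Integration.integral_cong[OF refl])
    fix t :: real
    show "indicator {1..} t *\<^sub>R (\<Sum>\<beta>\<in>?B. p_poly \<alpha> \<beta> (cvec u) * exp_tail (?s \<beta>) ?X t) = indicator {1..} t *\<^sub>R crandall_kernel \<alpha> \<nu> u t"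
    proof (cases "t \<ge> 1")
      case True
      have "p_poly \<alpha> \<beta> (cvec u) * exp_tail (?s \<beta>) ?X t =
         of_real t powr (\<nu> / 2 - 1) * (p_poly \<alpha> \<beta> (cvec u) * of_real t ^ (mi_abs \<alpha> - mi_abs \<beta>) * of_real (exp (- pi * (norm u)\<^sup>2 * t)))"
        if "\<beta> \<in> ?B" for \<beta>
      proof -
        have "\<beta> $ j \<le> \<alpha> $ j" for j using that by (metis (mono_tags) le_add2 le_trans mem_Collect_eq mult_2)
        then have "mi_abs \<beta> \<le> mi_abs \<alpha>" unfolding mi_abs_def by (intro sum_mono) simp
        then have "?s \<beta> - 1 = (\<nu> / 2 - 1) + of_nat (mi_abs \<alpha> - mi_abs \<beta>)"
          by (simp add: of_nat_diff field_simps)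
        then have "complex_of_real t powr (?s \<beta> - 1) = of_real t powr (\<nu> / 2 - 1) * of_real t ^ (mi_abs \<alpha> - mi_abs \<beta>)"
          using True by (simp only: powr_add) (simp add: powr_nat')
        then show ?thesis by (simp add: exp_tail_def mult_ac)
      qed
      then have "(\<Sum>\<beta>\<in>?B. p_poly \<alpha> \<beta> (cvec u) * exp_tail (?s \<beta>) ?X t) =
         (\<Sum>\<beta>\<in>?B. of_real t powr (\<nu> / 2 - 1) * (p_poly \<alpha> \<beta> (cvec u) * of_real t ^ (mi_abs \<alpha> - mi_abs \<beta>) * of_real (exp (- pi * (norm u)\<^sup>2 * t))))"
        by (rule sum.cong[OF refl])
      then show ?thesis
        unfolding crandall_kernel_def hermite_vec_eq_sum sum_distrib_left sum_distrib_right by simp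
    qed simp
  qed
  finally show ?thesis .
qed


section \<open>The limit at the origin\<close>

lemma hermite_gauss_at_0:
  "hermite_gauss n s 0 = (if even n then p_coeff n (n div 2) * s ^ (n div 2) else 0)"
proof -
  have "hermite_gauss n s 0 = (\<Sum>k | 2 * k \<le> n. if n = 2 * k then p_coeff n (n div 2) * s ^ (n div 2) else 0)"
    unfolding hermite_gauss_def
  proof (rule sum.cong)
    fix k assume "k \<in> {k. 2 * k \<le> n}"
    then have "2 * k \<le> n" by simp
    show "p_coeff n k * 0 ^ (n - 2 * k) * s ^ (n - k) = (if n = 2 * k then p_coeff n (n div 2) * s ^ (n div 2) else 0)"
    proof (cases "n = 2 * k")
      case True
      then show ?thesis by simp
    next
      case False
      then have "n - 2 * k > 0" using \<open>2 * k \<le> n\<close> by simp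
      then show ?thesis using False by (simp add: zero_power)
    qed
  qed simp
  also have "\<dots> = (if even n then p_coeff n (n div 2) * s ^ (n div 2) else 0)"
  proof (cases "even n")
    case True
    then obtain m where m: "n = 2 * m" by blast
    have "(\<Sum>k | 2 * k \<le> n. if n = 2 * k then p_coeff n (n div 2) * s ^ (n div 2) else 0)
      = (\<Sum>k | 2 * k \<le> n. if k = m then p_coeff n (n div 2) * s ^ (n div 2) else 0)"
      by (rule sum.cong) (auto simp: m)
    then show ?thesis using m by simp
  next
    case False
    then show ?thesis by (auto intro!: sum.neutral)
  qed
  finally show ?thesis .
qed

text \<open>An odd coordinate contributes the factor 0. If all are even, each factor keeps only the
  term 2k = \<alpha>_j, that is \<beta> = \<alpha> / 2, where the power of the variable is 0^0 =
  1.\<close>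

lemma hermite_vec_at_0:
  "hermite_vec \<alpha> s 0 = of_nat (chi \<alpha>) * p_poly \<alpha> (mi_half \<alpha>) 0 * s ^ (mi_abs \<alpha> div 2)"
proof (cases "\<forall>j. even (\<alpha> $ j)")
  case True
  then have h: "2 * mi_half \<alpha> $ j = \<alpha> $ j" for j by (simp add: mi_half_def)
  then have "mi_abs \<alpha> = 2 * mi_abs (mi_half \<alpha>)"
    by (simp add: mi_abs_def sum_distrib_left)
  moreover have "p_poly \<alpha> (mi_half \<alpha>) 0 = (\<Prod>j\<in>UNIV. p_coeff (\<alpha> $ j) (\<alpha> $ j div 2))"
    using p_poly_eq_prod[of "mi_half \<alpha>" \<alpha> 0] True h by (simp add: mi_half_def)
  ultimately show ?thesis
    using True by (simp add: hermite_vec_def hermite_gauss_at_0 chi_def prod.distrib mi_abs_def mi_half_def power_sum)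
next
  case False
  then obtain j where "odd (\<alpha> $ j)" by blast
  then have "hermite_vec \<alpha> s 0 = 0"
    unfolding hermite_vec_def by (intro prod_zero) (auto simp: hermite_gauss_at_0 intro!: bexI[of _ j])
  moreover have "chi \<alpha> = 0" using False by (simp only: chi_def if_False)
  ultimately show ?thesis by simp
qed

lemma set_integrable_powr_atLeast_1:
  fixes e :: real
  assumes "e < -1"
  shows "set_integrable lborel {1..} (\<lambda>t :: real. t powr e)"
proof (rule set_integrable_lborel_nonneg)
  show "(\<lambda>t :: real. t powr e) integrable_on {1..}"
    using has_integral_powr_to_inf[OF assms, of 1] by (auto simp: integrable_on_def)
  show "set_borel_measurable borel {1..} (\<lambda>t :: real. t powr e)"
    by (intro set_borel_measurable_continuous continuous_intros) auto
qed simp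

lemma set_integral_complex_powr:
  assumes "Re a < 0"
  shows "(LINT t:{1..}|lborel. of_real t powr (a - 1)) = - 1 / a"
proof -
  have a0: "a \<noteq> 0" using assms by auto
  have "(LINT t:{1..}|lborel. of_real t powr (a - 1)) = 0 - of_real 1 powr a / a"
  proof (rule set_integral_FTC_atLeast)
    show "set_integrable lborel {1..} (\<lambda>t. complex_of_real t powr (a - 1))"
      by (rule set_integrable_complex_bound[OF set_integrable_powr_atLeast_1[of "Re a - 1"] _ continuous_on_of_real_powr])
         (use assms in \<open>auto simp: norm_of_real_powr\<close>)
    show "((\<lambda>t. of_real t powr a / a) has_vector_derivative complex_of_real t powr (a - 1)) (at t within {1..})" if "1 \<le> t" for t
    proof -
      have "((\<lambda>z. z powr a / a) has_field_derivative complex_of_real t powr (a - 1)) (at (of_real t))"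
        using a0 that by (auto intro!: derivative_eq_intros simp: complex_nonpos_Reals_iff)
      then show ?thesis by (rule has_vector_derivative_real_field)
    qed
    have "((\<lambda>t. t powr Re a / norm a) \<longlongrightarrow> 0 / norm a) at_top"
      by (intro tendsto_intros tendsto_neg_powr assms filterlim_ident) (use a0 in auto)
    then show "((\<lambda>t. of_real t powr a / a) \<longlongrightarrow> 0) at_top"
    proof (rule Lim_null_comparison[rotated, OF tendsto_eq_rhs])
      show "\<forall>\<^sub>F t in at_top. norm (complex_of_real t powr a / a) \<le> t powr Re a / norm a"
        by (rule eventually_mono[OF eventually_gt_at_top[of 0]]) (simp add: norm_divide norm_of_real_powr)
    qed simp
  qed
  then show ?thesis by simp
qed

text \<open>Scaling u by sqrt t extracts t^(|\<alpha>| / 2) and leaves a Hermite polynomial times a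
  Gaussian, which is bounded. The bound is uniform in u, the origin included, as dominated
  convergence at u = 0 requires.\<close>

lemma norm_crandall_kernel_le:
  obtains C where "C > 0"
    "\<And>t (u :: real ^ 'n). t > 0 \<Longrightarrow> norm (crandall_kernel \<alpha> \<nu> u t) \<le> C * t powr ((Re \<nu> + real (mi_abs \<alpha>)) / 2 - 1)"
proof -
  obtain C where C: "C > 0"
    "\<And>p :: real ^ 'n. norm (hermite_vec \<alpha> 1 p * of_real (exp (- pi * (norm p)\<^sup>2 / 1))) \<le> C * (1 + norm p) powr (- real 0)"
    using norm_hermite_exp_le[of 1 \<alpha> 1 0] by auto
  have "norm (crandall_kernel \<alpha> \<nu> u t) \<le> C * t powr ((Re \<nu> + real (mi_abs \<alpha>)) / 2 - 1)" if t: "t > 0" for t and u :: "real ^ 'n"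
  proof -
    define c where "c = sqrt t"
    have c: "c > 0" "c\<^sup>2 = t" using t by (auto simp: c_def)
    have n1: "1 + norm (c *\<^sub>R u) \<noteq> 0" by (smt (verit) norm_ge_zero)
    have "hermite_vec \<alpha> (of_real t) u = of_real c ^ mi_abs \<alpha> * hermite_vec \<alpha> 1 (c *\<^sub>R u)"
      using hermite_vec_scale[of \<alpha> c 1 u] c(2) by (simp flip: of_real_power)
    moreover have "exp (- pi * (norm u)\<^sup>2 * t) = exp (- pi * (norm (c *\<^sub>R u))\<^sup>2 / 1)"
      using c by (simp add: power_mult_distrib)
    ultimately have "norm (hermite_vec \<alpha> (of_real t) u * of_real (exp (- pi * (norm u)\<^sup>2 * t))) =
       c ^ mi_abs \<alpha> * norm (hermite_vec \<alpha> 1 (c *\<^sub>R u) * of_real (exp (- pi * (norm (c *\<^sub>R u))\<^sup>2 / 1)))"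
      using c(1) by (simp only: norm_mult norm_power norm_of_real abs_of_pos mult.assoc)
    also have "\<dots> \<le> c ^ mi_abs \<alpha> * C"
      using C(2)[of "c *\<^sub>R u"] c(1) n1 by (intro mult_left_mono) auto
    also have "c ^ mi_abs \<alpha> = t powr (real (mi_abs \<alpha>) / 2)"
      using t by (simp add: c_def powr_half_sqrt[symmetric] powr_power)
    finally have "norm (crandall_kernel \<alpha> \<nu> u t) \<le> t powr (Re \<nu> / 2 - 1) * (t powr (real (mi_abs \<alpha>) / 2) * C)"
      unfolding crandall_kernel_def norm_mult[of "_ powr _"] using t
      by (simp add: norm_of_real_powr mult_left_mono)
    also have "\<dots> = C * t powr ((Re \<nu> + real (mi_abs \<alpha>)) / 2 - 1)"
      by (simp add: add_divide_distrib algebra_simps flip: powr_add)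
    finally show ?thesis .
  qed
  then show ?thesis by (rule that[OF C(1)])
qed

lemma continuous_on_crandall_kernel: "S \<subseteq> {0<..} \<Longrightarrow> continuous_on S (crandall_kernel \<alpha> \<nu> u)"
  unfolding crandall_kernel_def hermite_vec_def hermite_gauss_def
  by (intro continuous_intros continuous_on_of_real_powr)

lemma crandall_kernel_0:
  assumes "t > 0"
  shows "crandall_kernel \<alpha> \<nu> 0 t = of_nat (chi \<alpha>) * p_poly \<alpha> (mi_half \<alpha>) 0 * of_real t powr ((\<nu> + of_nat (mi_abs \<alpha>)) / 2 - 1)"
proof (cases "chi \<alpha> = 0")
  case True
  then show ?thesis by (simp add: crandall_kernel_def hermite_vec_at_0)
next
  case False
  then have "\<forall>j. even (\<alpha> $ j)" by (auto simp: chi_def split: if_splits)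
  then have "even (mi_abs \<alpha>)" unfolding mi_abs_def by (intro dvd_sum) auto
  then obtain m where m: "mi_abs \<alpha> = 2 * m" by blast
  have "complex_of_real t powr ((\<nu> + of_nat (mi_abs \<alpha>)) / 2 - 1) = of_real t powr ((\<nu> / 2 - 1) + of_nat m)"
    unfolding m by (simp add: field_simps)
  also have "\<dots> = of_real t powr (\<nu> / 2 - 1) * of_real t ^ m"
    using assms by (simp only: powr_add) (simp add: powr_nat')
  finally show ?thesis
    using m by (simp add: crandall_kernel_def hermite_vec_at_0 mult_ac)
qed

text \<open>Dominated convergence along sequences tending to 0: the majorant of
  \<open>norm_crandall_kernel_le\<close> is integrable over t >= 1 because Re \<nu> + |\<alpha>| <
  0. At u = 0 the kernel is a multiple of t^(a - 1) with a = (\<nu> + |\<alpha>|) / 2, whose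
  integral -1 / a accounts for the factor -2.\<close>

lemma
  assumes "Re \<nu> + real (mi_abs \<alpha>) < 0"
  shows integral_crandall_kernel_0: "(LINT t:{1..}|lborel. crandall_kernel \<alpha> \<nu> 0 t) =
      - 2 * of_nat (chi \<alpha>) * p_poly \<alpha> (mi_half \<alpha>) 0 / (\<nu> + of_nat (mi_abs \<alpha>))"
    and tendsto_nabla_crandall_0: "((\<lambda>u :: real ^ 'n. nabla \<alpha> (crandall \<nu>) (cvec u)) \<longlongrightarrow>
      - 2 * of_nat (chi \<alpha>) * p_poly \<alpha> (mi_half \<alpha>) 0 / (\<nu> + of_nat (mi_abs \<alpha>))) (at 0)"
proof -
  let ?a = "(\<nu> + of_nat (mi_abs \<alpha>)) / 2"
  have a: "Re ?a < 0" using assms by simp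
  have "(LINT t:{1..}|lborel. crandall_kernel \<alpha> \<nu> 0 t) =
     (LINT t:{1..}|lborel. of_nat (chi \<alpha>) * p_poly \<alpha> (mi_half \<alpha>) 0 * of_real t powr (?a - 1))"
    by (rule set_lebesgue_integral_cong) (auto simp: crandall_kernel_0)
  also have "\<dots> = of_nat (chi \<alpha>) * p_poly \<alpha> (mi_half \<alpha>) 0 * (- 1 / ?a)"
    by (simp add: set_integral_complex_powr[OF a])
  also have "\<dots> = - 2 * of_nat (chi \<alpha>) * p_poly \<alpha> (mi_half \<alpha>) 0 / (\<nu> + of_nat (mi_abs \<alpha>))"
    by simp
  finally show I0: "(LINT t:{1..}|lborel. crandall_kernel \<alpha> \<nu> 0 t) =
      - 2 * of_nat (chi \<alpha>) * p_poly \<alpha> (mi_half \<alpha>) 0 / (\<nu> + of_nat (mi_abs \<alpha>))" .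
  obtain C where C: "C > 0"
    "\<And>t (u :: real ^ 'n). t > 0 \<Longrightarrow> norm (crandall_kernel \<alpha> \<nu> u t) \<le> C * t powr ((Re \<nu> + real (mi_abs \<alpha>)) / 2 - 1)"
    using norm_crandall_kernel_le[of \<alpha> \<nu>] by blast
  have dom: "set_integrable lborel {1..} (\<lambda>t. C * t powr ((Re \<nu> + real (mi_abs \<alpha>)) / 2 - 1))"
    using assms by (intro set_integrable_mult_right impI set_integrable_powr_atLeast_1) auto
  have lim: "(\<lambda>n. nabla \<alpha> (crandall \<nu>) (cvec (X n))) \<longlonglongrightarrow> (LINT t:{1..}|lborel. crandall_kernel \<alpha> \<nu> 0 t)"
    if X: "\<And>n. X n \<noteq> 0" "X \<longlonglongrightarrow> 0" for X :: "nat \<Rightarrow> real ^ 'n"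
    unfolding nabla_crandall_eq_integral[OF X(1)] set_lebesgue_integral_def
  proof (rule integral_dominated_convergence)
    show "integrable lborel (\<lambda>t. indicator {1..} t *\<^sub>R (C * t powr ((Re \<nu> + real (mi_abs \<alpha>)) / 2 - 1)))"
      using dom by (simp add: set_integrable_def)
    have meas: "(\<lambda>t. indicator {1..} t *\<^sub>R crandall_kernel \<alpha> \<nu> u t) \<in> borel_measurable lborel" for u
    proof -
      have "{1..} \<subseteq> {0 :: real<..}" by auto
      then show ?thesis
        using set_borel_measurable_continuous[OF _ continuous_on_crandall_kernel, of "{1..}" \<alpha> \<nu> u]
        by (simp add: set_borel_measurable_def)
    qed
    show "(\<lambda>t. indicator {1..} t *\<^sub>R crandall_kernel \<alpha> \<nu> 0 t) \<in> borel_measurable lborel"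
      and "(\<lambda>t. indicator {1..} t *\<^sub>R crandall_kernel \<alpha> \<nu> (X n) t) \<in> borel_measurable lborel" for n
      by (rule meas)+
    show "AE t in lborel. norm (indicator {1..} t *\<^sub>R crandall_kernel \<alpha> \<nu> (X n) t) \<le> indicator {1..} t *\<^sub>R (C * t powr ((Re \<nu> + real (mi_abs \<alpha>)) / 2 - 1))" for n
      using C(2) by (intro AE_I2) (auto simp: indicator_def)
    show "AE t in lborel. (\<lambda>n. indicator {1..} t *\<^sub>R crandall_kernel \<alpha> \<nu> (X n) t) \<longlonglongrightarrow> indicator {1..} t *\<^sub>R crandall_kernel \<alpha> \<nu> 0 t"
    proof (intro AE_I2)
      fix t :: real
      have "continuous_on UNIV (\<lambda>u. crandall_kernel \<alpha> \<nu> u t)"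
        unfolding crandall_kernel_def hermite_vec_def hermite_gauss_def by (intro continuous_intros)
      then have "(\<lambda>n. crandall_kernel \<alpha> \<nu> (X n) t) \<longlonglongrightarrow> crandall_kernel \<alpha> \<nu> 0 t"
        by (rule continuous_on_tendsto_compose) (use X in auto)
      then show "(\<lambda>n. indicator {1..} t *\<^sub>R crandall_kernel \<alpha> \<nu> (X n) t) \<longlonglongrightarrow> indicator {1..} t *\<^sub>R crandall_kernel \<alpha> \<nu> 0 t"
        by (intro tendsto_intros)
    qed
  qed
  show "((\<lambda>u :: real ^ 'n. nabla \<alpha> (crandall \<nu>) (cvec u)) \<longlongrightarrow>
      - 2 * of_nat (chi \<alpha>) * p_poly \<alpha> (mi_half \<alpha>) 0 / (\<nu> + of_nat (mi_abs \<alpha>))) (at 0)"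
    unfolding tendsto_at_iff_sequentially I0[symmetric] o_def using lim by blast
qed

section \<open>Meromorphic continuation\<close>

text \<open>After removing singularities the difference vanishes near one point and hence
  everywhere, so F and G agree on a punctured neighbourhood of every point. The value at the point
  itself is then fixed by the convention: 0 at a pole, the limit otherwise.\<close>

lemma nicely_meromorphic_unique:
  assumes F: "F nicely_meromorphic_on UNIV" and G: "G nicely_meromorphic_on UNIV"
    and S: "open S" "z0 \<in> S" "\<And>s. s \<in> S \<Longrightarrow> F s = G s"
  shows "F = G"
proof
  fix z
  have "F meromorphic_on UNIV" "G meromorphic_on UNIV"
    using F G by (auto simp: nicely_meromorphic_on_def)
  then have D: "(\<lambda>s. F s - G s) meromorphic_on UNIV"
    by (intro meromorphic_intros)
  have iso: "isolated_singularity_at (\<lambda>s. F s - G s) w" for w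
    by (rule meromorphic_on_isolated_singularity, rule meromorphic_on_subset[OF D]) simp
  let ?R = "remove_sings (\<lambda>s. F s - G s)"
  have "eventually (\<lambda>s. s \<in> S) (at z0)"
    using S by (intro eventually_at_in_open') auto
  then have "eventually (\<lambda>s. ?R s = 0) (at z0)"
    using eventually_remove_sings_eq_at[OF iso[of z0]] by eventually_elim (simp add: S(3))
  then have "frequently (\<lambda>s. ?R s = 0) (at z0)"
    by (intro eventually_frequently) auto
  then have R0: "?R w = 0" for w
    by (rule frequently_eq_meromorphic_imp_constant[OF _ remove_sings_nicely_meromorphic[OF D]]) auto
  have ev: "eventually (\<lambda>s. F s = G s) (at z)"
    using eventually_remove_sings_eq_at[OF iso[of z]] by eventually_elim (simp add: R0)
  have "is_pole F z \<longleftrightarrow> is_pole G z"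
    by (rule is_pole_cong[OF ev refl])
  moreover have lim: "(is_pole F z \<and> F z = 0) \<or> F \<midarrow>z\<rightarrow> F z" "(is_pole G z \<and> G z = 0) \<or> G \<midarrow>z\<rightarrow> G z"
    using F G by (auto simp: nicely_meromorphic_on_def)
  moreover have "\<not> is_pole f z" if "f \<midarrow>z\<rightarrow> c" for f :: "complex \<Rightarrow> complex" and c
    using that not_tendsto_and_filterlim_at_infinity[OF at_neq_bot that] by (auto simp: is_pole_def)
  ultimately consider "F z = 0 \<and> G z = 0" | "\<not> is_pole F z" "\<not> is_pole G z"
    by blast
  then show "F z = G z"
  proof cases
    case 2
    then have "F \<midarrow>z\<rightarrow> F z" "G \<midarrow>z\<rightarrow> G z" using lim by auto
    moreover have "F \<midarrow>z\<rightarrow> F z \<longleftrightarrow> G \<midarrow>z\<rightarrow> F z"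
      by (rule tendsto_cong[OF ev])
    ultimately show ?thesis
      using LIM_unique by blast
  qed simp
qed

lemma merom_cont_eqI:
  assumes "is_merom_cont f S F" "open S" "z0 \<in> S"
  shows "merom_cont f S = F"
  unfolding merom_cont_def
proof (rule the_equality)
  fix G assume "is_merom_cont f S G"
  then show "G = F"
    using assms by (intro nicely_meromorphic_unique[of G F S z0]) (auto simp: is_merom_cont_def)
qed fact

lemma open_Re_less: "open {\<mu>. Re \<mu> + c < 0}"
  by (intro open_Collect_less continuous_intros)

lemma open_epstein_halfplane: "open (epstein_halfplane \<alpha>)"
  unfolding epstein_halfplane_def by (intro open_Collect_less continuous_intros)

text \<open>The residue at \<nu> = -|\<alpha>| of the continued value at the origin.\<close>

definition crandall_res :: "nat ^ 'n \<Rightarrow> complex" where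
  "crandall_res \<alpha> = - 2 * of_nat (chi \<alpha>) * p_poly \<alpha> (mi_half \<alpha>) 0"

lemma crandall_res_eq_0_iff: "crandall_res \<alpha> = 0 \<longleftrightarrow> chi \<alpha> \<noteq> 1"
proof (cases "\<forall>j. even (\<alpha> $ j)")
  case True
  then have h: "2 * mi_half \<alpha> $ j = \<alpha> $ j" for j by (simp add: mi_half_def)
  have "p_poly \<alpha> (mi_half \<alpha>) 0 = (\<Prod>j\<in>UNIV. p_coeff (\<alpha> $ j) (mi_half \<alpha> $ j))"
    using p_poly_eq_prod[of "mi_half \<alpha>" \<alpha> 0] h by simp
  also have "\<dots> \<noteq> 0"
    using h by (simp add: p_coeff_eq)
  finally have "p_poly \<alpha> (mi_half \<alpha>) 0 \<noteq> 0" .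
  then show ?thesis using True by (simp add: crandall_res_def chi_def)
next
  case False
  then have "chi \<alpha> = 0" by (simp only: chi_def if_False)
  then show ?thesis by (simp add: crandall_res_def)
qed

text \<open>At \<nu> = a the quotient is c / 0 = 0, which happens to be the value prescribed at a
  pole; for c = 0 the function is identically 0. So the formula itself is the normalised
  continuation in both cases.\<close>

lemma simple_fraction:
  fixes c a :: complex
  defines "R \<equiv> \<lambda>\<nu>. c / (\<nu> - a)"
  shows "R holomorphic_on - {a}" and "R meromorphic_on UNIV" and "R nicely_meromorphic_on UNIV"
    and "is_pole R a \<and> zorder R a = - 1 \<longleftrightarrow> c \<noteq> 0"
proof -
  show hol: "R holomorphic_on - {a}"
    unfolding R_def by (intro holomorphic_intros) auto
  show mer: "R meromorphic_on UNIV"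
    unfolding R_def by (intro meromorphic_intros)
  have pole: "is_pole R a" if "c \<noteq> 0"
    unfolding R_def using that
    by (intro is_pole_divide) (auto intro!: continuous_intros filterlim_atI tendsto_eq_intros simp: eventually_at_filter)
  have z: "zorder R a = - 1" if "c \<noteq> 0"
    by (rule zorder_eqI[of UNIV _ "\<lambda>_. c"]) (use that in \<open>auto simp: R_def power_int_minus divide_inverse\<close>)
  have "\<not> is_pole R a" if "c = 0"
    using that by (simp add: R_def)
  then show "is_pole R a \<and> zorder R a = - 1 \<longleftrightarrow> c \<noteq> 0"
    using pole z by blast
  have "(is_pole R w \<and> R w = 0) \<or> R \<midarrow>w\<rightarrow> R w" for w
  proof (cases "w = a")
    case True
    show ?thesis
    proof (cases "c = 0")
      case True
      then show ?thesis by (simp add: R_def)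
    next
      case False
      then show ?thesis using pole True \<open>w = a\<close> by (simp add: R_def)
    qed
  next
    case False
    have "isCont R w"
      using holomorphic_on_imp_continuous_on[OF hol] False by (simp add: continuous_on_eq_continuous_at open_Compl)
    then show ?thesis by (simp add: isCont_def)
  qed
  then show "R nicely_meromorphic_on UNIV"
    using mer by (simp add: nicely_meromorphic_on_def)
qed

lemma crandall_lim0_eq:
  fixes \<alpha> :: "nat ^ 'n"
  assumes "Re \<nu> + real (mi_abs \<alpha>) < 0"
  shows "crandall_lim0 \<alpha> \<nu> = crandall_res \<alpha> / (\<nu> + of_nat (mi_abs \<alpha>))"
  unfolding crandall_lim0_def crandall_res_def
  by (rule tendsto_Lim[OF _ tendsto_nabla_crandall_0[OF assms]]) (simp add: trivial_limit_at)

lemma is_merom_cont_crandall_lim0: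
  "is_merom_cont (crandall_lim0 \<alpha>) {\<nu>. Re \<nu> + real (mi_abs \<alpha>) < 0} (\<lambda>\<nu>. crandall_res \<alpha> / (\<nu> + of_nat (mi_abs \<alpha>)))"
  using simple_fraction(3)[of "crandall_res \<alpha>" "- of_nat (mi_abs \<alpha>)"]
  by (simp add: is_merom_cont_def crandall_lim0_eq)

lemma crandall_deriv_0: "crandall_deriv \<alpha> \<nu> 0 = crandall_res \<alpha> / (\<nu> + of_nat (mi_abs \<alpha>))"
proof -
  have "merom_cont (crandall_lim0 \<alpha>) {\<nu>. Re \<nu> + real (mi_abs \<alpha>) < 0} = (\<lambda>\<nu>. crandall_res \<alpha> / (\<nu> + of_nat (mi_abs \<alpha>)))"
    by (rule merom_cont_eqI[OF is_merom_cont_crandall_lim0 open_Re_less, of "- of_nat (mi_abs \<alpha>) - 1"]) simp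
  then show ?thesis by (simp add: crandall_deriv_def)
qed

lemma cvec_eq_0_iff [simp]: "cvec u = 0 \<longleftrightarrow> u = 0"
  by (simp add: cvec_def vec_eq_iff)

lemma crandall_deriv_cvec:
  assumes "u \<noteq> 0"
  shows "crandall_deriv \<alpha> \<nu> (cvec u) = nabla \<alpha> (crandall \<nu>) (cvec u)"
  using assms by (simp add: crandall_deriv_def)

lemma finite_ivec_ball: "finite {k :: int ^ 'n. norm (ivec k) \<le> M}"
proof -
  have "inj_on (\<lambda>k :: int ^ 'n. ($) k) {k. norm (ivec k) \<le> M}"
    by (auto simp: inj_on_def vec_eq_iff)
  moreover have "(\<lambda>k :: int ^ 'n. ($) k) ` {k. norm (ivec k) \<le> M} \<subseteq> PiE UNIV (\<lambda>_. {- \<lceil>M\<rceil>..\<lceil>M\<rceil>})"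
  proof (rule image_subsetI)
    fix k :: "int ^ 'n" assume "k \<in> {k. norm (ivec k) \<le> M}"
    then have "\<bar>of_int (k $ j)\<bar> \<le> M" for j
      using component_le_norm_cart[of "ivec k" j] by simp
    then have "k $ j \<le> \<lceil>M\<rceil> \<and> - (k $ j) \<le> \<lceil>M\<rceil>" for j
      by (smt (verit) le_of_int_ceiling of_int_le_iff of_int_minus)
    then show "($) k \<in> PiE UNIV (\<lambda>_. {- \<lceil>M\<rceil>..\<lceil>M\<rceil>})"
      by (auto simp: PiE_UNIV_domain minus_le_iff)
  qed
  moreover have "finite (PiE (UNIV :: 'n set) (\<lambda>_. {- \<lceil>M\<rceil>..\<lceil>M\<rceil>}))"
    by (intro finite_PiE) auto
  ultimately show ?thesis
    by (meson finite_imageD finite_subset)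
qed

text \<open>Only finitely many points have norm below 1, and for the others the norm is at least
  half of 1 plus the norm, which reduces the claim to
  \<open>summable_on_affine_ivec\<close>.\<close>

lemma summable_on_lattice_norm:
  fixes B :: "real ^ 'n ^ 'n"
  assumes B: "invertible B" and s: "s > real CARD('n)"
  shows "(\<lambda>z. norm z powr (- s)) summable_on (range (\<lambda>k. B *v ivec k + b) - {0})"
proof -
  let ?z = "\<lambda>k. B *v ivec k + b"
  have s0: "s \<ge> 0" using s by simp
  obtain K where K: "K > 0" "\<And>v. 1 + norm v \<le> K * (1 + norm (B *v v + b))"
    using affine_norm_lower_bound[OF B, of b] by blast
  have fin: "finite {k. norm (?z k) < 1}"
  proof (rule finite_subset[OF _ finite_ivec_ball])
    show "{k. norm (?z k) < 1} \<subseteq> {k. norm (ivec k) \<le> K * 2}"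
    proof
      fix k assume "k \<in> {k. norm (?z k) < 1}"
      then have "K * (1 + norm (?z k)) \<le> K * 2"
        using K(1) by (intro mult_left_mono) auto
      then have "1 + norm (ivec k) \<le> K * 2"
        using K(2)[of "ivec k"] by linarith
      then show "k \<in> {k. norm (ivec k) \<le> K * 2}" by simp
    qed
  qed
  have "(\<lambda>k. norm (?z k) powr (- s)) summable_on ({k. norm (?z k) < 1} \<union> {k. norm (?z k) \<ge> 1})"
  proof (rule summable_on_union)
    show "(\<lambda>k. norm (?z k) powr (- s)) summable_on {k. norm (?z k) < 1}"
      using fin by (rule summable_on_finite)
    have "(\<lambda>k. 2 powr s * (1 + norm (?z k)) powr (- s)) summable_on UNIV"
      by (intro summable_on_cmult_right summable_on_affine_ivec B s)
    then have "(\<lambda>k. 2 powr s * (1 + norm (?z k)) powr (- s)) summable_on {k. norm (?z k) \<ge> 1}"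
      by (rule summable_on_subset_banach) simp
    then show "(\<lambda>k. norm (?z k) powr (- s)) summable_on {k. norm (?z k) \<ge> 1}"
    proof (rule summable_on_comparison_test)
      fix k assume "k \<in> {k. norm (?z k) \<ge> 1}"
      then have n: "norm (?z k) \<ge> 1" by simp
      have "(1 + norm (?z k)) powr s \<le> (2 * norm (?z k)) powr s"
        using n s0 by (intro powr_mono2) auto
      also have "\<dots> = 2 powr s * norm (?z k) powr s" by (rule powr_mult)
      finally have *: "(1 + norm (?z k)) powr s \<le> 2 powr s * norm (?z k) powr s" .
      have "norm (?z k) powr s > 0" "(1 + norm (?z k)) powr s > 0" using n by auto
      with * show "norm (?z k) powr (- s) \<le> 2 powr s * (1 + norm (?z k)) powr (- s)"
        by (simp add: powr_minus field_simps)
    qed simp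
  qed
  also have "{k. norm (?z k) < 1} \<union> {k. norm (?z k) \<ge> 1} = UNIV" by auto
  finally have "(\<lambda>z. norm z powr (- s)) summable_on range ?z"
    by (subst summable_on_reindex[OF inj_matrix_ivec[OF B]]) (simp add: o_def)
  then show ?thesis by (rule summable_on_subset_banach) auto
qed

text \<open>The scaling argument of \<open>norm_crandall_kernel_le\<close>, now keeping N powers of
  the scaled norm. The constant is independent of \<nu>, because \<nu> enters only through a power
  of t.\<close>

lemma norm_crandall_kernel_decay:
  fixes N :: nat
  obtains C where "C > 0"
    "\<And>\<nu> t (u :: real ^ 'n). t > 0 \<Longrightarrow> u \<noteq> 0 \<Longrightarrow> norm (crandall_kernel \<alpha> \<nu> u t) \<le>
       C * norm u powr (- real N) * t powr ((Re \<nu> + real (mi_abs \<alpha>) - real N) / 2 - 1)"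
proof -
  obtain C where C: "C > 0"
    "\<And>p :: real ^ 'n. norm (hermite_vec \<alpha> 1 p * of_real (exp (- pi * (norm p)\<^sup>2 / 1))) \<le> C * (1 + norm p) powr (- real N)"
    using norm_hermite_exp_le[of 1 \<alpha> 1 N] by auto
  have "norm (crandall_kernel \<alpha> \<nu> u t) \<le> C * norm u powr (- real N) * t powr ((Re \<nu> + real (mi_abs \<alpha>) - real N) / 2 - 1)"
    if t: "t > 0" and u: "u \<noteq> 0" for \<nu> t and u :: "real ^ 'n"
  proof -
    define c where "c = sqrt t"
    have c: "c > 0" "c\<^sup>2 = t" using t by (auto simp: c_def)
    have cu: "norm (c *\<^sub>R u) > 0" using c u by simp
    have "hermite_vec \<alpha> (of_real t) u = of_real c ^ mi_abs \<alpha> * hermite_vec \<alpha> 1 (c *\<^sub>R u)"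
      using hermite_vec_scale[of \<alpha> c 1 u] c(2) by (simp flip: of_real_power)
    moreover have "exp (- pi * (norm u)\<^sup>2 * t) = exp (- pi * (norm (c *\<^sub>R u))\<^sup>2 / 1)"
      using c by (simp add: power_mult_distrib)
    ultimately have "norm (hermite_vec \<alpha> (of_real t) u * of_real (exp (- pi * (norm u)\<^sup>2 * t))) =
       c ^ mi_abs \<alpha> * norm (hermite_vec \<alpha> 1 (c *\<^sub>R u) * of_real (exp (- pi * (norm (c *\<^sub>R u))\<^sup>2 / 1)))"
      using c(1) by (simp only: norm_mult norm_power norm_of_real abs_of_pos mult.assoc)
    also have "\<dots> \<le> c ^ mi_abs \<alpha> * (C * norm (c *\<^sub>R u) powr (- real N))"
    proof -
      have "(1 + norm (c *\<^sub>R u)) powr (- real N) \<le> norm (c *\<^sub>R u) powr (- real N)"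
        using cu by (intro powr_mono2') auto
      then show ?thesis
        using C(2)[of "c *\<^sub>R u"] C(1) c(1) by (intro mult_left_mono order_trans[OF C(2)]) auto
    qed
    also have "norm (c *\<^sub>R u) powr (- real N) = c powr (- real N) * norm u powr (- real N)"
      using c(1) by (simp add: powr_mult)
    also have "c ^ mi_abs \<alpha> = t powr (real (mi_abs \<alpha>) / 2)"
      using t by (simp add: c_def powr_half_sqrt[symmetric] powr_power)
    also have "c powr (- real N) = t powr (- real N / 2)"
      using t by (simp add: c_def powr_half_sqrt[symmetric] powr_powr)
    finally have "norm (crandall_kernel \<alpha> \<nu> u t) \<le> t powr (Re \<nu> / 2 - 1) *
        (t powr (real (mi_abs \<alpha>) / 2) * (C * (t powr (- real N / 2) * norm u powr (- real N))))"
      unfolding crandall_kernel_def norm_mult[of "_ powr _"] using t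
      by (simp add: norm_of_real_powr mult_left_mono)
    also have "\<dots> = C * norm u powr (- real N) * (t powr (Re \<nu> / 2 - 1) * t powr (real (mi_abs \<alpha>) / 2) * t powr (- real N / 2))"
      by (simp only: mult_ac)
    also have "t powr (Re \<nu> / 2 - 1) * t powr (real (mi_abs \<alpha>) / 2) * t powr (- real N / 2) = t powr ((Re \<nu> + real (mi_abs \<alpha>) - real N) / 2 - 1)"
    proof -
      have "Re \<nu> / 2 - 1 + real (mi_abs \<alpha>) / 2 + - real N / 2 = (Re \<nu> + real (mi_abs \<alpha>) - real N) / 2 - 1"
        by (simp add: field_simps)
      then show ?thesis by (simp only: powr_add[symmetric])
    qed
    finally show ?thesis .
  qed
  then show ?thesis by (rule that[OF C(1)])
qed

lemma
  assumes "set_integrable lborel S h" "S \<in> sets borel" "continuous_on S f" "\<And>t. t \<in> S \<Longrightarrow> norm (f t :: complex) \<le> h t"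
  shows norm_set_integral_le: "norm (LINT t:S|lborel. f t) \<le> (LINT t:S|lborel. h (t :: real))"
    and set_integral_norm_le: "(LINT t:S|lborel. norm (f t)) \<le> (LINT t:S|lborel. h t)"
proof -
  have i: "set_integrable lborel S f"
    by (rule set_integrable_complex_bound[OF assms])
  show 1: "(LINT t:S|lborel. norm (f t)) \<le> (LINT t:S|lborel. h t)"
    by (rule set_integral_mono[OF set_integrable_norm[OF i] assms(1,4)])
  show "norm (LINT t:S|lborel. f t) \<le> (LINT t:S|lborel. h (t :: real))"
    using set_integral_norm_bound[OF i] 1 by linarith
qed

text \<open>The condition on N pushes the exponent of t down to -3/2 or below, so a fixed integrable
  power dominates for all Re \<nu> <= K. One constant then serves the integral of the norm, used for
  exchanging sum and integral, and the derivative itself, used for holomorphy in \<nu>.\<close>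

lemma integral_norm_crandall_kernel_le:
  fixes N :: nat and K :: real
  assumes N: "real N \<ge> K + real (mi_abs \<alpha>) + 1"
  obtains C where "C > 0"
    "\<And>\<nu> (u :: real ^ 'n). Re \<nu> \<le> K \<Longrightarrow> u \<noteq> 0 \<Longrightarrow> set_integrable lborel {1..} (crandall_kernel \<alpha> \<nu> u)"
    "\<And>\<nu> (u :: real ^ 'n). Re \<nu> \<le> K \<Longrightarrow> u \<noteq> 0 \<Longrightarrow> (LINT t:{1..}|lborel. norm (crandall_kernel \<alpha> \<nu> u t)) \<le> C * norm u powr (- real N)"
    "\<And>\<nu> (u :: real ^ 'n). Re \<nu> \<le> K \<Longrightarrow> u \<noteq> 0 \<Longrightarrow> norm (nabla \<alpha> (crandall \<nu>) (cvec u)) \<le> C * norm u powr (- real N)"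
proof -
  obtain C where C: "C > 0"
    "\<And>\<nu> t (u :: real ^ 'n). t > 0 \<Longrightarrow> u \<noteq> 0 \<Longrightarrow> norm (crandall_kernel \<alpha> \<nu> u t) \<le>
       C * norm u powr (- real N) * t powr ((Re \<nu> + real (mi_abs \<alpha>) - real N) / 2 - 1)"
    using norm_crandall_kernel_decay[of \<alpha> N] by blast
  define I where "I = (LINT t:{1..}|lborel. t powr (- (3 / 2)) :: real)"
  have I: "set_integrable lborel {1..} (\<lambda>t :: real. t powr (- (3 / 2)))"
    by (rule set_integrable_powr_atLeast_1) simp
  have I0: "I \<ge> 0" unfolding I_def set_lebesgue_integral_def by (intro integral_nonneg_AE) auto
  have sub: "{1..} \<subseteq> {0 :: real<..}" by auto
  have bound: "norm (crandall_kernel \<alpha> \<nu> u t) \<le> C * norm u powr (- real N) * t powr (- (3 / 2))"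
    if "Re \<nu> \<le> K" "u \<noteq> 0" "t \<in> {1..}" for \<nu> t and u :: "real ^ 'n"
  proof -
    have "t powr ((Re \<nu> + real (mi_abs \<alpha>) - real N) / 2 - 1) \<le> t powr (- (3 / 2))"
    proof (rule powr_mono)
      show "(Re \<nu> + real (mi_abs \<alpha>) - real N) / 2 - 1 \<le> - (3 / 2)"
        using that N by (simp add: field_simps)
    qed (use that in auto)
    then have "C * norm u powr (- real N) * t powr ((Re \<nu> + real (mi_abs \<alpha>) - real N) / 2 - 1) \<le> C * norm u powr (- real N) * t powr (- (3 / 2))"
      using C(1) by (intro mult_left_mono) auto
    then show ?thesis
      using C(2)[of t u \<nu>] that by auto
  qed
  have h: "set_integrable lborel {1..} (\<lambda>t. C * norm u powr (- real N) * t powr (- (3 / 2)))" for u :: "real ^ 'n"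
    using I by (intro set_integrable_mult_right impI)
  have hI: "(LINT t:{1..}|lborel. C * norm u powr (- real N) * t powr (- (3 / 2))) = C * norm u powr (- real N) * I" for u :: "real ^ 'n"
    by (simp add: I_def)
  have le: "C * norm u powr (- real N) * I \<le> C * (I + 1) * norm u powr (- real N)" for u :: "real ^ 'n"
    using C(1) I0 by (simp add: algebra_simps)
  show ?thesis
  \<comment> \<open>The summand 1 makes the constant positive at once.\<close>
  proof (rule that[of "C * (I + 1)"])
    show "C * (I + 1) > 0" using C(1) I0 by simp
    fix \<nu> and u :: "real ^ 'n" assume \<nu>: "Re \<nu> \<le> K" "u \<noteq> 0"
    note k = h[of u] _ continuous_on_crandall_kernel[OF sub, of \<alpha> \<nu> u] bound[OF \<nu>]
    show "set_integrable lborel {1..} (crandall_kernel \<alpha> \<nu> u)"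
      by (rule set_integrable_complex_bound[OF k]) auto
    have "(LINT t:{1..}|lborel. norm (crandall_kernel \<alpha> \<nu> u t)) \<le> C * norm u powr (- real N) * I"
      unfolding hI[symmetric] by (rule set_integral_norm_le[OF k]) auto
    then show "(LINT t:{1..}|lborel. norm (crandall_kernel \<alpha> \<nu> u t)) \<le> C * (I + 1) * norm u powr (- real N)"
      using le[of u] by linarith
    have "norm (LINT t:{1..}|lborel. crandall_kernel \<alpha> \<nu> u t) \<le> C * norm u powr (- real N) * I"
      unfolding hI[symmetric] by (rule norm_set_integral_le[OF k]) auto
    then show "norm (nabla \<alpha> (crandall \<nu>) (cvec u)) \<le> C * (I + 1) * norm u powr (- real N)"
      unfolding nabla_crandall_eq_integral[OF \<nu>(2)] using le[of u] by linarith
  qed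
qed

lemma holomorphic_nabla_crandall:
  assumes "u \<noteq> 0"
  shows "(\<lambda>\<nu>. nabla \<alpha> (crandall \<nu>) (cvec u)) holomorphic_on UNIV"
proof -
  have "(\<lambda>\<nu>. crandall (\<nu> + 2 * of_nat (mi_abs \<alpha>) - 2 * of_nat (mi_abs \<beta>)) (cvec u)) holomorphic_on UNIV" for \<beta> :: "nat ^ 'a"
    by (rule holomorphic_on_compose_gen[OF _ holomorphic_crandall[OF assms], unfolded o_def]) (auto intro!: holomorphic_intros)
  then show ?thesis
    unfolding nabla_crandall[OF cvec_crandall_dom[OF assms]] crandall_sum_def
    by (intro holomorphic_intros)
qed

section \<open>Sums holomorphic in a parameter, and inversion of the integration variable\<close>

lemma holomorphic_infsum:
  fixes f :: "'i \<Rightarrow> complex \<Rightarrow> complex"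
  assumes hol: "\<And>i. i \<in> I \<Longrightarrow> f i holomorphic_on UNIV"
    and bound: "\<And>K. \<exists>M. M summable_on I \<and> (\<forall>i\<in>I. \<forall>z. norm z \<le> K \<longrightarrow> norm (f i z) \<le> M i)"
  shows "(\<lambda>z. \<Sum>\<^sub>\<infinity>i\<in>I. f i z) holomorphic_on UNIV"
proof -
  have "\<exists>D. ((\<lambda>z. \<Sum>\<^sub>\<infinity>i\<in>I. f i z) has_field_derivative D) (at z)" for z
  proof -
    obtain M where M: "M summable_on I" "\<And>i w. i \<in> I \<Longrightarrow> norm w \<le> norm z + 1 \<Longrightarrow> norm (f i w) \<le> M i"
      using bound[of "norm z + 1"] by blast
    have "norm w \<le> norm z + 1" if "w \<in> cball z 1" for w
      using that norm_triangle_ineq2[of w z] by (simp add: dist_norm norm_minus_commute)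
    then have u: "uniform_limit (cball z 1) (\<lambda>J w. \<Sum>i\<in>J. f i w) (\<lambda>w. \<Sum>\<^sub>\<infinity>i\<in>I. f i w) (finite_subsets_at_top I)"
      by (intro Weierstrass_m_test_general[OF _ M(1)] M(2)) auto
    have "eventually (\<lambda>J. continuous_on (cball z 1) (\<lambda>w. \<Sum>i\<in>J. f i w) \<and> (\<lambda>w. \<Sum>i\<in>J. f i w) holomorphic_on ball z 1) (finite_subsets_at_top I)"
    proof (rule eventually_finite_subsets_at_top_weakI)
      fix J assume "finite J" "J \<subseteq> I"
      then have "(\<lambda>w. \<Sum>i\<in>J. f i w) holomorphic_on UNIV"
        by (intro holomorphic_intros hol) auto
      then show "continuous_on (cball z 1) (\<lambda>w. \<Sum>i\<in>J. f i w) \<and> (\<lambda>w. \<Sum>i\<in>J. f i w) holomorphic_on ball z 1"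
        by (meson holomorphic_on_imp_continuous_on holomorphic_on_subset subset_UNIV)
    qed
    from holomorphic_uniform_limit[OF this u finite_subsets_at_top_neq_bot]
    have "(\<lambda>w. \<Sum>\<^sub>\<infinity>i\<in>I. f i w) holomorphic_on ball z 1" by blast
    then show ?thesis
      using holomorphic_on_open[of "ball z 1"] by force
  qed
  then show ?thesis by (simp add: holomorphic_on_open)
qed

text \<open>The substitution t -> 1 / t with its Jacobian. It moves the tails of Crandall type from
  t > 1 to the unit interval, where the theta transformation meets them.\<close>

lemma
  fixes F :: "real \<Rightarrow> complex"
  assumes F: "continuous_on {1<..} F" "set_integrable lborel {1<..} F"
  shows set_integrable_inversion: "set_integrable lborel {0<..<1} (\<lambda>t. of_real (1 / t\<^sup>2) * F (1 / t))"
    and set_integral_inversion: "(LINT t:{0<..<1}|lborel. of_real (1 / t\<^sup>2) * F (1 / t)) = (LINT t:{1<..}|lborel. F t)"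
proof -
  have img: "(\<lambda>t :: real. 1 / t) ` {0<..<1} = {1<..}"
  proof (intro equalityI subsetI)
    fix s :: real assume "s \<in> {1<..}"
    then show "s \<in> (\<lambda>t. 1 / t) ` {0<..<1}" by (intro image_eqI[of _ _ "1 / s"]) (auto simp: field_simps)
  qed (auto simp: field_simps)
  have G: "(\<lambda>t. \<bar>- 1 / t\<^sup>2\<bar> *\<^sub>R F (1 / t)) = (\<lambda>t. of_real (1 / t\<^sup>2) * F (1 / t))"
    by (simp add: scaleR_conv_of_real)
  have "F absolutely_integrable_on {1<..}"
    using F(2) unfolding set_integrable_def by (subst integrable_completion) auto
  moreover have "(\<lambda>t. \<bar>- 1 / t\<^sup>2\<bar> *\<^sub>R F (1 / t)) absolutely_integrable_on {0<..<1} \<and>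
      integral {0<..<1} (\<lambda>t. \<bar>- 1 / t\<^sup>2\<bar> *\<^sub>R F (1 / t)) = integral {1<..} F
    \<longleftrightarrow> F absolutely_integrable_on (\<lambda>t. 1 / t) ` {0<..<1} \<and> integral ((\<lambda>t. 1 / t) ` {0<..<1}) F = integral {1<..} F"
    by (rule has_absolute_integral_change_of_variables_real)
       (auto intro!: derivative_eq_intros simp: inj_on_def power2_eq_square)
  ultimately have A: "(\<lambda>t. of_real (1 / t\<^sup>2) * F (1 / t)) absolutely_integrable_on {0<..<1}"
    and I: "integral {0<..<1} (\<lambda>t. of_real (1 / t\<^sup>2) * F (1 / t)) = integral {1<..} F"
    unfolding img G by auto
  have "continuous_on {0<..<1} (\<lambda>t. of_real (1 / t\<^sup>2) * F (1 / t))"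
    by (intro continuous_intros continuous_on_compose2[OF F(1)]) (auto simp: field_simps)
  then have "set_borel_measurable borel {0<..<1} (\<lambda>t. of_real (1 / t\<^sup>2) * F (1 / t))"
    by (intro set_borel_measurable_continuous) auto
  then show i: "set_integrable lborel {0<..<1} (\<lambda>t. of_real (1 / t\<^sup>2) * F (1 / t))"
    using A unfolding set_integrable_def set_borel_measurable_def
    by (subst (asm) integrable_completion) simp_all
  show "(LINT t:{0<..<1}|lborel. of_real (1 / t\<^sup>2) * F (1 / t)) = (LINT t:{1<..}|lborel. F t)"
    using set_borel_integral_eq_integral(2)[OF i] set_borel_integral_eq_integral(2)[OF F(2)] I by simp
qed

lemma set_integral_greaterThan_atLeast:
  fixes F :: "real \<Rightarrow> complex"
  assumes "set_integrable lborel {a..} F"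
  shows "(LINT t:{a<..}|lborel. F t) = (LINT t:{a..}|lborel. F t)"
proof -
  have "set_integrable lborel {a<..} F"
    by (rule set_integrable_subset[OF assms]) auto
  then show ?thesis
    using assms AE_lborel_singleton[of a] unfolding set_lebesgue_integral_def set_integrable_def
    by (intro integral_cong_AE) (auto simp: borel_measurable_integrable indicator_def elim!: eventually_mono)
qed

section \<open>Convergence of the lattice sums\<close>

lemma lat_shift: "(\<lambda>z. z - x) ` lat A = range (\<lambda>k. A *v ivec k + (- x))"
  by (auto simp: lat_eq)

lemma dual_lat_shift: "(\<lambda>q. q + y) ` dual_lat A = range (\<lambda>k. transpose (matrix_inv A) *v ivec k + y)"
  by (auto simp: lat_eq dual_lat_def)

lemma uminus_lat: "- z \<in> lat A \<longleftrightarrow> z \<in> lat A"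
proof -
  have "- z \<in> lat A" if "z \<in> lat A" for z
  proof -
    obtain k where "z = A *v ivec k" using \<open>z \<in> lat A\<close> by (auto simp: lat_eq)
    then have "- z = A *v ivec (- k)" by (simp add: ivec_minus linear_neg[OF matrix_vector_mul_linear])
    then show ?thesis by (auto simp: lat_eq)
  qed
  from this[of z] this[of "- z"] show ?thesis by auto
qed

lemma zero_mem_lat_shift: "0 \<in> (\<lambda>z. z - x) ` lat A \<longleftrightarrow> x \<in> lat A"
  by (auto simp: image_iff)

lemma zero_mem_dual_lat_shift: "0 \<in> (\<lambda>q. q + y) ` dual_lat A \<longleftrightarrow> y \<in> dual_lat A"
proof -
  have "0 \<in> (\<lambda>q. q + y) ` dual_lat A \<longleftrightarrow> - y \<in> dual_lat A"
    by (auto simp: image_iff add_eq_0_iff2)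
  then show ?thesis by (simp add: dual_lat_def uminus_lat)
qed

lemma
  fixes A :: "real ^ 'n ^ 'n"
  assumes A: "invertible A" and s: "s > real CARD('n)"
  shows summable_on_lat_norm: "(\<lambda>z. norm z powr (- s)) summable_on ((\<lambda>z. z - x) ` lat A - {0})"
    and summable_on_dual_lat_norm: "(\<lambda>z. norm z powr (- s)) summable_on ((\<lambda>q. q + y) ` dual_lat A - {0})"
  unfolding lat_shift dual_lat_shift
  by (rule summable_on_lattice_norm[OF A s], rule summable_on_lattice_norm[OF invertible_dual[OF A] s])

text \<open>Serves to isolate an exceptional term, the origin of a shifted lattice or the point z =
  x. The conditional treats lattices with and without that point alike.\<close>

lemma
  fixes f :: "'a \<Rightarrow> complex"
  assumes "f summable_on (S - {a})"
  shows summable_on_from_remove: "f summable_on S"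
    and infsum_split: "(\<Sum>\<^sub>\<infinity>z\<in>S. f z) = (if a \<in> S then f a else 0) + (\<Sum>\<^sub>\<infinity>z\<in>S - {a}. f z)"
proof -
  have "f summable_on S \<and> (\<Sum>\<^sub>\<infinity>z\<in>S. f z) = (if a \<in> S then f a else 0) + (\<Sum>\<^sub>\<infinity>z\<in>S - {a}. f z)"
  proof (cases "a \<in> S")
    case True
    have "f summable_on insert a (S - {a})"
      using assms summable_on_insert_iff[of f a "S - {a}"] by blast
    moreover have "(\<Sum>\<^sub>\<infinity>z\<in>insert a (S - {a}). f z) = f a + (\<Sum>\<^sub>\<infinity>z\<in>S - {a}. f z)"
      by (rule infsum_insert) (use assms in auto)
    ultimately show ?thesis
      unfolding insert_Diff[OF True] using True by simp
  next
    case False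
    then have "S - {a} = S" by auto
    then show ?thesis using assms False by simp
  qed
  then show "f summable_on S" "(\<Sum>\<^sub>\<infinity>z\<in>S. f z) = (if a \<in> S then f a else 0) + (\<Sum>\<^sub>\<infinity>z\<in>S - {a}. f z)"
    by blast+
qed

lemma norm_epstein_term_le:
  assumes "z \<noteq> x"
  shows "norm (epstein_term \<alpha> x y \<nu> z) \<le> norm (z - x) powr (- (Re \<nu> - real (mi_abs \<alpha>)))"
proof -
  have n: "norm (z - x) > 0" using assms by simp
  have "norm (epstein_term \<alpha> x y \<nu> z) = norm (mi_pow (z - x) \<alpha>) * norm (z - x) powr (- Re \<nu>)"
    using n by (simp add: epstein_term_def norm_mult norm_divide norm_of_real_powr powr_minus divide_inverse norm_inverse)
  also have "\<dots> \<le> norm (z - x) ^ mi_abs \<alpha> * norm (z - x) powr (- Re \<nu>)"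
    by (intro mult_right_mono norm_mi_pow_le) auto
  also have "\<dots> = norm (z - x) powr (- (Re \<nu> - real (mi_abs \<alpha>)))"
    using n by (simp flip: powr_realpow powr_add)
  finally show ?thesis .
qed

lemma lat_remove_image: "(\<lambda>z. z - x) ` (lat A - {x}) = (\<lambda>z. z - x) ` lat A - {0}"
  by auto

lemma inj_shift: "inj_on (\<lambda>z :: 'a :: ab_group_add. z - x) S"
  by (simp add: inj_on_def)

lemma summable_on_lat_remove_norm:
  fixes A :: "real ^ 'n ^ 'n"
  assumes A: "invertible A" and s: "s > real CARD('n)"
  shows "(\<lambda>z. norm (z - x) powr (- s)) summable_on (lat A - {x})"
  using summable_on_lat_norm[OF assms, of x]
  unfolding lat_remove_image[symmetric] summable_on_reindex[OF inj_shift] by (simp add: o_def)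

lemma summable_on_epstein_term:
  fixes A :: "real ^ 'n ^ 'n"
  assumes A: "invertible A" and \<nu>: "\<nu> \<in> epstein_halfplane \<alpha>"
  shows "epstein_term \<alpha> x y \<nu> summable_on (lat A - {x})"
proof (rule summable_on_norm_comparison)
  show "(\<lambda>z. norm (z - x) powr (- (Re \<nu> - real (mi_abs \<alpha>)))) summable_on (lat A - {x})"
    by (rule summable_on_lat_remove_norm[OF A]) (use \<nu> in \<open>simp add: epstein_halfplane_def\<close>)
qed (use norm_epstein_term_le in auto)

text \<open>A single majorant for all \<nu> with Re \<nu> <= K, as holomorphy of the sum in \<nu>
  requires. The Crandall function decays to any chosen order, so the monomial costs nothing.\<close>

lemma direct_term_bound:
  fixes A :: "real ^ 'n ^ 'n"
  assumes A: "invertible A" and lam: "lam > 0"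
  shows "\<exists>M. M summable_on ((\<lambda>z. z - x) ` lat A - {0}) \<and>
     (\<forall>z\<in>(\<lambda>z. z - x) ` lat A - {0}. \<forall>\<nu>. Re \<nu> \<le> K \<longrightarrow> norm (direct_term \<alpha> x y \<nu> lam z) \<le> M z)"
proof -
  \<comment> \<open>Large enough that K' - |\<alpha>|, the decay left after the monomial, exceeds
    the dimension.\<close>
  define K' where "K' = max K (real CARD('n) + real (mi_abs \<alpha>) + 1)"
  define C where "C = Gamma (K' / 2) * pi powr (- K' / 2) * lam powr K'"
  have K': "K' > 0" "K \<le> K'" "K' - real (mi_abs \<alpha>) > real CARD('n)"
    unfolding K'_def by (auto simp: max_def)
  have "norm (direct_term \<alpha> x y \<nu> lam z) \<le> C * norm z powr (- (K' - real (mi_abs \<alpha>)))"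
    if z: "z \<noteq> 0" and \<nu>: "Re \<nu> \<le> K" for z \<nu>
  proof -
    have n: "norm z > 0" using z by simp
    have "norm (direct_term \<alpha> x y \<nu> lam z) = norm (mi_pow z \<alpha>) * norm (crandall \<nu> (cvec ((1 / lam) *\<^sub>R z)))"
      by (simp add: direct_term_def norm_mult)
    also have "\<dots> \<le> norm z ^ mi_abs \<alpha> * (Gamma (K' / 2) * pi powr (- K' / 2) * norm ((1 / lam) *\<^sub>R z) powr (- K'))"
      using lam z \<nu> K' by (intro mult_mono norm_mi_pow_le norm_crandall_le) auto
    also have "norm ((1 / lam) *\<^sub>R z) powr (- K') = lam powr K' * norm z powr (- K')"
    proof -
      show ?thesis using lam by (simp add: powr_mult powr_divide powr_minus field_simps)
    qed
    also have "norm z ^ mi_abs \<alpha> * (Gamma (K' / 2) * pi powr (- K' / 2) * (lam powr K' * norm z powr (- K'))) =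
       C * (norm z ^ mi_abs \<alpha> * norm z powr (- K'))"
      by (simp add: C_def)
    also have "norm z ^ mi_abs \<alpha> * norm z powr (- K') = norm z powr (- (K' - real (mi_abs \<alpha>)))"
      using n by (simp flip: powr_realpow powr_add)
    finally show ?thesis .
  qed
  then show ?thesis
    by (intro exI[of _ "\<lambda>z. C * norm z powr (- (K' - real (mi_abs \<alpha>)))"] conjI summable_on_cmult_right
        summable_on_lat_norm[OF A K'(3)]) auto
qed

text \<open>The same majorant controls the terms and the integrals of their kernels: the former for
  holomorphy in \<nu>, the latter for exchanging summation and integration.\<close>

lemma dual_term_bound:
  fixes A :: "real ^ 'n ^ 'n"
  assumes A: "invertible A" and lam: "lam > 0"
  shows "\<exists>M. M summable_on ((\<lambda>q. q + y) ` dual_lat A - {0}) \<and>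
     (\<forall>p\<in>(\<lambda>q. q + y) ` dual_lat A - {0}. \<forall>\<nu>. Re (of_nat CARD('n) - \<nu>) \<le> K \<longrightarrow>
        norm (dual_term \<alpha> x \<nu> lam p) \<le> M p \<and>
        set_integrable lborel {1..} (crandall_kernel \<alpha> (of_nat CARD('n) - \<nu>) (lam *\<^sub>R p)) \<and>
        (LINT t:{1..}|lborel. norm (crandall_kernel \<alpha> (of_nat CARD('n) - \<nu>) (lam *\<^sub>R p) t)) \<le> M p)"
proof -
  \<comment> \<open>One natural number meets both demands: summability over the lattice and
    integrability of the kernel up to order K.\<close>
  define N where "N = nat \<lceil>max (real CARD('n)) (K + real (mi_abs \<alpha>))\<rceil> + 1"
  have N: "real N > real CARD('n)" "real N \<ge> K + real (mi_abs \<alpha>) + 1"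
    unfolding N_def by linarith+
  obtain C where C: "C > 0"
    "\<And>\<nu> (u :: real ^ 'n). Re \<nu> \<le> K \<Longrightarrow> u \<noteq> 0 \<Longrightarrow> set_integrable lborel {1..} (crandall_kernel \<alpha> \<nu> u)"
    "\<And>\<nu> (u :: real ^ 'n). Re \<nu> \<le> K \<Longrightarrow> u \<noteq> 0 \<Longrightarrow> (LINT t:{1..}|lborel. norm (crandall_kernel \<alpha> \<nu> u t)) \<le> C * norm u powr (- real N)"
    "\<And>\<nu> (u :: real ^ 'n). Re \<nu> \<le> K \<Longrightarrow> u \<noteq> 0 \<Longrightarrow> norm (nabla \<alpha> (crandall \<nu>) (cvec u)) \<le> C * norm u powr (- real N)"
    using integral_norm_crandall_kernel_le[OF N(2)] by blast
  let ?M = "\<lambda>p :: real ^ 'n. C * lam powr (- real N) * norm p powr (- real N)"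
  have e: "C * norm (lam *\<^sub>R p) powr (- real N) = ?M p" for p :: "real ^ 'n"
    using lam by (simp add: powr_mult)
  show ?thesis
  proof (intro exI[of _ ?M] conjI ballI allI impI)
    show "?M summable_on ((\<lambda>q. q + y) ` dual_lat A - {0})"
      by (intro summable_on_cmult_right summable_on_dual_lat_norm[OF A N(1)])
    fix p \<nu> assume p: "p \<in> (\<lambda>q. q + y) ` dual_lat A - {0}" and \<nu>: "Re (of_nat CARD('n) - \<nu>) \<le> K"
    have lp: "lam *\<^sub>R p \<noteq> 0" using p lam by simp
    show "norm (dual_term \<alpha> x \<nu> lam p) \<le> ?M p"
      using C(4)[OF \<nu> lp] unfolding e by (simp add: dual_term_def norm_mult crandall_deriv_cvec[OF lp])
    show "set_integrable lborel {1..} (crandall_kernel \<alpha> (of_nat CARD('n) - \<nu>) (lam *\<^sub>R p))"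
      by (rule C(2)[OF \<nu> lp])
    show "(LINT t:{1..}|lborel. norm (crandall_kernel \<alpha> (of_nat CARD('n) - \<nu>) (lam *\<^sub>R p) t)) \<le> ?M p"
      using C(3)[OF \<nu> lp] unfolding e .
  qed
qed

lemma summable_on_direct_term:
  fixes A :: "real ^ 'n ^ 'n"
  assumes "invertible A" "lam > 0"
  shows "direct_term \<alpha> x y \<nu> lam summable_on ((\<lambda>z. z - x) ` lat A - {0})"
proof -
  obtain M where M: "M summable_on ((\<lambda>z. z - x) ` lat A - {0})"
     "\<And>z. z \<in> (\<lambda>z. z - x) ` lat A - {0} \<Longrightarrow> norm (direct_term \<alpha> x y \<nu> lam z) \<le> M z"
    using direct_term_bound[OF assms, of x "Re \<nu>" \<alpha> y] by blast
  then show ?thesis by (rule summable_on_norm_comparison)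
qed

lemma summable_on_dual_term:
  fixes A :: "real ^ 'n ^ 'n"
  assumes "invertible A" "lam > 0"
  shows "dual_term \<alpha> x \<nu> lam summable_on ((\<lambda>q. q + y) ` dual_lat A - {0})"
proof -
  obtain M where M: "M summable_on ((\<lambda>q. q + y) ` dual_lat A - {0})"
     "\<And>p. p \<in> (\<lambda>q. q + y) ` dual_lat A - {0} \<Longrightarrow> norm (dual_term \<alpha> x \<nu> lam p) \<le> M p"
    using dual_term_bound[OF assms, of y "Re (of_nat CARD('n) - \<nu>)" \<alpha> x] by blast
  then show ?thesis by (rule summable_on_norm_comparison)
qed

section \<open>The right-hand side as a function of the exponent\<close>

definition epstein_rhs ::
    "real ^ 'n ^ 'n \<Rightarrow> nat ^ 'n \<Rightarrow> real ^ 'n \<Rightarrow> real ^ 'n \<Rightarrow> real \<Rightarrow> complex \<Rightarrow> complex" where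
  "epstein_rhs A \<alpha> x y lam \<nu> = crandall_prefactor lam \<nu> *
            ((\<Sum>\<^sub>\<infinity>z\<in>(\<lambda>z. z - x) ` lat A. direct_term \<alpha> x y \<nu> lam z) +
             1 / (- 2 * of_real pi * \<i>) ^ mi_abs \<alpha> *
             of_real (lam ^ (CARD('n) + mi_abs \<alpha>) / covol A) *
             (\<Sum>\<^sub>\<infinity>p\<in>(\<lambda>q. q + y) ` dual_lat A. dual_term \<alpha> x \<nu> lam p))
          + origin_limit A \<alpha> x y \<nu>"

lemma mi_pow_0: "mi_pow (0 :: real ^ 'n) \<alpha> = (if \<alpha> = 0 then 1 else 0)"
  by (auto simp: mi_pow_def vec_eq_iff prod_zero_iff power_0_left)

lemma direct_term_0: "direct_term \<alpha> x y \<nu> lam 0 = of_real (mi_pow 0 \<alpha>) * (- 2 / \<nu>) * phase y x"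
  by (simp add: direct_term_def crandall_def)

lemma cvec_0 [simp]: "cvec 0 = 0"
  by simp

lemma dual_term_0:
  fixes \<alpha> :: "nat ^ 'n"
  shows "dual_term \<alpha> x \<nu> lam 0 = crandall_res \<alpha> / (of_nat CARD('n) - \<nu> + of_nat (mi_abs \<alpha>))"
  by (simp add: dual_term_def crandall_deriv_0)

text \<open>As 1 / \<Gamma>(\<nu>/2) = (\<nu>/2) / \<Gamma>(\<nu>/2 + 1), the prefactor cancels the
  pole of -2 / \<nu>. At \<nu> = 0 the product as defined is 0 and \<open>origin_limit\<close>
  supplies the missing limit, so the right side is entire in \<nu> without exception.\<close>

lemma prefactor_origin:
  "crandall_prefactor lam \<nu> * (if x \<in> lat A then direct_term \<alpha> x y \<nu> lam 0 else 0) + origin_limit A \<alpha> x y \<nu> =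
   (if x \<in> lat A then - of_real (mi_pow 0 \<alpha>) * phase y x * of_real (pi / lam\<^sup>2) powr (\<nu> / 2) * rGamma (\<nu> / 2 + 1) else 0)"
  if "lam > 0"
proof (cases "\<nu> = 0")
  case True
  then show ?thesis using that by (auto simp: crandall_prefactor_def origin_limit_def mi_pow_0)
next
  case False
  have e: "rGamma (\<nu> / 2) = \<nu> / 2 * rGamma (\<nu> / 2 + 1)"
    by (rule rGamma_plus1[symmetric])
  show ?thesis
    unfolding crandall_prefactor_def e direct_term_0 using False by (simp add: origin_limit_def)
qed

text \<open>The sums away from the origin are entire by the uniform majorants, and the direct term
  at the origin is entire once multiplied by the prefactor. Only the dual term at the origin can
  produce a pole; \<open>g\<close> is its coefficient.\<close>

lemma epstein_rhs_decomposition: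
  fixes A :: "real ^ 'n ^ 'n"
  assumes A: "invertible A" and lam: "lam > 0"
  obtains f g where "f holomorphic_on UNIV" "g holomorphic_on UNIV"
    "\<And>\<nu>. epstein_rhs A \<alpha> x y lam \<nu> = f \<nu> +
       (if y \<in> dual_lat A then g \<nu> * (crandall_res \<alpha> / (of_nat CARD('n) - \<nu> + of_nat (mi_abs \<alpha>))) else 0)"
proof -
  define L where "L = (\<lambda>z. z - x) ` lat A - {0}"
  define D where "D = (\<lambda>q. q + y) ` dual_lat A - {0}"
  define \<kappa> where "\<kappa> = 1 / (- 2 * of_real pi * \<i>) ^ mi_abs \<alpha> * of_real (lam ^ (CARD('n) + mi_abs \<alpha>) / covol A)"
  define P where "P = crandall_prefactor lam"
  define Q where "Q \<nu> = (if x \<in> lat A then - of_real (mi_pow 0 \<alpha>) * phase y x * of_real (pi / lam\<^sup>2) powr (\<nu> / 2) * rGamma (\<nu> / 2 + 1) else 0)" for \<nu>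
  define f where "f \<nu> = P \<nu> * ((\<Sum>\<^sub>\<infinity>z\<in>L. direct_term \<alpha> x y \<nu> lam z) + \<kappa> * (\<Sum>\<^sub>\<infinity>p\<in>D. dual_term \<alpha> x \<nu> lam p)) + Q \<nu>" for \<nu>
  have hP: "P holomorphic_on UNIV"
    unfolding P_def crandall_prefactor_def[abs_def] using lam by (intro holomorphic_intros) auto
  have hQ: "Q holomorphic_on UNIV"
    unfolding Q_def[abs_def] using lam by (cases "x \<in> lat A") (auto intro!: holomorphic_intros)
  have h1: "(\<lambda>\<nu>. \<Sum>\<^sub>\<infinity>z\<in>L. direct_term \<alpha> x y \<nu> lam z) holomorphic_on UNIV"
  proof (rule holomorphic_infsum)
    show "(\<lambda>\<nu>. direct_term \<alpha> x y \<nu> lam z) holomorphic_on UNIV" if "z \<in> L" for z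
      unfolding direct_term_def using that lam
      by (intro holomorphic_intros holomorphic_crandall) (auto simp: L_def)
    fix K :: real
    obtain M where M: "M summable_on L" "\<forall>z\<in>L. \<forall>\<nu>. Re \<nu> \<le> K \<longrightarrow> norm (direct_term \<alpha> x y \<nu> lam z) \<le> M z"
      using direct_term_bound[OF A lam, of x K \<alpha> y] unfolding L_def by blast
    have "Re \<nu> \<le> K" if "norm \<nu> \<le> K" for \<nu> using complex_Re_le_cmod[of \<nu>] that by linarith
    with M show "\<exists>M. M summable_on L \<and> (\<forall>z\<in>L. \<forall>\<nu>. norm \<nu> \<le> K \<longrightarrow> norm (direct_term \<alpha> x y \<nu> lam z) \<le> M z)"
      by blast
  qed
  have h2: "(\<lambda>\<nu>. \<Sum>\<^sub>\<infinity>p\<in>D. dual_term \<alpha> x \<nu> lam p) holomorphic_on UNIV"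
  proof (rule holomorphic_infsum)
    show "(\<lambda>\<nu>. dual_term \<alpha> x \<nu> lam p) holomorphic_on UNIV" if "p \<in> D" for p
    proof -
      have lp: "lam *\<^sub>R p \<noteq> 0" using that lam by (auto simp: D_def)
      have "(\<lambda>\<nu>. nabla \<alpha> (crandall (of_nat CARD('n) - \<nu>)) (cvec (lam *\<^sub>R p))) holomorphic_on UNIV"
        by (rule holomorphic_on_compose_gen[OF _ holomorphic_nabla_crandall[OF lp], unfolded o_def]) (auto intro!: holomorphic_intros)
      then show ?thesis
        unfolding dual_term_def crandall_deriv_cvec[OF lp] by (intro holomorphic_intros)
    qed
    fix K :: real
    obtain M where M: "M summable_on D" "\<forall>p\<in>D. \<forall>\<nu>. Re (of_nat CARD('n) - \<nu>) \<le> real CARD('n) + K \<longrightarrow> norm (dual_term \<alpha> x \<nu> lam p) \<le> M p"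
      using dual_term_bound[OF A lam, of y "real CARD('n) + K" \<alpha> x] unfolding D_def by blast
    have "Re (of_nat CARD('n) - \<nu>) \<le> real CARD('n) + K" if "norm \<nu> \<le> K" for \<nu>
      using abs_Re_le_cmod[of \<nu>] that by simp
    with M show "\<exists>M. M summable_on D \<and> (\<forall>p\<in>D. \<forall>\<nu>. norm \<nu> \<le> K \<longrightarrow> norm (dual_term \<alpha> x \<nu> lam p) \<le> M p)"
      by blast
  qed
  have "f holomorphic_on UNIV"
    unfolding f_def[abs_def] by (intro holomorphic_intros hP hQ h1 h2)
  moreover have "(\<lambda>\<nu>. P \<nu> * \<kappa>) holomorphic_on UNIV"
    by (intro holomorphic_intros hP)
  moreover have "epstein_rhs A \<alpha> x y lam \<nu> = f \<nu> +
       (if y \<in> dual_lat A then P \<nu> * \<kappa> * (crandall_res \<alpha> / (of_nat CARD('n) - \<nu> + of_nat (mi_abs \<alpha>))) else 0)" for \<nu>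
  proof -
    have "epstein_rhs A \<alpha> x y lam \<nu> = P \<nu> * (((if x \<in> lat A then direct_term \<alpha> x y \<nu> lam 0 else 0) + (\<Sum>\<^sub>\<infinity>z\<in>L. direct_term \<alpha> x y \<nu> lam z)) +
       \<kappa> * ((if y \<in> dual_lat A then dual_term \<alpha> x \<nu> lam 0 else 0) + (\<Sum>\<^sub>\<infinity>p\<in>D. dual_term \<alpha> x \<nu> lam p))) + origin_limit A \<alpha> x y \<nu>"
      unfolding epstein_rhs_def P_def \<kappa>_def L_def D_def
        infsum_split[OF summable_on_direct_term[OF A lam]] infsum_split[OF summable_on_dual_term[OF A lam]]
        zero_mem_lat_shift zero_mem_dual_lat_shift ..
    also have "\<dots> = P \<nu> * ((\<Sum>\<^sub>\<infinity>z\<in>L. direct_term \<alpha> x y \<nu> lam z) + \<kappa> * (\<Sum>\<^sub>\<infinity>p\<in>D. dual_term \<alpha> x \<nu> lam p)) +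
      (P \<nu> * (if x \<in> lat A then direct_term \<alpha> x y \<nu> lam 0 else 0) + origin_limit A \<alpha> x y \<nu>) +
      P \<nu> * \<kappa> * (if y \<in> dual_lat A then dual_term \<alpha> x \<nu> lam 0 else 0)"
      by (simp add: algebra_simps)
    also have "P \<nu> * (if x \<in> lat A then direct_term \<alpha> x y \<nu> lam 0 else 0) + origin_limit A \<alpha> x y \<nu> = Q \<nu>"
      unfolding P_def Q_def by (rule prefactor_origin[OF lam])
    finally show ?thesis by (simp add: f_def dual_term_0)
  qed
  ultimately show ?thesis by (rule that)
qed

lemma epstein_rhs_meromorphic:
  fixes A :: "real ^ 'n ^ 'n"
  assumes A: "invertible A" and lam: "lam > 0"
  shows "epstein_rhs A \<alpha> x y lam meromorphic_on UNIV"
    and "\<lbrakk>y \<in> dual_lat A \<and> chi \<alpha> = 1 \<longrightarrow> \<nu> \<noteq> of_nat (CARD('n) + mi_abs \<alpha>)\<rbrakk> \<Longrightarrow> epstein_rhs A \<alpha> x y lam analytic_on {\<nu>}"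
proof -
  obtain f g where fg: "f holomorphic_on UNIV" "g holomorphic_on UNIV"
    "\<And>\<nu>. epstein_rhs A \<alpha> x y lam \<nu> = f \<nu> +
       (if y \<in> dual_lat A then g \<nu> * (crandall_res \<alpha> / (of_nat CARD('n) - \<nu> + of_nat (mi_abs \<alpha>))) else 0)"
    using epstein_rhs_decomposition[OF A lam] by blast
  have an: "f analytic_on S" "g analytic_on S" for S
    using fg(1,2) by (metis analytic_on_holomorphic open_UNIV subset_UNIV)+
  have eq: "epstein_rhs A \<alpha> x y lam = (\<lambda>\<nu>. f \<nu> +
       (if y \<in> dual_lat A then g \<nu> * (crandall_res \<alpha> / (of_nat CARD('n) - \<nu> + of_nat (mi_abs \<alpha>))) else 0))"
    by (rule ext) (rule fg(3))
  show "epstein_rhs A \<alpha> x y lam meromorphic_on UNIV"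
    unfolding eq using an[THEN analytic_on_imp_meromorphic_on]
    by (cases "y \<in> dual_lat A") (auto intro!: meromorphic_intros)
  show "epstein_rhs A \<alpha> x y lam analytic_on {\<nu>}" if "y \<in> dual_lat A \<and> chi \<alpha> = 1 \<longrightarrow> \<nu> \<noteq> of_nat (CARD('n) + mi_abs \<alpha>)"
  proof (cases "y \<in> dual_lat A \<and> chi \<alpha> = 1")
    case True
    then have "\<nu> \<noteq> of_nat (CARD('n) + mi_abs \<alpha>)" using that by simp
    then have "of_nat CARD('n) - \<nu> + of_nat (mi_abs \<alpha>) \<noteq> 0"
      by (auto simp: algebra_simps)
    then show ?thesis
      unfolding eq using True by (auto intro!: analytic_intros an)
  next
    case False
    then have "epstein_rhs A \<alpha> x y lam = f"
      using crandall_res_eq_0_iff[of \<alpha>] by (auto simp: eq fun_eq_iff)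
    then show ?thesis using an by simp
  qed
qed

text \<open>Scaling t by X reduces the complete Mellin integral to Euler's integral for complex s.
  The norm bound over the unit interval is what makes the low parts of the zeta series
  summable.\<close>

lemma
  assumes X: "X > 0" and s: "Re s > 0"
  shows set_integrable_exp_tail_full: "set_integrable lborel {0<..} (exp_tail s X)"
    and set_integral_exp_tail_full: "(LINT t:{0<..}|lborel. exp_tail s X t) = Gamma s * of_real X powr (- s)"
    and set_integral_norm_exp_tail_full: "(LINT t:{0<..<1}|lborel. norm (exp_tail s X t)) \<le> Gamma (Re s) * X powr (- Re s)"
proof -
  have h0: "set_integrable lborel {0..} (\<lambda>t. t powr (Re s - 1) * exp (- X * t))" if "X > 0" for X
    using that s by (intro set_integrable_Gamma)
  have h: "set_integrable lborel {0<..} (\<lambda>t. t powr (Re s - 1) * exp (- X * t))" if "X > 0" for X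
    by (rule set_integrable_subset[OF h0[OF that]]) auto
  have le: "norm (exp_tail s X t) \<le> t powr (Re s - 1) * exp (- X * t)" if "t \<in> {0<..}" for t X
    using that by (simp add: exp_tail_def norm_mult norm_of_real_powr)
  have int: "set_integrable lborel {0<..} (exp_tail s X)" if "X > 0" for X
    by (rule set_integrable_complex_bound[OF h[OF that] _ continuous_on_exp_tail le]) auto
  show "set_integrable lborel {0<..} (exp_tail s X)" by (rule int[OF X])
  \<comment> \<open>By \<open>0 powr a = 0\<close> the integrand vanishes at the endpoint, so the
    closed and the open half-line give identical integrands.\<close>
  have z: "exp_tail s X 0 = 0" for X by (simp add: exp_tail_def)
  have ind: "indicator {0..} t *\<^sub>R exp_tail s X t = indicator {0<..} t *\<^sub>R exp_tail s X t" for t X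
    using z by (cases "t = 0") (auto simp: indicator_def)
  have G: "(LINT t:{0<..}|lborel. exp_tail s 1 t) = Gamma s"
  proof -
    have i: "set_integrable lborel {0..} (exp_tail s 1)"
      using int[of 1] unfolding set_integrable_def ind by simp
    have "(LINT t:{0<..}|lborel. exp_tail s 1 t) = (LINT t:{0..}|lborel. exp_tail s 1 t)"
      unfolding set_lebesgue_integral_def ind ..
    also have "\<dots> = integral {0..} (exp_tail s 1)"
      by (rule set_borel_integral_eq_integral(2)[OF i])
    also have "\<dots> = Gamma s"
    proof -
      have "exp_tail s 1 = (\<lambda>t. of_real t powr (s - 1) / of_real (exp t))"
        by (simp add: exp_tail_def[abs_def] exp_minus divide_inverse)
      then show ?thesis
        using integral_unique[OF Gamma_integral_complex[OF s]] by (simp only:)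
    qed
    finally show ?thesis .
  qed
  have "Gamma s = (LINT t|lborel. indicator {0<..} t *\<^sub>R exp_tail s 1 t)"
    using G by (simp add: set_lebesgue_integral_def)
  also have "\<dots> = \<bar>X\<bar> *\<^sub>R (LINT t|lborel. indicator {0<..} (0 + X * t) *\<^sub>R exp_tail s 1 (0 + X * t))"
    by (rule lborel_integral_real_affine) (use X in simp)
  also have "(\<lambda>t. indicator {0<..} (0 + X * t) *\<^sub>R exp_tail s 1 (0 + X * t)) = (\<lambda>t. of_real X powr (s - 1) * (indicator {0<..} t *\<^sub>R exp_tail s X t))"
  proof
    fix t
    show "indicator {0<..} (0 + X * t) *\<^sub>R exp_tail s 1 (0 + X * t) = of_real X powr (s - 1) * (indicator {0<..} t *\<^sub>R exp_tail s X t)"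
    proof (cases "t > 0")
      case True
      have "complex_of_real (X * t) powr (s - 1) = of_real X powr (s - 1) * of_real t powr (s - 1)"
        unfolding of_real_mult using True X by (intro powr_times_real) auto
      then show ?thesis using True X by (simp add: exp_tail_def mult.assoc del: of_real_mult)
    next
      case False
      then show ?thesis using X by (simp add: zero_less_mult_iff)
    qed
  qed
  finally have "Gamma s = of_real X * of_real X powr (s - 1) * (LINT t:{0<..}|lborel. exp_tail s X t)"
    using X by (simp add: set_lebesgue_integral_def scaleR_conv_of_real)
  also have "of_real X * of_real X powr (s - 1) = complex_of_real X powr s"
    using X by (simp add: powr_diff)
  finally show "(LINT t:{0<..}|lborel. exp_tail s X t) = Gamma s * of_real X powr (- s)"
    using X by (simp add: powr_minus field_simps)
  have h1: "set_integrable lborel {0<..<1} (\<lambda>t. t powr (Re s - 1) * exp (- X * t))"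
    by (rule set_integrable_subset[OF h0[OF X]]) auto
  have "(LINT t:{0<..<1}|lborel. norm (exp_tail s X t)) \<le> (LINT t:{0<..<1}|lborel. t powr (Re s - 1) * exp (- X * t))"
    by (rule set_integral_norm_le[OF h1 _ continuous_on_exp_tail le]) auto
  also have "\<dots> \<le> (LINT t:{0..}|lborel. t powr (Re s - 1) * exp (- X * t))"
    unfolding set_lebesgue_integral_def
    by (rule integral_mono) (use h1 h0[OF X] in \<open>auto simp: set_integrable_def split: split_indicator\<close>)
  also have "\<dots> = Gamma (Re s) * X powr (- Re s)"
    using X s by (intro set_integral_Gamma)
  finally show "(LINT t:{0<..<1}|lborel. norm (exp_tail s X t)) \<le> Gamma (Re s) * X powr (- Re s)" .
qed

section \<open>The Epstein zeta function\<close>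

text \<open>
  The parts over \<open>t < 1\<close> of the Mellin integrals of the two theta series, in the variable
  scaled by \<open>\<lambda>\<^sup>2\<close>. The theta transformation exchanges them with tails of Crandall type.
\<close>

definition epstein_low ::
    "nat ^ 'n \<Rightarrow> real ^ 'n \<Rightarrow> real ^ 'n \<Rightarrow> complex \<Rightarrow> real \<Rightarrow> real ^ 'n \<Rightarrow> real \<Rightarrow> complex" where
  "epstein_low \<alpha> x y \<nu> lam z t =
     of_real t powr (\<nu> / 2 - 1) * (gauss_mono \<alpha> (t * (1 / lam\<^sup>2)) (z - x) * phase y z)"

lemma epstein_low_eq:
  "epstein_low \<alpha> x y \<nu> lam z t =
     of_real (mi_pow (z - x) \<alpha>) * phase y z * exp_tail (\<nu> / 2) (pi * (norm ((1 / lam) *\<^sub>R (z - x)))\<^sup>2) t"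
proof -
  have "- pi * (t * (1 / lam\<^sup>2)) * (norm (z - x))\<^sup>2 = - (pi * (norm ((1 / lam) *\<^sub>R (z - x)))\<^sup>2) * t"
    by (simp add: power_divide)
  then show ?thesis
    by (simp only: epstein_low_def gauss_mono_def exp_tail_def of_real_mult mult_ac)
qed

lemma powr_inverse_of_real:
  assumes "t > 0"
  shows "complex_of_real (1 / t) powr a = of_real t powr (- a)"
proof -
  have "Ln (complex_of_real (1 / t)) = of_real (ln (1 / t))"
    using assms by (intro Ln_of_real) simp
  also have "ln (1 / t) = - ln t" using assms by (simp add: ln_div)
  finally show ?thesis using assms by (simp add: powr_def Ln_of_real)
qed

text \<open>With w = z - x and X = \<pi> |w|^2 / lam^2, the complete integral \<Gamma>(\<nu>/2)
  X^(-\<nu>/2) is cut at t = 1, the upper part being the Crandall function. The prefactor cancels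
  \<Gamma>(\<nu>/2) and all constants in X, which leaves |w|^(-\<nu>).\<close>

lemma epstein_term_split:
  assumes z: "z \<noteq> x" and lam: "lam > 0" and \<nu>: "Re \<nu> > 0"
  shows "epstein_term \<alpha> x y \<nu> z = crandall_prefactor lam \<nu> *
     ((LINT t:{0<..<1}|lborel. epstein_low \<alpha> x y \<nu> lam z t) + direct_term \<alpha> x y \<nu> lam (z - x))"
    and "set_integrable lborel {0<..<1} (epstein_low \<alpha> x y \<nu> lam z)"
proof -
  define w where "w = z - x"
  define X where "X = pi * (norm ((1 / lam) *\<^sub>R w))\<^sup>2"
  define s where "s = \<nu> / 2"
  have w: "w \<noteq> 0" "norm w > 0" using z by (simp_all add: w_def)
  have lw: "(1 / lam) *\<^sub>R w \<noteq> 0" using w lam by simp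
  have X: "X > 0" using lw by (simp add: X_def)
  have s: "Re s > 0" using \<nu> by (simp add: s_def)
  have i: "set_integrable lborel {0<..} (exp_tail s X)"
    by (rule set_integrable_exp_tail_full[OF X s])
  have i1: "set_integrable lborel {0<..<1} (exp_tail s X)" by (rule set_integrable_subset[OF i]) auto
  have i2: "set_integrable lborel {1..} (exp_tail s X)" by (rule set_integrable_subset[OF i]) auto
  have low: "epstein_low \<alpha> x y \<nu> lam z = (\<lambda>t. of_real (mi_pow w \<alpha>) * phase y z * exp_tail s X t)"
    by (rule ext) (simp add: epstein_low_eq w_def s_def X_def)
  show "set_integrable lborel {0<..<1} (epstein_low \<alpha> x y \<nu> lam z)"
    unfolding low by (intro set_integrable_mult_right impI i1)
  have "{0 :: real<..} = {0<..<1} \<union> {1..}" "{0 :: real<..<1} \<inter> {1..} = {}" by auto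
  then have "(LINT t:{0<..}|lborel. exp_tail s X t) = (LINT t:{0<..<1}|lborel. exp_tail s X t) + (LINT t:{1..}|lborel. exp_tail s X t)"
    using set_integral_Un[OF _ i1 i2] by simp
  then have split: "(LINT t:{0<..<1}|lborel. exp_tail s X t) + crandall \<nu> (cvec ((1 / lam) *\<^sub>R w)) = Gamma s * of_real X powr (- s)"
    unfolding set_integral_exp_tail_full[OF X s] crandall_cvec[OF lw] by (simp add: X_def s_def)
  have "(LINT t:{0<..<1}|lborel. epstein_low \<alpha> x y \<nu> lam z t) + direct_term \<alpha> x y \<nu> lam (z - x) =
    of_real (mi_pow w \<alpha>) * phase y z * ((LINT t:{0<..<1}|lborel. exp_tail s X t) + crandall \<nu> (cvec ((1 / lam) *\<^sub>R w)))"
    unfolding low by (simp add: direct_term_def w_def algebra_simps)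
  also have "\<dots> = of_real (mi_pow w \<alpha>) * phase y z * (Gamma s * of_real X powr (- s))"
    unfolding split ..
  finally have "crandall_prefactor lam \<nu> * ((LINT t:{0<..<1}|lborel. epstein_low \<alpha> x y \<nu> lam z t) + direct_term \<alpha> x y \<nu> lam (z - x)) =
    of_real (mi_pow w \<alpha>) * phase y z * (rGamma s * Gamma s) * (of_real (pi / lam\<^sup>2) powr s * of_real X powr (- s))"
    by (simp add: crandall_prefactor_def s_def mult_ac)
  also have "rGamma s * Gamma s = 1"
  proof -
    have "s \<notin> \<int>\<^sub>\<le>\<^sub>0" using s by (auto elim!: nonpos_Ints_cases)
    then show ?thesis by (simp add: rGamma_inverse_Gamma Gamma_eq_zero_iff)
  qed
  also have "of_real (pi / lam\<^sup>2) powr s * complex_of_real X powr (- s) = 1 / of_real (norm w) powr \<nu>"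
  proof -
    have a: "pi / lam\<^sup>2 > 0" using lam by simp
    have "X = pi / lam\<^sup>2 * (norm w * norm w)"
      using lam by (simp add: X_def power_divide power2_eq_square)
    then have "complex_of_real X = of_real (pi / lam\<^sup>2) * (of_real (norm w) * of_real (norm w))"
      by (simp only: of_real_mult)
    moreover have "(of_real (pi / lam\<^sup>2) * (of_real (norm w) * of_real (norm w))) powr (- s) =
        complex_of_real (pi / lam\<^sup>2) powr (- s) * (of_real (norm w) * of_real (norm w)) powr (- s)"
      using a by (intro powr_times_real_left) (simp_all only: Reals_of_real Re_complex_of_real less_imp_le)
    moreover have "(of_real (norm w) * of_real (norm w)) powr (- s) = complex_of_real (norm w) powr (- s) * of_real (norm w) powr (- s)"
      by (intro powr_times_real_left) simp_all
    ultimately have "complex_of_real X powr (- s) = of_real (pi / lam\<^sup>2) powr (- s) * (of_real (norm w) powr (- s) * of_real (norm w) powr (- s))"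
      by (simp only:)
    moreover have "of_real (norm w) powr (- s) * of_real (norm w) powr (- s) = complex_of_real (norm w) powr (- \<nu>)"
      using w by (simp add: s_def flip: powr_add)
    moreover have "of_real (pi / lam\<^sup>2) powr s * complex_of_real (pi / lam\<^sup>2) powr (- s) = 1"
      using a lam by (simp del: of_real_divide flip: powr_add)
    ultimately have "of_real (pi / lam\<^sup>2) powr s * complex_of_real X powr (- s) = complex_of_real (norm w) powr (- \<nu>)"
      by (simp only: mult.assoc[symmetric] mult_1_left)
    then show ?thesis by (simp add: powr_minus divide_inverse)
  qed
  finally show "epstein_term \<alpha> x y \<nu> z = crandall_prefactor lam \<nu> *
     ((LINT t:{0<..<1}|lborel. epstein_low \<alpha> x y \<nu> lam z t) + direct_term \<alpha> x y \<nu> lam (z - x))"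
    by (simp add: epstein_term_def w_def)
qed

text \<open>The integrals of the norms are bounded by a constant times |z - x|^(|\<alpha>| - Re
  \<nu>), and this is summable by the assumption on Re \<nu>. Pointwise summability in t comes with
  the theta series.\<close>

lemma has_sum_epstein_low:
  fixes A :: "real ^ 'n ^ 'n"
  assumes A: "invertible A" and lam: "lam > 0" and \<nu>: "Re \<nu> > real CARD('n) + real (mi_abs \<alpha>)"
  shows "((\<lambda>z. LINT t:{0<..<1}|lborel. epstein_low \<alpha> x y \<nu> lam z t) has_sum
     (LINT t:{0<..<1}|lborel. (\<Sum>\<^sub>\<infinity>z\<in>lat A - {x}. epstein_low \<alpha> x y \<nu> lam z t))) (lat A - {x})"
proof -
  let ?f = "\<lambda>z t. indicator {0<..<1} t *\<^sub>R epstein_low \<alpha> x y \<nu> lam z t"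
  define \<sigma> where "\<sigma> = Re \<nu> / 2"
  have \<nu>0: "Re \<nu> > 0" "Re (\<nu> / 2) > 0" using \<nu> by auto
  have "((\<lambda>z. LINT t|lborel. ?f z t) has_sum (LINT t|lborel. (\<Sum>\<^sub>\<infinity>z\<in>lat A - {x}. ?f z t))) (lat A - {x})"
  proof (rule infsum_lebesgue_integral(2))
    show "countable (lat A - {x})" by simp
    show "integrable lborel (?f z)" if "z \<in> lat A - {x}" for z
      using epstein_term_split(2)[OF _ lam \<nu>0(1), of z x \<alpha> y] that by (simp add: set_integrable_def)
    show "(\<lambda>z. LINT t|lborel. norm (?f z t)) summable_on (lat A - {x})"
    proof (rule summable_on_comparison_test)
      show "(\<lambda>z. Gamma \<sigma> * (pi / lam\<^sup>2) powr (- \<sigma>) * norm (z - x) powr (- (Re \<nu> - real (mi_abs \<alpha>)))) summable_on (lat A - {x})"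
        by (intro summable_on_cmult_right summable_on_lat_remove_norm A) (use \<nu> in simp)
      fix z assume z: "z \<in> lat A - {x}"
      define X where "X = pi * (norm ((1 / lam) *\<^sub>R (z - x)))\<^sup>2"
      have n: "norm (z - x) > 0" using z by simp
      have X: "X > 0" using n lam by (simp add: X_def)
      have "(LINT t|lborel. norm (?f z t)) = (LINT t|lborel. norm (mi_pow (z - x) \<alpha>) * (indicator {0<..<1} t *\<^sub>R norm (exp_tail (\<nu> / 2) X t)))"
        unfolding epstein_low_eq X_def[symmetric]
        by (rule Bochner_Integration.integral_cong) (auto simp: norm_mult indicator_def)
      also have "\<dots> = norm (mi_pow (z - x) \<alpha>) * (LINT t:{0<..<1}|lborel. norm (exp_tail (\<nu> / 2) X t))"
        by (simp add: set_lebesgue_integral_def)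
      also have "\<dots> \<le> norm (z - x) ^ mi_abs \<alpha> * (Gamma (Re (\<nu> / 2)) * X powr (- Re (\<nu> / 2)))"
        by (intro mult_mono norm_mi_pow_le set_integral_norm_exp_tail_full X \<nu>0)
           (auto simp: set_lebesgue_integral_def intro!: integral_nonneg_AE)
      also have "X powr (- Re (\<nu> / 2)) = (pi / lam\<^sup>2) powr (- \<sigma>) * norm (z - x) powr (- Re \<nu>)"
      proof -
        have "X = (pi / lam\<^sup>2) * (norm (z - x) * norm (z - x))"
          using lam by (simp add: X_def power_divide power2_eq_square)
        then have "X powr (- \<sigma>) = (pi / lam\<^sup>2) powr (- \<sigma>) * (norm (z - x) powr (- \<sigma>) * norm (z - x) powr (- \<sigma>))"
          by (simp only: powr_mult)
        also have "norm (z - x) powr (- \<sigma>) * norm (z - x) powr (- \<sigma>) = norm (z - x) powr (- Re \<nu>)"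
          by (simp add: \<sigma>_def flip: powr_add)
        finally show ?thesis by (simp add: \<sigma>_def)
      qed
      also have "norm (z - x) ^ mi_abs \<alpha> * (Gamma (Re (\<nu> / 2)) * ((pi / lam\<^sup>2) powr (- \<sigma>) * norm (z - x) powr (- Re \<nu>))) =
         Gamma \<sigma> * (pi / lam\<^sup>2) powr (- \<sigma>) * (norm (z - x) ^ mi_abs \<alpha> * norm (z - x) powr (- Re \<nu>))"
        by (simp add: \<sigma>_def)
      also have "norm (z - x) ^ mi_abs \<alpha> * norm (z - x) powr (- Re \<nu>) = norm (z - x) powr (- (Re \<nu> - real (mi_abs \<alpha>)))"
        using n by (simp flip: powr_realpow powr_add)
      finally show "(LINT t|lborel. norm (?f z t)) \<le> Gamma \<sigma> * (pi / lam\<^sup>2) powr (- \<sigma>) * norm (z - x) powr (- (Re \<nu> - real (mi_abs \<alpha>)))" .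
    qed (auto intro!: integral_nonneg_AE)
    show "(\<lambda>z. ?f z t) summable_on (lat A - {x})" for t
    proof (cases "t \<in> {0<..<1}")
      case True
      then have "t * (1 / lam\<^sup>2) > 0" using lam by simp
      then have "(\<lambda>z. gauss_mono \<alpha> (t * (1 / lam\<^sup>2)) (z - x) * phase y z) summable_on (lat A - {x})"
        by (intro summable_on_subset_banach[OF theta_transformation(1)[OF A]]) auto
      then show ?thesis
        unfolding epstein_low_def by (intro summable_on_scaleR_right summable_on_cmult_right)
    qed simp
  qed
  moreover have "(\<Sum>\<^sub>\<infinity>z\<in>lat A - {x}. ?f z t) = indicator {0<..<1} t *\<^sub>R (\<Sum>\<^sub>\<infinity>z\<in>lat A - {x}. epstein_low \<alpha> x y \<nu> lam z t)" for t
    by (rule infsum_scaleR_right)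
  ultimately show ?thesis
    by (simp add: set_lebesgue_integral_def)
qed

section \<open>The dual side and the identity in the half-plane of convergence\<close>

text \<open>The integrand of a dual term pulled back along t -> 1 / t, Jacobian included, so that it
  can be compared with the theta series at the same t < 1.\<close>

definition dual_low ::
    "nat ^ 'n \<Rightarrow> real ^ 'n \<Rightarrow> complex \<Rightarrow> real \<Rightarrow> real ^ 'n \<Rightarrow> real \<Rightarrow> complex" where
  "dual_low \<alpha> x \<nu> lam p t =
     of_real (1 / t\<^sup>2) * crandall_kernel \<alpha> (of_nat CARD('n) - \<nu>) (lam *\<^sub>R p) (1 / t) * phase x p"

text \<open>Homogeneity of the Hermite polynomial moves \<open>lam\<close> into the argument and
  yields lam^|\<alpha>|, the square root yields lam^d, and the powers of t agree because \<nu>/2 - 1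
  - d/2 = -2 - ((d - \<nu>)/2 - 1).\<close>

lemma theta_term_eq_dual_low:
  fixes p :: "real ^ 'n" and x :: "real ^ 'n"
  assumes t: "t > 0" and lam: "lam > 0"
  shows "of_real t powr (\<nu> / 2 - 1) / of_real (sqrt (t * (1 / lam\<^sup>2)) ^ CARD('n)) *
      (hermite_vec \<alpha> (1 / of_real (t * (1 / lam\<^sup>2))) p * of_real (exp (- pi * (norm p)\<^sup>2 / (t * (1 / lam\<^sup>2)))) * phase x p) =
      of_real (lam ^ (CARD('n) + mi_abs \<alpha>)) * dual_low \<alpha> x \<nu> lam p t"
proof -
  let ?d = "CARD('n)"
  have sq: "sqrt (t * (1 / lam\<^sup>2)) = sqrt t / lam"
    using lam by (simp add: real_sqrt_divide)
  have h: "hermite_vec \<alpha> (1 / of_real (t * (1 / lam\<^sup>2))) p = of_real lam ^ mi_abs \<alpha> * hermite_vec \<alpha> (of_real (1 / t)) (lam *\<^sub>R p)"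
  proof -
    have "1 / complex_of_real (t * (1 / lam\<^sup>2)) = (of_real lam)\<^sup>2 * of_real (1 / t)" by simp
    then show ?thesis by (simp only: hermite_vec_scale)
  qed
  have e: "exp (- pi * (norm p)\<^sup>2 / (t * (1 / lam\<^sup>2))) = exp (- pi * (norm (lam *\<^sub>R p))\<^sup>2 * (1 / t))"
    by (simp add: power_mult_distrib)
  have pw: "of_real t powr (\<nu> / 2 - 1) / of_real (sqrt t ^ ?d) = of_real (1 / t\<^sup>2) * complex_of_real (1 / t) powr ((of_nat ?d - \<nu>) / 2 - 1)"
  proof -
    have "sqrt t ^ ?d = t powr (real ?d / 2)"
      using t by (simp add: powr_half_sqrt[symmetric] powr_power)
    then have 1: "complex_of_real (sqrt t ^ ?d) = of_real t powr (of_nat ?d / 2)"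
      using t by (simp add: powr_of_real[symmetric])
    have "complex_of_real (1 / t) powr ((of_nat ?d - \<nu>) / 2 - 1) = of_real t powr (- ((of_nat ?d - \<nu>) / 2 - 1))"
      by (rule powr_inverse_of_real[OF t])
    moreover have "complex_of_real (1 / t\<^sup>2) = of_real t powr (- 2)"
      using t by (simp add: powr_minus divide_inverse)
    ultimately have "of_real (1 / t\<^sup>2) * complex_of_real (1 / t) powr ((of_nat ?d - \<nu>) / 2 - 1) =
       complex_of_real t powr (- 2 + - ((of_nat ?d - \<nu>) / 2 - 1))"
      by (simp only: powr_add)
    also have "- 2 + - ((of_nat ?d - \<nu>) / 2 - 1) = (\<nu> / 2 - 1) - of_nat ?d / 2"
      by (simp add: field_simps)
    also have "complex_of_real t powr \<dots> = of_real t powr (\<nu> / 2 - 1) / of_real (sqrt t ^ ?d)"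
      unfolding 1 by (rule powr_diff)
    finally show ?thesis by simp
  qed
  have "of_real t powr (\<nu> / 2 - 1) / of_real (sqrt (t * (1 / lam\<^sup>2)) ^ ?d) = (of_real t powr (\<nu> / 2 - 1) / of_real (sqrt t ^ ?d)) * of_real (lam ^ ?d)"
    unfolding sq using lam by (simp add: power_divide)
  then show ?thesis
    unfolding h e pw dual_low_def crandall_kernel_def by (simp add: power_add mult_ac)
qed

text \<open>Inversion turns each integral over t < 1 into the tail integral of a dual term. Away
  from the origin \<open>dual_term_bound\<close> gives the majorant; the origin adds a single term,
  integrable because Re (d - \<nu>) + |\<alpha>| < 0.\<close>

lemma has_sum_dual_low:
  fixes A :: "real ^ 'n ^ 'n" and x y :: "real ^ 'n"
  assumes A: "invertible A" and lam: "lam > 0" and \<nu>: "Re \<nu> > real CARD('n) + real (mi_abs \<alpha>)"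
  defines "D \<equiv> (\<lambda>q. q + y) ` dual_lat A"
  shows "(dual_term \<alpha> x \<nu> lam has_sum (LINT t:{0<..<1}|lborel. (\<Sum>\<^sub>\<infinity>p\<in>D. dual_low \<alpha> x \<nu> lam p t))) D"
    and "set_integrable lborel {0<..<1} (\<lambda>t. \<Sum>\<^sub>\<infinity>p\<in>D. dual_low \<alpha> x \<nu> lam p t)"
    and "\<And>t. t \<in> {0<..<1} \<Longrightarrow> (\<lambda>p. dual_low \<alpha> x \<nu> lam p t) summable_on D"
proof -
  let ?f = "\<lambda>p t. indicator {0<..<1} t *\<^sub>R dual_low \<alpha> x \<nu> lam p t"
  let ?k = "\<lambda>p. crandall_kernel \<alpha> (of_nat CARD('n) - \<nu>) (lam *\<^sub>R p)"
  let ?\<mu> = "of_nat CARD('n) - \<nu>"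
  have \<mu>: "Re ?\<mu> + real (mi_abs \<alpha>) < 0" using \<nu> by simp
  have sub: "{1..} \<subseteq> {0 :: real<..}" "{1<..} \<subseteq> {0 :: real<..}" by auto
  show pt: "(\<lambda>p. dual_low \<alpha> x \<nu> lam p t) summable_on D" if "t \<in> {0<..<1}" for t
  proof -
    have t: "t > 0" "t * (1 / lam\<^sup>2) > 0" using that lam by auto
    let ?c = "complex_of_real (lam ^ (CARD('n) + mi_abs \<alpha>))"
    have "(\<lambda>p. of_real t powr (\<nu> / 2 - 1) / of_real (sqrt (t * (1 / lam\<^sup>2)) ^ CARD('n)) *
      (hermite_vec \<alpha> (1 / of_real (t * (1 / lam\<^sup>2))) p * of_real (exp (- pi * (norm p)\<^sup>2 / (t * (1 / lam\<^sup>2)))) * phase x p)) summable_on D"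
      unfolding D_def by (intro summable_on_cmult_right theta_transformation(2)[OF A t(2)])
    then have "(\<lambda>p. ?c * dual_low \<alpha> x \<nu> lam p t) summable_on D"
      unfolding theta_term_eq_dual_low[OF t(1) lam] .
    then have "(\<lambda>p. 1 / ?c * (?c * dual_low \<alpha> x \<nu> lam p t)) summable_on D"
      by (rule summable_on_cmult_right)
    moreover have "?c \<noteq> 0" using lam by simp
    ultimately show ?thesis by simp
  qed
  obtain M where M: "M summable_on (D - {0})"
    "\<And>p. p \<in> D - {0} \<Longrightarrow> set_integrable lborel {1..} (?k p)"
    "\<And>p. p \<in> D - {0} \<Longrightarrow> (LINT t:{1..}|lborel. norm (?k p t)) \<le> M p"
    using dual_term_bound[OF A lam, of y "Re ?\<mu>" \<alpha> x] unfolding D_def by blast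
  have k: "set_integrable lborel {1..} (?k p)" if "p \<in> D" for p
  proof (cases "p = 0")
    case True
    obtain C where C: "C > 0"
      "\<And>t (u :: real ^ 'n). t > 0 \<Longrightarrow> norm (crandall_kernel \<alpha> ?\<mu> u t) \<le> C * t powr ((Re ?\<mu> + real (mi_abs \<alpha>)) / 2 - 1)"
      using norm_crandall_kernel_le[of \<alpha> ?\<mu>] by blast
    have "set_integrable lborel {1..} (\<lambda>t. C * t powr ((Re ?\<mu> + real (mi_abs \<alpha>)) / 2 - 1))"
      using \<mu> by (intro set_integrable_mult_right impI set_integrable_powr_atLeast_1) auto
    then show ?thesis
      by (rule set_integrable_complex_bound[OF _ _ continuous_on_crandall_kernel[OF sub(1)] C(2)]) auto
  next
    case False
    then show ?thesis using M(2) that by simp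
  qed
  have k': "set_integrable lborel {1<..} (?k p)" if "p \<in> D" for p
    by (rule set_integrable_subset[OF k[OF that]]) auto
  have fint: "integrable lborel (?f p)" if "p \<in> D" for p
  proof -
    have "set_integrable lborel {0<..<1} (\<lambda>t. of_real (1 / t\<^sup>2) * ?k p (1 / t) * phase x p)"
      by (intro set_integrable_mult_left impI set_integrable_inversion[OF continuous_on_crandall_kernel[OF sub(2)] k'[OF that]])
    then show ?thesis by (simp only: set_integrable_def dual_low_def)
  qed
  have fval: "(LINT t|lborel. ?f p t) = dual_term \<alpha> x \<nu> lam p" if "p \<in> D" for p
  proof -
    have "(LINT t|lborel. ?f p t) = (LINT t:{0<..<1}|lborel. of_real (1 / t\<^sup>2) * ?k p (1 / t)) * phase x p"
      unfolding dual_low_def set_lebesgue_integral_def mult_scaleR_left[symmetric] by (rule integral_mult_left_zero)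
    also have "\<dots> = (LINT t:{1..}|lborel. ?k p t) * phase x p"
      unfolding set_integral_inversion[OF continuous_on_crandall_kernel[OF sub(2)] k'[OF that]]
        set_integral_greaterThan_atLeast[OF k[OF that]] ..
    also have "\<dots> = dual_term \<alpha> x \<nu> lam p"
    \<comment> \<open>At the origin the dual term is defined by continuation in \<nu>; in the
      present half-plane the integral converges and already equals that value.\<close>
    proof (cases "p = 0")
      case True
      then show ?thesis
        using integral_crandall_kernel_0[OF \<mu>] by (simp add: dual_term_0 crandall_res_def)
    next
      case False
      then have lp: "lam *\<^sub>R p \<noteq> 0" using lam by simp
      show ?thesis
        unfolding dual_term_def crandall_deriv_cvec[OF lp] nabla_crandall_eq_integral[OF lp] ..
    qed
    finally show ?thesis .
  qed
  have fnorm: "(LINT t|lborel. norm (?f p t)) = (LINT t:{1..}|lborel. norm (?k p t))" if "p \<in> D" for p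
  proof -
    \<comment> \<open>The inversion rule concerns complex functions, so the norms are embedded into
      the complex numbers and taken back at the end.\<close>
    have n: "set_integrable lborel {1..} (\<lambda>t. complex_of_real (norm (?k p t)))"
      using set_integrable_norm[OF k[OF that]] by (simp add: set_integrable_def scaleR_conv_of_real flip: of_real_mult)
    have n': "set_integrable lborel {1<..} (\<lambda>t. complex_of_real (norm (?k p t)))"
      by (rule set_integrable_subset[OF n]) auto
    have "continuous_on {1<..} (\<lambda>t. complex_of_real (norm (?k p t)))"
      by (intro continuous_intros continuous_on_crandall_kernel sub)
    from set_integral_inversion[OF this n']
    have "complex_of_real (LINT t:{0<..<1}|lborel. 1 / t\<^sup>2 * norm (?k p (1 / t))) = complex_of_real (LINT t:{1..}|lborel. norm (?k p t))"
      unfolding set_integral_greaterThan_atLeast[OF n] by (simp only: set_integral_complex_of_real of_real_mult[symmetric])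
    then have "(LINT t:{0<..<1}|lborel. 1 / t\<^sup>2 * norm (?k p (1 / t))) = (LINT t:{1..}|lborel. norm (?k p t))"
      by (simp only: of_real_eq_iff)
    moreover have "(LINT t|lborel. norm (?f p t)) = (LINT t:{0<..<1}|lborel. 1 / t\<^sup>2 * norm (?k p (1 / t)))"
      unfolding set_lebesgue_integral_def
      by (rule Bochner_Integration.integral_cong) (auto simp: dual_low_def norm_mult norm_divide norm_power indicator_def)
    ultimately show ?thesis by simp
  qed
  have nsum: "(\<lambda>p. LINT t|lborel. norm (?f p t)) summable_on D"
  proof -
    have "(\<lambda>p. LINT t|lborel. norm (?f p t)) summable_on (D - {0})"
    proof (rule summable_on_comparison_test[OF M(1)])
      fix p assume p: "p \<in> D - {0}"
      then show "(LINT t|lborel. norm (?f p t)) \<le> M p"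
        by (subst fnorm) (use M(3) in auto)
      show "0 \<le> (LINT t|lborel. norm (?f p t))"
        by (rule Bochner_Integration.integral_nonneg) (rule norm_ge_zero)
    qed
    then have "(\<lambda>p. LINT t|lborel. norm (?f p t)) summable_on insert 0 (D - {0})"
      by (simp only: summable_on_insert_iff)
    then show ?thesis
      by (rule summable_on_subset_banach) auto
  qed
  have Dc: "countable D" unfolding D_def dual_lat_def by simp
  have pt': "(\<lambda>p. ?f p t) summable_on D" for t
    using pt[of t] by (cases "t \<in> {0<..<1}") (auto intro: summable_on_scaleR_right)
  have ind: "(\<Sum>\<^sub>\<infinity>p\<in>D. ?f p t) = indicator {0<..<1} t *\<^sub>R (\<Sum>\<^sub>\<infinity>p\<in>D. dual_low \<alpha> x \<nu> lam p t)" for t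
    by (rule infsum_scaleR_right)
  have "integrable lborel (\<lambda>t. \<Sum>\<^sub>\<infinity>p\<in>D. ?f p t)"
    and hs: "((\<lambda>p. LINT t|lborel. ?f p t) has_sum (LINT t|lborel. (\<Sum>\<^sub>\<infinity>p\<in>D. ?f p t))) D"
    using infsum_lebesgue_integral[OF Dc fint nsum pt'] by blast+
  then show "set_integrable lborel {0<..<1} (\<lambda>t. \<Sum>\<^sub>\<infinity>p\<in>D. dual_low \<alpha> x \<nu> lam p t)"
    unfolding ind set_integrable_def by blast
  have "((\<lambda>p. LINT t|lborel. ?f p t) has_sum (LINT t:{0<..<1}|lborel. (\<Sum>\<^sub>\<infinity>p\<in>D. dual_low \<alpha> x \<nu> lam p t))) D"
    using hs unfolding ind set_lebesgue_integral_def .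
  also have "?this \<longleftrightarrow> (dual_term \<alpha> x \<nu> lam has_sum (LINT t:{0<..<1}|lborel. (\<Sum>\<^sub>\<infinity>p\<in>D. dual_low \<alpha> x \<nu> lam p t))) D"
    by (rule has_sum_cong) (rule fval)
  finally show "(dual_term \<alpha> x \<nu> lam has_sum (LINT t:{0<..<1}|lborel. (\<Sum>\<^sub>\<infinity>p\<in>D. dual_low \<alpha> x \<nu> lam p t))) D" .
qed

lemma
  assumes "Re \<nu> > 0"
  shows set_integrable_powr_unit: "set_integrable lborel {0<..<1} (\<lambda>t. complex_of_real t powr (\<nu> / 2 - 1))"
    and set_integral_powr_unit: "(LINT t:{0<..<1}|lborel. complex_of_real t powr (\<nu> / 2 - 1)) = 2 / \<nu>"
proof -
  have a: "Re (- \<nu> / 2) < 0" using assms by simp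
  let ?F = "\<lambda>t :: real. complex_of_real t powr (- \<nu> / 2 - 1)"
  have i: "set_integrable lborel {1..} ?F"
    by (rule set_integrable_complex_bound[OF set_integrable_powr_atLeast_1[of "- Re \<nu> / 2 - 1"] _ continuous_on_of_real_powr])
       (use assms in \<open>auto simp: norm_of_real_powr\<close>)
  have i': "set_integrable lborel {1<..} ?F" by (rule set_integrable_subset[OF i]) auto
  have c: "continuous_on {1<..} ?F" by (rule continuous_on_of_real_powr) auto
  have e: "indicator {0<..<1} t *\<^sub>R (of_real (1 / t\<^sup>2) * ?F (1 / t)) = indicator {0<..<1} t *\<^sub>R (complex_of_real t powr (\<nu> / 2 - 1))" for t
  proof (cases "t \<in> {0<..<1}")
    case True
    have "?F (1 / t) = of_real t powr (- (- \<nu> / 2 - 1))"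
      using True by (intro powr_inverse_of_real) simp
    moreover have "complex_of_real (1 / t\<^sup>2) = of_real t powr (- 2)"
      using True by (simp add: powr_minus divide_inverse)
    ultimately have "of_real (1 / t\<^sup>2) * ?F (1 / t) = of_real t powr (- 2 + - (- \<nu> / 2 - 1))"
      by (simp only: powr_add)
    then show ?thesis by simp
  qed simp
  show "set_integrable lborel {0<..<1} (\<lambda>t. complex_of_real t powr (\<nu> / 2 - 1))"
    using set_integrable_inversion[OF c i'] unfolding set_integrable_def e .
  have "(LINT t:{0<..<1}|lborel. complex_of_real t powr (\<nu> / 2 - 1)) = (LINT t:{1..}|lborel. ?F t)"
    using set_integral_inversion[OF c i'] unfolding set_integral_greaterThan_atLeast[OF i]
    unfolding set_lebesgue_integral_def e .
  also have "\<dots> = 2 / \<nu>"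
    unfolding set_integral_complex_powr[OF a] by simp
  finally show "(LINT t:{0<..<1}|lborel. complex_of_real t powr (\<nu> / 2 - 1)) = 2 / \<nu>" .
qed

text \<open>The theta transformation at t / lam^2. It needs the complete lattice, so the term z = x
  is added and subtracted again; that term is a constant times t^(\<nu>/2 - 1), and the constant is
  nonzero only for \<alpha> = 0.\<close>

lemma infsum_epstein_low:
  fixes A :: "real ^ 'n ^ 'n"
  assumes A: "invertible A" and lam: "lam > 0" and t: "t > 0"
  shows "(\<Sum>\<^sub>\<infinity>z\<in>lat A - {x}. epstein_low \<alpha> x y \<nu> lam z t) =
    1 / (- 2 * of_real pi * \<i>) ^ mi_abs \<alpha> * of_real (lam ^ (CARD('n) + mi_abs \<alpha>) / covol A) *
      (\<Sum>\<^sub>\<infinity>p\<in>(\<lambda>q. q + y) ` dual_lat A. dual_low \<alpha> x \<nu> lam p t)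
    - (if x \<in> lat A then of_real (mi_pow 0 \<alpha>) * phase y x else 0) * of_real t powr (\<nu> / 2 - 1)"
proof -
  define t' where "t' = t * (1 / lam\<^sup>2)"
  have t': "t' > 0" using t lam by (simp add: t'_def)
  define T where "T = complex_of_real t powr (\<nu> / 2 - 1)"
  define D where "D = (\<lambda>q. q + y) ` dual_lat A"
  define th where "th p = hermite_vec \<alpha> (1 / of_real t') p * of_real (exp (- pi * (norm p)\<^sup>2 / t')) * phase x p" for p
  define g where "g z = gauss_mono \<alpha> t' (z - x) * phase y z" for z
  define c1 where "c1 = (- 2 * complex_of_real pi * \<i>) ^ mi_abs \<alpha>"
  define S where "S = (\<Sum>\<^sub>\<infinity>z\<in>lat A - {x}. g z)"
  have gs: "g summable_on (lat A - {x})"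
    unfolding g_def[abs_def] by (rule summable_on_subset_banach[OF theta_transformation(1)[OF A t']]) auto
  have gx: "g x = of_real (mi_pow 0 \<alpha>) * phase y x"
    by (simp add: g_def gauss_mono_def)
  have "(if x \<in> lat A then g x else 0) + S = 1 / (c1 * of_real (covol A * sqrt t' ^ CARD('n))) * (\<Sum>\<^sub>\<infinity>p\<in>D. th p)"
    using theta_transformation(3)[OF A t', of \<alpha> x y] unfolding S_def infsum_split[OF gs, symmetric]
    unfolding g_def th_def D_def c1_def .
  then have S: "S = 1 / (c1 * of_real (covol A * sqrt t' ^ CARD('n))) * (\<Sum>\<^sub>\<infinity>p\<in>D. th p) - (if x \<in> lat A then g x else 0)"
    by (simp only: eq_diff_eq add.commute)
  have th: "T / of_real (sqrt t' ^ CARD('n)) * th p = of_real (lam ^ (CARD('n) + mi_abs \<alpha>)) * dual_low \<alpha> x \<nu> lam p t" for p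
    unfolding T_def th_def t'_def by (rule theta_term_eq_dual_low[OF t lam])
  have "(\<Sum>\<^sub>\<infinity>z\<in>lat A - {x}. epstein_low \<alpha> x y \<nu> lam z t) = T * S"
    unfolding S_def epstein_low_def T_def g_def t'_def by (rule infsum_cmult_right')
  also have "\<dots> = 1 / (c1 * of_real (covol A)) * (T / of_real (sqrt t' ^ CARD('n)) * (\<Sum>\<^sub>\<infinity>p\<in>D. th p)) - T * (if x \<in> lat A then g x else 0)"
    unfolding S right_diff_distrib by simp
  also have "T / of_real (sqrt t' ^ CARD('n)) * (\<Sum>\<^sub>\<infinity>p\<in>D. th p) = of_real (lam ^ (CARD('n) + mi_abs \<alpha>)) * (\<Sum>\<^sub>\<infinity>p\<in>D. dual_low \<alpha> x \<nu> lam p t)"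
    unfolding infsum_cmult_right'[symmetric] th ..
  finally show ?thesis
    unfolding gx D_def c1_def T_def by (simp add: mult_ac)
qed

text \<open>Integrating the transformed low part over t < 1 gives the dual sum minus \<delta> times
  2 / \<nu>, and this correction is exactly the direct term at the origin. As \<nu> is not 0 here,
  \<open>origin_limit\<close> vanishes.\<close>

lemma epstein_series_eq_rhs:
  fixes A :: "real ^ 'n ^ 'n"
  assumes A: "invertible A" and lam: "lam > 0" and \<nu>: "\<nu> \<in> epstein_halfplane \<alpha>"
  shows "epstein_series A \<alpha> x y \<nu> = epstein_rhs A \<alpha> x y lam \<nu>"
proof -
  define D where "D = (\<lambda>q. q + y) ` dual_lat A"
  define L where "L = (\<lambda>z. z - x) ` lat A - {0}"
  define \<kappa> where "\<kappa> = 1 / (- 2 * of_real pi * \<i>) ^ mi_abs \<alpha> * of_real (lam ^ (CARD('n) + mi_abs \<alpha>) / covol A)"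
  define \<delta> where "\<delta> = (if x \<in> lat A then of_real (mi_pow 0 \<alpha>) * phase y x else 0)"
  define P where "P = crandall_prefactor lam \<nu>"
  define low where "low z = (LINT t:{0<..<1}|lborel. epstein_low \<alpha> x y \<nu> lam z t)" for z
  have Re: "Re \<nu> > real CARD('n) + real (mi_abs \<alpha>)" "Re \<nu> > 0"
    using \<nu> by (auto simp: epstein_halfplane_def)
  have \<nu>0: "\<nu> \<noteq> 0" using Re(2) by auto
  have hs: "(low has_sum (LINT t:{0<..<1}|lborel. (\<Sum>\<^sub>\<infinity>z\<in>lat A - {x}. epstein_low \<alpha> x y \<nu> lam z t))) (lat A - {x})"
    unfolding low_def[abs_def] by (rule has_sum_epstein_low[OF A lam Re(1)])
  have "(\<Sum>\<^sub>\<infinity>z\<in>lat A - {x}. low z) = (LINT t:{0<..<1}|lborel. (\<Sum>\<^sub>\<infinity>z\<in>lat A - {x}. epstein_low \<alpha> x y \<nu> lam z t))"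
    by (rule infsumI[OF hs])
  also have "\<dots> = (LINT t:{0<..<1}|lborel. \<kappa> * (\<Sum>\<^sub>\<infinity>p\<in>D. dual_low \<alpha> x \<nu> lam p t) - \<delta> * of_real t powr (\<nu> / 2 - 1))"
    unfolding \<kappa>_def D_def \<delta>_def
    by (rule set_lebesgue_integral_cong) (simp_all add: infsum_epstein_low[OF A lam])
  also have "\<dots> = \<kappa> * (LINT t:{0<..<1}|lborel. (\<Sum>\<^sub>\<infinity>p\<in>D. dual_low \<alpha> x \<nu> lam p t)) - \<delta> * (LINT t:{0<..<1}|lborel. of_real t powr (\<nu> / 2 - 1))"
  proof (subst set_integral_diff(2))
    show "set_integrable lborel {0<..<1} (\<lambda>t. \<kappa> * (\<Sum>\<^sub>\<infinity>p\<in>D. dual_low \<alpha> x \<nu> lam p t))"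
      unfolding D_def by (intro set_integrable_mult_right impI has_sum_dual_low(2)[OF A lam Re(1)])
    show "set_integrable lborel {0<..<1} (\<lambda>t. \<delta> * of_real t powr (\<nu> / 2 - 1))"
      by (intro set_integrable_mult_right impI set_integrable_powr_unit Re(2))
  qed simp
  also have "(LINT t:{0<..<1}|lborel. (\<Sum>\<^sub>\<infinity>p\<in>D. dual_low \<alpha> x \<nu> lam p t)) = (\<Sum>\<^sub>\<infinity>p\<in>D. dual_term \<alpha> x \<nu> lam p)"
    unfolding D_def by (rule infsumI[OF has_sum_dual_low(1)[OF A lam Re(1)], symmetric])
  also have "(LINT t:{0<..<1}|lborel. complex_of_real t powr (\<nu> / 2 - 1)) = 2 / \<nu>"
    by (rule set_integral_powr_unit[OF Re(2)])
  finally have low_sum: "(\<Sum>\<^sub>\<infinity>z\<in>lat A - {x}. low z) = \<kappa> * (\<Sum>\<^sub>\<infinity>p\<in>D. dual_term \<alpha> x \<nu> lam p) - \<delta> * (2 / \<nu>)" .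
  have ds: "direct_term \<alpha> x y \<nu> lam summable_on L"
    unfolding L_def by (rule summable_on_direct_term[OF A lam])
  have ds': "(\<lambda>z. direct_term \<alpha> x y \<nu> lam (z - x)) summable_on (lat A - {x})"
    using ds unfolding L_def lat_remove_image[symmetric] summable_on_reindex[OF inj_shift] by (simp add: o_def)
  have "epstein_series A \<alpha> x y \<nu> = (\<Sum>\<^sub>\<infinity>z\<in>lat A - {x}. P * (low z + direct_term \<alpha> x y \<nu> lam (z - x)))"
    unfolding epstein_series_def P_def low_def
    by (rule infsum_cong) (rule epstein_term_split(1)[OF _ lam Re(2)], simp)
  also have "\<dots> = P * ((\<Sum>\<^sub>\<infinity>z\<in>lat A - {x}. low z) + (\<Sum>\<^sub>\<infinity>z\<in>lat A - {x}. direct_term \<alpha> x y \<nu> lam (z - x)))"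
    using has_sum_imp_summable[OF hs] ds' by (simp add: infsum_cmult_right' infsum_add)
  also have "(\<Sum>\<^sub>\<infinity>z\<in>lat A - {x}. direct_term \<alpha> x y \<nu> lam (z - x)) = (\<Sum>\<^sub>\<infinity>z\<in>L. direct_term \<alpha> x y \<nu> lam z)"
    unfolding L_def lat_remove_image[symmetric] infsum_reindex[OF inj_shift] by (simp add: o_def)
  finally have series: "epstein_series A \<alpha> x y \<nu> = P * (\<kappa> * (\<Sum>\<^sub>\<infinity>p\<in>D. dual_term \<alpha> x \<nu> lam p) - \<delta> * (2 / \<nu>) + (\<Sum>\<^sub>\<infinity>z\<in>L. direct_term \<alpha> x y \<nu> lam z))"
    unfolding low_sum .
  have "epstein_rhs A \<alpha> x y lam \<nu> = P * (((if x \<in> lat A then direct_term \<alpha> x y \<nu> lam 0 else 0) + (\<Sum>\<^sub>\<infinity>z\<in>L. direct_term \<alpha> x y \<nu> lam z)) +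
       \<kappa> * (\<Sum>\<^sub>\<infinity>p\<in>D. dual_term \<alpha> x \<nu> lam p))"
    unfolding epstein_rhs_def P_def \<kappa>_def L_def D_def
        infsum_split[OF summable_on_direct_term[OF A lam]] zero_mem_lat_shift
    using \<nu>0 by (simp add: origin_limit_def)
  moreover have "(if x \<in> lat A then direct_term \<alpha> x y \<nu> lam 0 else 0) = - \<delta> * (2 / \<nu>)"
    by (simp add: direct_term_0 \<delta>_def)
  ultimately show ?thesis
    unfolding series by (simp add: algebra_simps)
qed

section \<open>Identification with the meromorphic continuation\<close>

text \<open>Removing singularities normalises the right-hand side at its possible pole d +
  |\<alpha>|. That point lies on the boundary of the open half-plane, so no value inside is
  changed.\<close>

lemma is_merom_cont_epstein:
  fixes A :: "real ^ 'n ^ 'n"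
  assumes A: "invertible A" and lam: "lam > 0"
  shows "is_merom_cont (epstein_series A \<alpha> x y) (epstein_halfplane \<alpha>) (remove_sings (epstein_rhs A \<alpha> x y lam))"
  unfolding is_merom_cont_def
proof (intro conjI ballI)
  show "remove_sings (epstein_rhs A \<alpha> x y lam) nicely_meromorphic_on UNIV"
    by (rule remove_sings_nicely_meromorphic[OF epstein_rhs_meromorphic(1)[OF A lam]])
  fix \<nu> assume \<nu>: "\<nu> \<in> epstein_halfplane \<alpha>"
  then have "\<nu> \<noteq> of_nat (CARD('n) + mi_abs \<alpha>)"
    by (auto simp: epstein_halfplane_def)
  then have "epstein_rhs A \<alpha> x y lam analytic_on {\<nu>}"
    by (intro epstein_rhs_meromorphic(2)[OF A lam]) simp
  then show "remove_sings (epstein_rhs A \<alpha> x y lam) \<nu> = epstein_series A \<alpha> x y \<nu>"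
    using epstein_series_eq_rhs[OF A lam \<nu>, of x y] by simp
qed

lemma epstein_zeta_eq:
  fixes A :: "real ^ 'n ^ 'n"
  assumes A: "invertible A" and lam: "lam > 0"
  shows "epstein_zeta A \<nu> \<alpha> x y = remove_sings (epstein_rhs A \<alpha> x y lam) \<nu>"
proof -
  \<comment> \<open>Uniqueness of the continuation requires the half-plane to be nonempty.\<close>
  have "complex_of_real (real (CARD('n) + mi_abs \<alpha>) + 1) \<in> epstein_halfplane \<alpha>"
    by (simp add: epstein_halfplane_def)
  then show ?thesis
    unfolding epstein_zeta_def
    using merom_cont_eqI[OF is_merom_cont_epstein[OF A lam] open_epstein_halfplane] by metis
qed

lemma epstein_zeta_eq_rhs:
  fixes A :: "real ^ 'n ^ 'n"
  assumes A: "invertible A" and lam: "lam > 0"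
    and "y \<in> dual_lat A \<and> chi \<alpha> = 1 \<longrightarrow> \<nu> \<noteq> of_nat (CARD('n) + mi_abs \<alpha>)"
  shows "epstein_zeta A \<nu> \<alpha> x y = epstein_rhs A \<alpha> x y lam \<nu>"
  unfolding epstein_zeta_eq[OF A lam]
  using epstein_rhs_meromorphic(2)[OF A lam assms(3)] by simp

text \<open>Summability, existence of the continuation, differentiability and convergence are
  asserted beside the formulas because \<open>infsum\<close>, \<open>merom_cont\<close>,
  \<open>deriv\<close> and \<open>Lim\<close> are total operators, whose values carry the intended
  meaning only together with such facts.\<close>

theorem theorem2p9:
  fixes A :: "real ^ 'n ^ 'n" and \<alpha> :: "nat ^ 'n"
  assumes "invertible A"
  shows
    "(\<forall>x y.
        (\<forall>\<nu>\<in>epstein_halfplane \<alpha>. epstein_term \<alpha> x y \<nu> summable_on (lat A - {x})) \<and>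
        is_merom_cont (epstein_series A \<alpha> x y) (epstein_halfplane \<alpha>)
          (\<lambda>\<nu>. epstein_zeta A \<nu> \<alpha> x y)) \<and>
     (\<forall>(x :: real ^ 'n) (y :: real ^ 'n) (\<nu> :: complex) (lam :: real).
        (y \<in> dual_lat A \<and> chi \<alpha> = 1 \<longrightarrow> \<nu> \<noteq> of_nat (CARD('n) + mi_abs \<alpha>)) \<and> lam > 0 \<longrightarrow>
        direct_term \<alpha> x y \<nu> lam summable_on ((\<lambda>z. z - x) ` lat A) \<and>
        dual_term \<alpha> x \<nu> lam summable_on ((\<lambda>q. q + y) ` dual_lat A) \<and>
        epstein_zeta A \<nu> \<alpha> x y =
          crandall_prefactor lam \<nu> *
            ((\<Sum>\<^sub>\<infinity>z\<in>(\<lambda>z. z - x) ` lat A. direct_term \<alpha> x y \<nu> lam z) +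
             1 / (- 2 * of_real pi * \<i>) ^ mi_abs \<alpha> *
             of_real (lam ^ (CARD('n) + mi_abs \<alpha>) / covol A) *
             (\<Sum>\<^sub>\<infinity>p\<in>(\<lambda>q. q + y) ` dual_lat A. dual_term \<alpha> x \<nu> lam p))
          + origin_limit A \<alpha> x y \<nu>) \<and>
     (\<forall>(\<nu> :: complex) (u :: complex ^ 'n). u \<in> crandall_dom \<longrightarrow>
        (\<forall>j. (pd_line j (nabla \<alpha> (crandall \<nu>)) u has_field_derivative
                nabla (\<alpha> + axis j 1) (crandall \<nu>) u) (at (u $ j))) \<and>
        nabla \<alpha> (crandall \<nu>) u =
          (\<Sum>\<beta> | \<forall>j. 2 * \<beta> $ j \<le> \<alpha> $ j.
             p_poly \<alpha> \<beta> u * crandall (\<nu> + 2 * of_nat (mi_abs \<alpha>) - 2 * of_nat (mi_abs \<beta>)) u)) \<and>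
     (\<forall>\<nu> :: complex. Re \<nu> + real (mi_abs \<alpha>) < 0 \<longrightarrow>
        ((\<lambda>u :: real ^ 'n. nabla \<alpha> (crandall \<nu>) (cvec u)) \<longlongrightarrow>
           - 2 * of_nat (chi \<alpha>) * p_poly \<alpha> (mi_half \<alpha>) 0 / (\<nu> + of_nat (mi_abs \<alpha>))) (at 0)) \<and>
     (let R = (\<lambda>\<nu> :: complex.
          - 2 * of_nat (chi \<alpha>) * p_poly \<alpha> (mi_half \<alpha>) 0 / (\<nu> + of_nat (mi_abs \<alpha>)))
      in is_merom_cont (crandall_lim0 \<alpha>) {\<nu>. Re \<nu> + real (mi_abs \<alpha>) < 0} R \<and>
         (\<forall>\<nu>. crandall_deriv \<alpha> \<nu> 0 = R \<nu>) \<and>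
         R holomorphic_on (- {- of_nat (mi_abs \<alpha>)}) \<and>
         (is_pole R (- of_nat (mi_abs \<alpha>)) \<and> zorder R (- of_nat (mi_abs \<alpha>)) = - 1
            \<longleftrightarrow> chi \<alpha> = 1))"
proof (intro conjI allI ballI impI, goal_cases)
  case (1 x y \<nu>)
  then show ?case by (rule summable_on_epstein_term[OF assms])
next
  case (2 x y)
  \<comment> \<open>Any positive value of \<open>lam\<close> represents the same continuation; 1 is
    taken.\<close>
  have "(\<lambda>\<nu>. epstein_zeta A \<nu> \<alpha> x y) = remove_sings (epstein_rhs A \<alpha> x y 1)"
    by (rule ext) (rule epstein_zeta_eq[OF assms zero_less_one])
  then show ?case
    using is_merom_cont_epstein[OF assms zero_less_one] by simp
next
  case (3 x y \<nu> lam)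
  then show ?case
    by (intro summable_on_from_remove[OF summable_on_direct_term[OF assms]]) simp
next
  case (4 x y \<nu> lam)
  then show ?case
    by (intro summable_on_from_remove[OF summable_on_dual_term[OF assms]]) simp
next
  case (5 x y \<nu> lam)
  then show ?case
    using epstein_zeta_eq_rhs[OF assms, of lam y \<alpha> \<nu> x] unfolding epstein_rhs_def by blast
next
  case (6 \<nu> u j)
  then show ?case by (rule nabla_crandall_line_derivative)
next
  case (7 \<nu> u)
  then show ?case by (simp only: nabla_crandall crandall_sum_def)
next
  case (8 \<nu>)
  then show ?case by (rule tendsto_nabla_crandall_0)
next
  case 9
  show ?case
    unfolding Let_def crandall_res_def[symmetric]
    using is_merom_cont_crandall_lim0[of \<alpha>] crandall_deriv_0[of \<alpha>]
      simple_fraction(1,4)[of "crandall_res \<alpha>" "- of_nat (mi_abs \<alpha>)"] crandall_res_eq_0_iff[of \<alpha>]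
    by (simp only: diff_minus_eq_add) simp
qed

end
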